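(* Let $H\in[\tfrac12,1)$, let $(B^H_t)_{t\in[0,1]}$ be a fractional Brownian motion with Hurst index $H$, let $x\in\mathbb{R}$, let $f\in C^{0,1}_b([0,1]\times\mathbb{R})$, and let $(X_t)_{t\in[0,1]}$ be a solution of $$X_t = x+\int_0^t f(s,X_s)\,ds + B^H_t,\qquad t\in[0,1] .$$ Let $a=(a_0,\dots,a_p)$ be a filter with order $M(a)>H+\frac14$. If $\alpha\ge 1$, $\alpha>\max\left(\frac{2H-1}{2-2H},\frac{1}{4-4H}\right)$ and $\Delta=n^{-\alpha}$, then $$\sqrt{n}\,V(a,n,\Delta,X)\xrightarrow{(d)} N(0,\sigma_H)\qquad (n\to\infty),$$ where $\sigma_H>0$ is the variance of the limit in the central limit theorem for the quadratic $a$-variation of fractional Brownian motion.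
   Context: Fractional Brownian motion $(B^H_t)_{t\in T}$ with Hurst index $H\in(0,1)$ on an interval $T$ is the centered Gaussian process with covariance $\mathbb{E}[B^H_tB^H_s]=\frac12(t^{2H}+s^{2H}-|t-s|^{2H})$. $f\in C^{0,1}_b(T\times\mathbb{R})$ means that $f(s,x)$ is continuous in the time component $s$, continuously differentiable in the space component $x$, and that $f$ and its derivative $f'$ with respect to the second variable are bounded, $\|f\|_\infty+\|f'\|_\infty\le M$ for a fixed constant $M>0$. A filter of length $p+1$ ($p\in\mathbb{N}$, $p\ge1$) is a tuple $a=(a_0,\dots,a_p)$ of real numbers with $\sum_{q=0}^p a_q=0$. Its order $M(a)$ is the order of its first non-zero moment: $\sum_{i=0}^p a_i i^k=0$ for $0\le k<M(a)$ and $\sum_{i=0}^p a_i i^{M(a)}\ne0$ (in particular $a$ is not identically zero). For a process $Z$ and mesh size $\Delta>0$ put $\Delta_aZ_j=\sum_{i=0}^p a_i Z_{(i+j)\Delta}$. Put $\sigma_{a,\Delta}=\operatorname{Var}(\Delta_aB^H_j)=-\frac{\Delta^{2H}}{2}\sum_{k,l=0}^p a_ka_l|k-l|^{2H}$. For $Z=X$ or $Z=B^H$ and $n>p$, the quadratic $a$-variation is $$V(a,n,\Delta,Z)=\frac1n\sum_{j=1}^{n-p}\left(\frac{(\Delta_aZ_j)^2}{\sigma_{a,\Delta}}-1\right).$$ The constant $\sigma_H>0$ (depending on $H$ and $a$) is the one from the known central limit theorem: if $M(a)>H+\frac14$, then $\sqrt n\,V(a,n,\Delta,B^H)\xrightarrow{(d)}N(0,\sigma_H)$,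 with $\Delta=n^{-\alpha}$. Here $N(0,\sigma)$ is the centered normal law with variance $\sigma$, and $\xrightarrow{(d)}$ is convergence in distribution. *)

theory Defs
  imports "HOL-Probability.Probability"
begin

section \<open>Gaussian processes and fractional Brownian motion\<close>

text \<open>The second parameter is the variance, not the standard deviation.\<close>

definition normal_law :: "real \<Rightarrow> real \<Rightarrow> real measure" where
  "normal_law \<mu> v =
    (if v = 0 then return borel \<mu> else density lborel (normal_density \<mu> (sqrt v)))"

definition gaussian_process :: "'w measure \<Rightarrow> real set \<Rightarrow> (real \<Rightarrow> 'w \<Rightarrow> real) \<Rightarrow> bool" where
  "gaussian_process M T Z \<longleftrightarrow>
    (\<forall>t\<in>T. Z t \<in> borel_measurable M) \<and>
    (\<forall>I c. finite I \<and> I \<subseteq> T \<longrightarrow>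
      (\<exists>\<mu> v. 0 \<le> v \<and> distr M borel (\<lambda>\<omega>. \<Sum>t\<in>I. c t * Z t \<omega>) = normal_law \<mu> v))"

definition fractional_brownian_motion ::
    "'w measure \<Rightarrow> real set \<Rightarrow> real \<Rightarrow> (real \<Rightarrow> 'w \<Rightarrow> real) \<Rightarrow> bool" where
  "fractional_brownian_motion M T H B \<longleftrightarrow>
    gaussian_process M T B \<and>
    (\<forall>t\<in>T. prob_space.expectation M (B t) = 0) \<and>
    (\<forall>t\<in>T. \<forall>s\<in>T. prob_space.expectation M (\<lambda>\<omega>. B t \<omega> * B s \<omega>) =
        (t powr (2 * H) + s powr (2 * H) - \<bar>t - s\<bar> powr (2 * H)) / 2)"


section \<open>The stochastic differential equation\<close>

text \<open>The last conjunct says that \<open>\<parallel>f\<parallel>\<^sub>\<infinity> + \<parallel>f'\<parallel>\<^sub>\<infinity> \<le> K\<close>, the two suprema being taken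
  independently of each other.\<close>

definition C01b :: "real set \<Rightarrow> (real \<Rightarrow> real \<Rightarrow> real) \<Rightarrow> bool" where
  "C01b T f \<longleftrightarrow>
    (\<forall>y. continuous_on T (\<lambda>s. f s y)) \<and>
    (\<forall>s\<in>T. f s C1_differentiable_on UNIV) \<and>
    (\<exists>K>0. \<forall>s\<in>T. \<forall>r\<in>T. \<forall>y z. \<bar>f s y\<bar> + \<bar>deriv (f r) z\<bar> \<le> K)"

text \<open>Joint measurability is what makes the pathwise integral of \<open>f s (X s \<omega>)\<close> meaningful as a
  random variable. It is asked for up to indistinguishability only, so every process with almost
  surely continuous paths qualifies.\<close>

definition measurable_process :: "'w measure \<Rightarrow> real set \<Rightarrow> (real \<Rightarrow> 'w \<Rightarrow> real) \<Rightarrow> bool" where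
  "measurable_process M T Z \<longleftrightarrow>
    (\<forall>t\<in>T. Z t \<in> borel_measurable M) \<and>
    (\<exists>Z'. (\<lambda>(t, \<omega>). Z' t \<omega>) \<in> borel_measurable (restrict_space borel T \<Otimes>\<^sub>M M) \<and>
          (AE \<omega> in M. \<forall>t\<in>T. Z t \<omega> = Z' t \<omega>))"

definition sde_solution ::
    "'w measure \<Rightarrow> real \<Rightarrow> (real \<Rightarrow> real \<Rightarrow> real) \<Rightarrow> (real \<Rightarrow> 'w \<Rightarrow> real) \<Rightarrow> (real \<Rightarrow> 'w \<Rightarrow> real) \<Rightarrow> bool"
  where
  "sde_solution M x f B X \<longleftrightarrow>
    measurable_process M {0..1} X \<and>
    (AE \<omega> in M. \<forall>t\<in>{0..1}.
        set_integrable lborel {0..t} (\<lambda>s. f s (X s \<omega>)) \<and>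
        X t \<omega> = x + (LBINT s:{0..t}. f s (X s \<omega>)) + B t \<omega>)"


section \<open>Filters and quadratic variations\<close>

text \<open>A filter \<open>(a\<^sub>0, \<dots>, a\<^sub>p)\<close> is a sequence of which only the first \<open>p + 1\<close> terms are used.
  Note \<open>0 ^ 0 = 1\<close>, so the moment of order \<open>0\<close> is the sum of the coefficients.\<close>

definition zero_sum_filter :: "nat \<Rightarrow> (nat \<Rightarrow> real) \<Rightarrow> bool" where
  "zero_sum_filter p a \<longleftrightarrow> 1 \<le> p \<and> (\<Sum>q\<le>p. a q) = 0"

definition has_filter_order :: "nat \<Rightarrow> (nat \<Rightarrow> real) \<Rightarrow> nat \<Rightarrow> bool" where
  "has_filter_order p a m \<longleftrightarrow>
    (\<forall>k<m. (\<Sum>i\<le>p. a i * real i ^ k) = 0) \<and> (\<Sum>i\<le>p. a i * real i ^ m) \<noteq> 0"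

definition filter_increment ::
    "nat \<Rightarrow> (nat \<Rightarrow> real) \<Rightarrow> real \<Rightarrow> (real \<Rightarrow> 'w \<Rightarrow> real) \<Rightarrow> nat \<Rightarrow> 'w \<Rightarrow> real" where
  "filter_increment p a \<Delta> Z j \<omega> = (\<Sum>i\<le>p. a i * Z (real (i + j) * \<Delta>) \<omega>)"

text \<open>The variance of \<open>filter_increment p a \<Delta> B j\<close> for a fractional Brownian motion \<open>B\<close>.\<close>

definition increment_variance :: "real \<Rightarrow> nat \<Rightarrow> (nat \<Rightarrow> real) \<Rightarrow> real \<Rightarrow> real" where
  "increment_variance H p a \<Delta> =
    - (\<Delta> powr (2 * H) / 2) * (\<Sum>k\<le>p. \<Sum>l\<le>p. a k * a l * \<bar>real k - real l\<bar> powr (2 * H))"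

definition quadratic_variation ::
    "real \<Rightarrow> nat \<Rightarrow> (nat \<Rightarrow> real) \<Rightarrow> nat \<Rightarrow> real \<Rightarrow> (real \<Rightarrow> 'w \<Rightarrow> real) \<Rightarrow> 'w \<Rightarrow> real" where
  "quadratic_variation H p a n \<Delta> Z \<omega> =
    1 / real n * (\<Sum>j=1..n - p.
      ((filter_increment p a \<Delta> Z j \<omega>)\<^sup>2 / increment_variance H p a \<Delta> - 1))"

definition quadratic_variation_clt ::
    "'w measure \<Rightarrow> real \<Rightarrow> nat \<Rightarrow> (nat \<Rightarrow> real) \<Rightarrow> real \<Rightarrow> (real \<Rightarrow> 'w \<Rightarrow> real) \<Rightarrow> real \<Rightarrow> bool" where
  "quadratic_variation_clt M H p a \<alpha> Z v \<longleftrightarrow>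
    weak_conv_m
      (\<lambda>n. distr M borel
        (\<lambda>\<omega>. sqrt (real n) * quadratic_variation H p a n (real n powr (- \<alpha>)) Z \<omega>))
      (normal_law 0 v)"

text \<open>The variance of the limit in the central limit theorem for fractional Brownian motion
  itself. It is determined by \<open>H\<close> and the filter: the law of the quadratic variation depends neither
  on the probability space nor, by self-similarity, on \<open>\<alpha>\<close>. The condition \<open>1 \<le> \<alpha>\<close> keeps the
  sampling times in \<open>{0..1}\<close>. Fixing the type of sample points to \<open>real \<Rightarrow> real\<close> is no restriction,
  since the law of any process can be realised by the coordinate process on path space.\<close>

definition is_fbm_clt_variance :: "real \<Rightarrow> nat \<Rightarrow> (nat \<Rightarrow> real) \<Rightarrow> real \<Rightarrow> bool" where
  "is_fbm_clt_variance H p a v \<longleftrightarrow>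
    0 < v \<and>
    (\<forall>(M :: (real \<Rightarrow> real) measure) B \<alpha>.
      prob_space M \<and> fractional_brownian_motion M {0..1} H B \<and> 1 \<le> \<alpha> \<longrightarrow>
      quadratic_variation_clt M H p a \<alpha> B v)"

definition fbm_clt_variance :: "real \<Rightarrow> nat \<Rightarrow> (nat \<Rightarrow> real) \<Rightarrow> real" where
  "fbm_clt_variance H p a = (THE v. is_fbm_clt_variance H p a v)"

end

theory Submission
  imports Defs "HOL-Real_Asymp.Real_Asymp"
begin

text \<open>Let \<open>G\<^sub>j\<close> be the normalised filtered increments of the fractional Brownian motion; their correlations
  \<open>\<rho>\<close> satisfy \<open>\<bar>\<rho> k\<bar> \<le> C (k + 1) powr - s\<close> with \<open>s = min (2 m - 2 H) (3/4) > 1/2\<close>.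

  Central limit theorem: with \<open>F = (1 / \<surd>n) \<Sum> (G\<^sub>j\<^sup>2 - 1)\<close> and \<open>Q = (1/n) \<Sum> \<rho> (j - k) G\<^sub>j G\<^sub>k\<close>, Gaussian integration by parts
  gives \<open>E (F exp (i t F)) = 2 i t E (Q exp (i t F))\<close>. The variance of \<open>Q\<close> tends to \<open>0\<close>, so the characteristic function of
  \<open>F\<close> satisfies \<open>\<phi>' = - t v \<phi>\<close> up to a small error, and the limit law is normal with variance
  \<open>v = 2 \<Sum>\<^bsub>k\<in>\<int>\<^esub> \<rho> k\<^sup>2\<close>.

  Solutions of the equation: the quadratic variations of \<open>X\<close> and \<open>B\<close> differ by a cross term and a drift term. The latter
  is of order \<open>\<surd>n \<Delta> powr (2 - 2 H)\<close>. The cross term is an integral over small \<open>u\<close> of \<open>\<Sum> D\<^sub>j f (t\<^sub>j + u) (X (t\<^sub>j + u))\<close>, where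
  \<open>D\<^sub>j\<close> are the filtered increments of \<open>B\<close>. As \<open>f\<close> is merely continuous in time, \<open>X\<close> is frozen at the beginning of dyadic blocks
  while the time argument of \<open>f\<close> is kept; a Sobolev estimate in space replaces the supremum over the frozen value by
  covariances of the \<open>D\<^sub>j\<close>, and the dependence of \<open>X\<close> on the increments plays no role.\<close>

section \<open>Joint characteristic functions\<close>

text \<open>Normality is given only for linear combinations, while integration by parts needs
  independence of the regression residuals. It is obtained by comparing joint characteristic
  functions, and uniqueness of a joint law is reduced to the one-dimensional theorem by exchanging
  exponentials for indicators, one coordinate at a time.

  The bound s > 1/2 is the condition m > H + 1/4 in disguise (apart from the cap at 3/4). It makes
  the correlations square summable and lets the bound n powr (1 - 2 s) for the variance of Q tend to
  0.

  The price of the Sobolev estimate is the square root of a first moment of increments of X, which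
  turns the natural power Delta powr (2 H) into Delta powr (3 H / 2). After the integration over u,
  which gains a factor Delta, and the division by sqrt n Delta powr (2 H), three powers of n remain;
  all are negative when alpha >= 1 and alpha (1 - H) > 1/4.\<close>

lemma integrable_bounded_complex:
  fixes f :: "'a \<Rightarrow> complex"
  assumes "prob_space M" "f \<in> borel_measurable M" "\<And>x. norm (f x) \<le> C"
  shows "integrable M f"
proof -
  interpret prob_space M by fact
  show ?thesis
    by (rule integrable_const_bound[of _ C]) (use assms in auto)
qed

lemma norm_iexp_times: "norm (iexp x * z) = norm z"
  by (simp add: norm_mult)

text \<open>Adding \<open>2\<close> to the bounded weight \<open>Z\<close> makes it positive, so that it can serve as a density.\<close>

lemma weighted_law_unique_real:
  fixes Y :: "'a \<Rightarrow> real" and Y' :: "'b \<Rightarrow> real" and Z :: "'a \<Rightarrow> real" and Z' :: "'b \<Rightarrow> real"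
  assumes M: "prob_space M" and N: "prob_space N"
    and [measurable]: "Y \<in> borel_measurable M" "Z \<in> borel_measurable M"
      "Y' \<in> borel_measurable N" "Z' \<in> borel_measurable N"
    and Z: "\<And>x. \<bar>Z x\<bar> \<le> 1" and Z': "\<And>x. \<bar>Z' x\<bar> \<le> 1"
    and eq0: "\<And>s. (CLINT x|M. iexp (s * Y x)) = (CLINT x|N. iexp (s * Y' x))"
    and eqZ: "\<And>s. (CLINT x|M. iexp (s * Y x) * of_real (Z x)) = (CLINT x|N. iexp (s * Y' x) * of_real (Z' x))"
    and A: "A \<in> sets borel"
  shows "(LINT x|M. indicator A (Y x) * Z x) = (LINT x|N. indicator A (Y' x) * Z' x)"
proof -
  interpret M: prob_space M by fact
  interpret N: prob_space N by fact
  have [measurable]: "A \<in> sets borel" by (rule A)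
  have intZ: "integrable M Z" by (rule M.integrable_const_bound[of _ 1]) (use Z in auto)
  have intZ': "integrable N Z'" by (rule N.integrable_const_bound[of _ 1]) (use Z' in auto)
  have eqmass: "(LINT x|M. Z x) = (LINT x|N. Z' x)"
    using eqZ[of 0] by (simp add: integral_complex_of_real)
  \<comment> \<open>Reweighting by \<open>(2 + W x) / c\<close>, where \<open>c >= 1\<close>, gives
    a probability density. The characteristic function and the probability of \<open>A\<close> under
    it are affine in the plain and the weighted integrals, so the two hypotheses together fix the
    reweighted law.\<close>
  have gen: "real_distribution (distr (density P (\<lambda>x. ennreal ((2 + W x) / c))) borel V) \<and>
      (\<forall>s. char (distr (density P (\<lambda>x. ennreal ((2 + W x) / c))) borel V) s =
        (2 * (CLINT x|P. iexp (s * V x)) + (CLINT x|P. iexp (s * V x) * of_real (W x))) / of_real c) \<and>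
      measure (distr (density P (\<lambda>x. ennreal ((2 + W x) / c))) borel V) A =
        (2 * (LINT x|P. indicator A (V x)) + (LINT x|P. indicator A (V x) * W x)) / c"
    if P: "prob_space P" and [measurable]: "V \<in> borel_measurable P" "W \<in> borel_measurable P"
      and W: "\<And>x. \<bar>W x\<bar> \<le> 1" and c: "c = 2 + (LINT x|P. W x)"
    for P :: "'c measure" and V W :: "'c \<Rightarrow> real" and c
  proof -
    interpret P: prob_space P by fact
    have iW: "integrable P W" by (rule P.integrable_const_bound[of _ 1]) (use W in auto)
    have "-1 \<le> (LINT x|P. W x)"
      by (rule P.integral_ge_const[OF iW]) (use W in \<open>auto simp: abs_le_iff minus_le_iff\<close>)
    then have c0: "c > 0" using c by simp
    have W0: "0 \<le> (2 + W x) / c" for x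
      using W[of x] c0 by (auto simp: abs_le_iff)
    let ?D = "density P (\<lambda>x. ennreal ((2 + W x) / c))"
    have "emeasure ?D (space ?D) = ennreal (LINT x|P. (2 + W x) / c)"
      by (simp add: emeasure_density nn_integral_eq_integral W0 iW del: Bochner_Integration.integral_divide_zero
            Bochner_Integration.integral_add cong: nn_integral_cong)
    also have "(LINT x|P. (2 + W x) / c) = 1"
      using iW c0 c by (simp add: P.prob_space)
    finally have D: "prob_space ?D" by (intro prob_spaceI) simp
    interpret D: prob_space ?D by fact
    have rd: "real_distribution (distr ?D borel V)"
      by (rule D.real_distribution_distr) simp
    have ch: "char (distr ?D borel V) s =
        (2 * (CLINT x|P. iexp (s * V x)) + (CLINT x|P. iexp (s * V x) * of_real (W x))) / of_real c" for s
    proof -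
      have i1: "integrable P (\<lambda>x. iexp (s * V x))"
        by (rule integrable_bounded_complex[OF P, of _ 1]) auto
      have i2: "integrable P (\<lambda>x. iexp (s * V x) * of_real (W x))"
        by (rule integrable_bounded_complex[OF P, of _ 1]) (use W in \<open>auto simp: norm_mult\<close>)
      have "char (distr ?D borel V) s = (CLINT x|?D. iexp (s * V x))"
        unfolding char_def by (subst integral_distr) auto
      also have "\<dots> = (CLINT x|P. ((2 + W x) / c) *\<^sub>R iexp (s * V x))"
        by (subst integral_density) (use W0 in auto)
      also have "\<dots> = (CLINT x|P. (2 * iexp (s * V x) + iexp (s * V x) * of_real (W x)) / of_real c)"
        by (intro Bochner_Integration.integral_cong) (auto simp: scaleR_conv_of_real field_simps)
      also have "\<dots> = (2 * (CLINT x|P. iexp (s * V x)) + (CLINT x|P. iexp (s * V x) * of_real (W x))) / of_real c"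
        using i1 i2 by simp
      finally show ?thesis .
    qed
    have "measure (distr ?D borel V) A = (LINT x|distr ?D borel V. indicator A x)"
      by simp
    also have "\<dots> = (LINT x|?D. indicator A (V x))"
      by (subst integral_distr) auto
    also have "\<dots> = (LINT x|P. ((2 + W x) / c) *\<^sub>R indicator A (V x))"
      by (subst integral_density) (use W0 in auto)
    also have "\<dots> = (LINT x|P. (2 * indicator A (V x) + indicator A (V x) * W x) / c)"
      by (intro Bochner_Integration.integral_cong) (auto simp: field_simps)
    also have "\<dots> = (2 * (LINT x|P. indicator A (V x)) + (LINT x|P. indicator A (V x) * W x)) / c"
    proof -
      have i1: "integrable P (\<lambda>x. indicator A (V x) :: real)"
        by (rule P.integrable_const_bound[of _ 1]) (auto simp: indicator_def)
      have i2: "integrable P (\<lambda>x. indicator A (V x) * W x)"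
        by (rule P.integrable_const_bound[of _ 1]) (use W in \<open>auto simp: indicator_def\<close>)
      show ?thesis using i1 i2 by simp
    qed
    finally show ?thesis using rd ch by blast
  qed
  have eq1: "(LINT x|M. indicator A (Y x) :: real) = (LINT x|N. indicator A (Y' x))"
  proof -
    have "distr M borel Y = distr N borel Y'"
      by (intro Levy_uniqueness M.real_distribution_distr N.real_distribution_distr ext)
         (use eq0 in \<open>auto simp: char_def integral_distr\<close>)
    then have "measure (distr M borel Y) A = measure (distr N borel Y') A" by simp
    moreover have "measure (distr M borel Y) A = (LINT x|M. indicator A (Y x))"
      by (subst integral_distr[symmetric, where g = Y and N = borel and f = "indicator A"]) auto
    moreover have "measure (distr N borel Y') A = (LINT x|N. indicator A (Y' x))"
      by (subst integral_distr[symmetric, where g = Y' and N = borel and f = "indicator A"]) auto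
    ultimately show ?thesis by simp
  qed
  \<comment> \<open>One constant normalises both sides: \<open>eqZ\<close> at \<open>s = 0\<close>
    says that \<open>Z\<close> and \<open>Z'\<close> have the same mean.\<close>
  define c where "c = 2 + (LINT x|M. Z x)"
  note g1 = gen[OF M assms(3,4) Z c_def] and g2 = gen[OF N assms(5,6) Z' c_def[unfolded eqmass]]
  have c0: "c > 0"
  proof -
    have "-1 \<le> (LINT x|M. Z x)"
      by (rule M.integral_ge_const[OF intZ]) (use Z in \<open>auto simp: abs_le_iff minus_le_iff\<close>)
    then show ?thesis by (simp add: c_def)
  qed
  have "distr (density M (\<lambda>x. ennreal ((2 + Z x) / c))) borel Y
      = distr (density N (\<lambda>x. ennreal ((2 + Z' x) / c))) borel Y'"
    by (rule Levy_uniqueness) (use g1 g2 eq0 eqZ in auto)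
  then have "(2 * (LINT x|M. indicator A (Y x)) + (LINT x|M. indicator A (Y x) * Z x)) / c
      = (2 * (LINT x|N. indicator A (Y' x)) + (LINT x|N. indicator A (Y' x) * Z' x)) / c"
    using g1[THEN conjunct2, THEN conjunct2] g2[THEN conjunct2, THEN conjunct2] by auto
  then show ?thesis using c0 eq1 by simp
qed

text \<open>Conjugating the hypothesis at \<open>- s\<close> gives it for \<open>cnj (Z x)\<close>.
  Hence the real and the imaginary part of the weight satisfy it separately, and the real case
  applies to each.\<close>

lemma weighted_law_unique:
  fixes Y :: "'a \<Rightarrow> real" and Y' :: "'b \<Rightarrow> real" and Z :: "'a \<Rightarrow> complex" and Z' :: "'b \<Rightarrow> complex"
  assumes M: "prob_space M" and N: "prob_space N"
    and [measurable]: "Y \<in> borel_measurable M" "Z \<in> borel_measurable M"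
      "Y' \<in> borel_measurable N" "Z' \<in> borel_measurable N"
    and Z: "\<And>x. norm (Z x) \<le> 1" and Z': "\<And>x. norm (Z' x) \<le> 1"
    and eq0: "\<And>s. (CLINT x|M. iexp (s * Y x)) = (CLINT x|N. iexp (s * Y' x))"
    and eqZ: "\<And>s. (CLINT x|M. iexp (s * Y x) * Z x) = (CLINT x|N. iexp (s * Y' x) * Z' x)"
    and A: "A \<in> sets borel"
  shows "(CLINT x|M. indicator A (Y x) * Z x) = (CLINT x|N. indicator A (Y' x) * Z' x)"
proof -
  interpret M: prob_space M by fact
  interpret N: prob_space N by fact
  have [measurable]: "A \<in> sets borel" by (rule A)
  have cnj: "(CLINT x|M. iexp (s * Y x) * cnj (Z x)) = (CLINT x|N. iexp (s * Y' x) * cnj (Z' x))" for s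
  proof -
    have "cnj (iexp (- s * y) * z) = iexp (s * y) * cnj z" for y z
      by (simp add: exp_cnj)
    then have "(CLINT x|M. iexp (s * Y x) * cnj (Z x)) = cnj (CLINT x|M. iexp (- s * Y x) * Z x)"
      and "(CLINT x|N. iexp (s * Y' x) * cnj (Z' x)) = cnj (CLINT x|N. iexp (- s * Y' x) * Z' x)"
      by (simp_all only: flip: Bochner_Integration.integral_cnj)
    then show ?thesis using eqZ[of "- s"] by simp
  qed
  have [measurable]: "cnj \<in> borel_measurable borel"
    by (intro borel_measurable_continuous_onI continuous_intros)
  have i: "integrable P (\<lambda>x. iexp (s * V x) * W x)" "integrable P (\<lambda>x. iexp (s * V x) * cnj (W x))"
      "integrable P (\<lambda>x. indicator A (V x) * W x)"
    if "prob_space P" and [measurable]: "V \<in> borel_measurable P" "W \<in> borel_measurable P"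
      and W: "\<And>x. norm (W x) \<le> 1" for P :: "'c measure" and V :: "'c \<Rightarrow> real" and W :: "'c \<Rightarrow> complex" and s
    using W by (auto intro!: integrable_bounded_complex[OF that(1), of _ 1] simp: norm_mult indicator_def)
  note iM = i[OF M assms(3,4) Z] and iN = i[OF N assms(5,6) Z']
  have re: "(CLINT x|M. iexp (s * Y x) * of_real (Re (Z x))) = (CLINT x|N. iexp (s * Y' x) * of_real (Re (Z' x)))" for s
  proof -
    have *: "w * of_real (Re z) = (w * z + w * cnj z) / 2" for w z
      by (simp add: complex_eq_iff field_simps)
    show ?thesis unfolding * using iM(1,2)[of s] iN(1,2)[of s] eqZ[of s] cnj[of s] by simp
  qed
  have im: "(CLINT x|M. iexp (s * Y x) * of_real (Im (Z x))) = (CLINT x|N. iexp (s * Y' x) * of_real (Im (Z' x)))" for s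
  proof -
    have *: "w * of_real (Im z) = (w * z - w * cnj z) / (2 * \<i>)" for w z
      by (simp add: complex_diff_cnj flip: right_diff_distrib, simp add: complex_eq_iff)
    show ?thesis unfolding * using iM(1,2)[of s] iN(1,2)[of s] eqZ[of s] cnj[of s] by simp
  qed
  have bd: "\<bar>Re z\<bar> \<le> 1" "\<bar>Im z\<bar> \<le> 1" if "norm z \<le> 1" for z
    using that abs_Re_le_cmod[of z] abs_Im_le_cmod[of z] by linarith+
  have "(LINT x|M. indicator A (Y x) * Re (Z x)) = (LINT x|N. indicator A (Y' x) * Re (Z' x))"
    by (rule weighted_law_unique_real[OF M N _ _ _ _ _ _ eq0 re A]) (use bd Z Z' in auto)
  moreover have "(LINT x|M. indicator A (Y x) * Im (Z x)) = (LINT x|N. indicator A (Y' x) * Im (Z' x))"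
    by (rule weighted_law_unique_real[OF M N _ _ _ _ _ _ eq0 im A]) (use bd Z Z' in auto)
  moreover have "indicator A y * Re z = Re (indicator A y * z)" "indicator A y * Im z = Im (indicator A y * z)"
    for y :: real and z by (auto simp: indicator_def)
  ultimately show ?thesis
    using iM(3) iN(3) by (simp add: complex_eq_iff integral_Re[symmetric] integral_Im[symmetric])
qed

lemma box_probability_eq_integral:
  fixes V :: "'i \<Rightarrow> 'c \<Rightarrow> real"
  assumes J: "finite J" and P: "prob_space P"
    and V[measurable]: "\<And>j. j \<in> J \<Longrightarrow> V j \<in> borel_measurable P"
    and A[measurable]: "\<And>j. j \<in> J \<Longrightarrow> A j \<in> sets borel"
  shows "complex_of_real (measure (distr P (PiM J (\<lambda>_. borel)) (\<lambda>x. \<lambda>j\<in>J. V j x)) (Pi\<^sub>E J A))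
    = (CLINT x|P. (\<Prod>j\<in>J. indicator (A j) (V j x)))"
proof -
  interpret P: prob_space P by fact
  have S: "Pi\<^sub>E J A \<in> sets (PiM J (\<lambda>_. borel))"
    using J A by (intro sets_PiM_I_finite) auto
  have S': "{x \<in> space P. \<forall>j\<in>J. V j x \<in> A j} \<in> sets P"
    using J by measurable
  have pr: "(\<Prod>j\<in>J. indicator (A j) (V j x)) = complex_of_real (indicator {x \<in> space P. \<forall>j\<in>J. V j x \<in> A j} x)"
    if "x \<in> space P" for x
    using J that by (auto simp: indicator_def)
  have "measure (distr P (PiM J (\<lambda>_. borel)) (\<lambda>x. \<lambda>j\<in>J. V j x)) (Pi\<^sub>E J A)
      = measure P ((\<lambda>x. \<lambda>j\<in>J. V j x) -` Pi\<^sub>E J A \<inter> space P)"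
    using S by (intro measure_distr) auto
  also have "(\<lambda>x. \<lambda>j\<in>J. V j x) -` Pi\<^sub>E J A \<inter> space P = {x \<in> space P. \<forall>j\<in>J. V j x \<in> A j}"
    by (auto simp: PiE_def Pi_def restrict_def extensional_def)
  also have "complex_of_real (measure P {x \<in> space P. \<forall>j\<in>J. V j x \<in> A j}) =
      (CLINT x|P. complex_of_real (indicator {x \<in> space P. \<forall>j\<in>J. V j x \<in> A j} x))"
    using S' by (simp add: integral_complex_of_real)
  also have "\<dots> = (CLINT x|P. (\<Prod>j\<in>J. indicator (A j) (V j x)))"
    by (intro Bochner_Integration.integral_cong) (auto simp: pr)
  finally show ?thesis .
qed

text \<open>Seen from one coordinate, the factors of the other coordinates form a bounded complex
  weight, so \<open>weighted_law_unique\<close> turns the exponential in that coordinate into an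
  indicator. Once this is done for all coordinates, the laws agree on boxes, which determine a
  measure on a finite product.\<close>

theorem joint_law_unique:
  fixes G :: "'i \<Rightarrow> 'a \<Rightarrow> real" and G' :: "'i \<Rightarrow> 'b \<Rightarrow> real"
  assumes M: "prob_space M" and N: "prob_space N" and J: "finite J"
    and G[measurable]: "\<And>j. j \<in> J \<Longrightarrow> G j \<in> borel_measurable M"
    and G'[measurable]: "\<And>j. j \<in> J \<Longrightarrow> G' j \<in> borel_measurable N"
    and eq: "\<And>c. (CLINT x|M. iexp (\<Sum>j\<in>J. c j * G j x)) = (CLINT x|N. iexp (\<Sum>j\<in>J. c j * G' j x))"
  shows "distr M (PiM J (\<lambda>_. borel)) (\<lambda>x. \<lambda>j\<in>J. G j x) = distr N (PiM J (\<lambda>_. borel)) (\<lambda>x. \<lambda>j\<in>J. G' j x)"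
proof -
  interpret M: prob_space M by fact
  interpret N: prob_space N by fact
  \<comment> \<open>The exponential keeps every coordinate of \<open>J\<close>, with
    \<open>c\<close> arbitrary: adding \<open>s\<close> to \<open>c k\<close> in the induction
    hypothesis yields the one-dimensional hypothesis for \<open>G k\<close>.\<close>
  have step: "(CLINT x|M. (\<Prod>j\<in>K. indicator (A j) (G j x)) * iexp (\<Sum>j\<in>J. c j * G j x))
      = (CLINT x|N. (\<Prod>j\<in>K. indicator (A j) (G' j x)) * iexp (\<Sum>j\<in>J. c j * G' j x))"
    if "K \<subseteq> J" "finite K" "\<And>j. j \<in> J \<Longrightarrow> A j \<in> sets borel" for K A c
    using that(2,1)
  proof (induction K arbitrary: c)
    case empty
    then show ?case using eq by simp
  next
    case (insert k K)
    then have k: "k \<in> J" and K: "K \<subseteq> J" by auto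
    have [measurable]: "A j \<in> sets borel" if "j \<in> K" for j using that K \<open>\<And>j. j \<in> J \<Longrightarrow> A j \<in> sets borel\<close> by auto
    have [measurable]: "G j \<in> borel_measurable M" "G' j \<in> borel_measurable N" if "j \<in> K" for j
      using that K by auto
    have [measurable]: "G k \<in> borel_measurable M" "G' k \<in> borel_measurable N" using k by auto
    have shift: "(\<Sum>j\<in>J. (if j = k then c j + s else c j) * g j) = s * g k + (\<Sum>j\<in>J. c j * g j)"
      for s c and g :: "'i \<Rightarrow> real"
      using J k by (simp add: sum.remove[of J k] algebra_simps)
    have nrm: "norm ((\<Prod>j\<in>K. indicator (A j) (g j)) * iexp r) \<le> (1::real)" for r and g :: "'i \<Rightarrow> real"
    proof -
      have "norm (\<Prod>j\<in>K. indicator (A j) (g j) :: complex) \<le> 1"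
        unfolding prod_norm[symmetric] by (rule prod_le_1) (auto simp: indicator_def)
      then show ?thesis by (simp add: norm_mult)
    qed
    have "(CLINT x|M. indicator (A k) (G k x) * ((\<Prod>j\<in>K. indicator (A j) (G j x)) * iexp (\<Sum>j\<in>J. c j * G j x)))
      = (CLINT x|N. indicator (A k) (G' k x) * ((\<Prod>j\<in>K. indicator (A j) (G' j x)) * iexp (\<Sum>j\<in>J. c j * G' j x)))"
    proof (rule weighted_law_unique[OF M N])
      fix s
      show "(CLINT x|M. iexp (s * G k x)) = (CLINT x|N. iexp (s * G' k x))"
        using eq[of "\<lambda>j. if j = k then 0 + s else 0"] shift[of "\<lambda>_. 0" s] by simp
      have "iexp (s * y) * (z * iexp r) = z * iexp (s * y + r)" for y r z
        by (simp add: exp_add algebra_simps)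
      then show "(CLINT x|M. iexp (s * G k x) * ((\<Prod>j\<in>K. indicator (A j) (G j x)) * iexp (\<Sum>j\<in>J. c j * G j x)))
        = (CLINT x|N. iexp (s * G' k x) * ((\<Prod>j\<in>K. indicator (A j) (G' j x)) * iexp (\<Sum>j\<in>J. c j * G' j x)))"
        using insert.IH[OF K, of "\<lambda>j. if j = k then c j + s else c j"] by (simp only: shift)
      show "norm ((\<Prod>j\<in>K. indicator (A j) (G j x)) * iexp (\<Sum>j\<in>J. c j * G j x)) \<le> 1"
        "norm ((\<Prod>j\<in>K. indicator (A j) (G' j y)) * iexp (\<Sum>j\<in>J. c j * G' j y)) \<le> 1" for x y
        by (rule nrm)+
    qed (use that k in auto)
    then show ?case using insert.hyps by (simp add: mult.assoc)
  qed
  interpret product_sigma_finite "\<lambda>_. lborel :: real measure" ..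
  let ?\<mu> = "distr M (PiM J (\<lambda>_. borel)) (\<lambda>x. \<lambda>j\<in>J. G j x)"
  let ?\<nu> = "distr N (PiM J (\<lambda>_. borel)) (\<lambda>x. \<lambda>j\<in>J. G' j x)"
  interpret \<mu>: prob_space ?\<mu> by (rule M.prob_space_distr) simp
  interpret \<nu>: prob_space ?\<nu> by (rule N.prob_space_distr) simp
  have eq_box: "emeasure ?\<mu> (Pi\<^sub>E J A) = emeasure ?\<nu> (Pi\<^sub>E J A)"
    if A: "\<And>i. i \<in> J \<Longrightarrow> A i \<in> sets borel" for A :: "'i \<Rightarrow> real set"
  proof -
  have "complex_of_real (measure ?\<mu> (Pi\<^sub>E J A)) = (CLINT x|M. (\<Prod>j\<in>J. indicator (A j) (G j x)))"
    by (rule box_probability_eq_integral) (use J M A in auto)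
  moreover have "complex_of_real (measure ?\<nu> (Pi\<^sub>E J A)) = (CLINT x|N. (\<Prod>j\<in>J. indicator (A j) (G' j x)))"
    by (rule box_probability_eq_integral) (use J N A in auto)
  ultimately have "complex_of_real (measure ?\<mu> (Pi\<^sub>E J A)) = complex_of_real (measure ?\<nu> (Pi\<^sub>E J A))"
    using step[of J A "\<lambda>_. 0", OF order_refl J A] by (simp del: of_real_eq_iff)
  then have "measure ?\<mu> (Pi\<^sub>E J A) = measure ?\<nu> (Pi\<^sub>E J A)"
    using of_real_eq_iff by blast
  then show ?thesis
    by (simp only: \<mu>.emeasure_eq_measure \<nu>.emeasure_eq_measure)
  qed
  show ?thesis
  proof (rule measure_eqI_PiM_finite[OF J, where A = "\<lambda>_. Pi\<^sub>E J (\<lambda>_. UNIV)"])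
    show "emeasure ?\<mu> (Pi\<^sub>E J A) = emeasure ?\<nu> (Pi\<^sub>E J A)" if "\<And>i. i \<in> J \<Longrightarrow> A i \<in> sets borel" for A
      using that by (rule eq_box)
    show "range (\<lambda>_::nat. Pi\<^sub>E J (\<lambda>_. UNIV)) \<subseteq> prod_algebra J (\<lambda>_. borel :: real measure)"
      using J by (auto intro!: prod_algebraI_finite)
    show "(\<Union>i::nat. Pi\<^sub>E J (\<lambda>_. UNIV)) = space (PiM J (\<lambda>_. borel :: real measure))"
      by (simp add: space_PiM)
    show "emeasure ?\<mu> (Pi\<^sub>E J (\<lambda>_. UNIV)) \<noteq> \<infinity>"
      using \<mu>.emeasure_finite by simp
  qed simp_all
qed

section \<open>Gaussian integration by parts\<close>

lemma integrable_std_normal_pow4: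
  "integrable lborel (\<lambda>x. std_normal_density x * (1 + \<bar>x\<bar>) ^ 4)"
proof -
  have "std_normal_density x * (1 + \<bar>x\<bar>) ^ 4 = std_normal_density x * \<bar>x\<bar> ^ 0 + 4 * (std_normal_density x * \<bar>x\<bar> ^ 1)
      + 6 * (std_normal_density x * \<bar>x\<bar> ^ 2) + 4 * (std_normal_density x * \<bar>x\<bar> ^ 3)
      + std_normal_density x * \<bar>x\<bar> ^ 4" for x
    by (simp add: power4_eq_xxxx power3_eq_cube power2_eq_square algebra_simps)
  then show ?thesis
    by (simp only:) (intro Bochner_Integration.integrable_add integrable_mult_right integrable_std_normal_moment_abs)
qed

text \<open>The normal density \<open>d\<close> satisfies \<open>d' = - x d\<close>, so
  \<open>d g\<close> has derivative \<open>d (g' - x g)\<close> and vanishes at both ends. Cubic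
  growth is what the products differentiated later require.\<close>

lemma stein_identity:
  fixes g g' :: "real \<Rightarrow> complex"
  assumes deriv: "\<And>x. (g has_vector_derivative g' x) (at x)"
    and cont: "continuous_on UNIV g'"
    and bd: "\<And>x. norm (g x) \<le> C * (1 + \<bar>x\<bar>) ^ 3" and bd': "\<And>x. norm (g' x) \<le> C * (1 + \<bar>x\<bar>) ^ 3"
  shows "(CLINT x|std_normal_distribution. of_real x * g x) = (CLINT x|std_normal_distribution. g' x)"
proof -
  have C: "C \<ge> 0" using order_trans[OF norm_ge_zero bd[of 0]] by simp
  have contg: "continuous_on UNIV g"
    using deriv by (meson continuous_at_imp_continuous_on has_vector_derivative_continuous)
  have [measurable]: "g \<in> borel_measurable borel" "g' \<in> borel_measurable borel"
    using contg cont by (auto intro: borel_measurable_continuous_onI)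
  define F where "F x = std_normal_density x *\<^sub>R g x" for x
  define F' where "F' x = std_normal_density x *\<^sub>R (g' x - of_real x * g x)" for x
  have pw: "(1 + \<bar>x\<bar>) ^ 3 \<le> (1 + \<bar>x\<bar>) ^ 4" for x :: real by (rule power_increasing) auto
  have bd4: "norm (g' x) \<le> C * (1 + \<bar>x\<bar>) ^ 4" for x
    using bd'[of x] mult_left_mono[OF pw[of x] C] by linarith
  have bd4': "norm (of_real x * g x) \<le> C * (1 + \<bar>x\<bar>) ^ 4" for x
  proof -
    have "norm (of_real x * g x) \<le> (1 + \<bar>x\<bar>) * (C * (1 + \<bar>x\<bar>) ^ 3)"
      unfolding norm_mult by (intro mult_mono bd) auto
    then show ?thesis by (simp add: power4_eq_xxxx power3_eq_cube mult_ac)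
  qed
  have int: "integrable lborel (\<lambda>x. std_normal_density x *\<^sub>R f x)"
    if [measurable]: "f \<in> borel_measurable borel" and "\<And>x. norm (f x) \<le> C * (1 + \<bar>x\<bar>) ^ 4" for f :: "real \<Rightarrow> complex"
  proof (rule Bochner_Integration.integrable_bound[OF integrable_mult_right[OF integrable_std_normal_pow4, of C]])
    show "AE x in lborel. norm (std_normal_density x *\<^sub>R f x) \<le> norm (C * (std_normal_density x * (1 + \<bar>x\<bar>) ^ 4))"
    proof (rule AE_I2)
      fix x
      have "std_normal_density x * norm (f x) \<le> std_normal_density x * (C * (1 + \<bar>x\<bar>) ^ 4)"
        by (rule mult_left_mono[OF that(2)]) simp
      then show "norm (std_normal_density x *\<^sub>R f x) \<le> norm (C * (std_normal_density x * (1 + \<bar>x\<bar>) ^ 4))"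
        using C by (simp add: mult_ac)
    qed
  qed simp
  have i1: "integrable lborel (\<lambda>x. std_normal_density x *\<^sub>R g' x)"
    and i2: "integrable lborel (\<lambda>x. std_normal_density x *\<^sub>R (of_real x * g x))"
    using bd4 bd4' by (auto intro!: int)
  have iF': "integrable lborel F'"
    unfolding F'_def scaleR_diff_right using i1 i2 by simp
  have dF: "(F has_vector_derivative F' x) (at x)" for x
  proof -
    have "((\<lambda>x. std_normal_density x) has_real_derivative - x * std_normal_density x) (at x)"
    proof -
      have "((\<lambda>x::real. exp (- x\<^sup>2 / 2)) has_real_derivative - x * exp (- x\<^sup>2 / 2)) (at x)"
        by (auto intro!: derivative_eq_intros)
      from DERIV_cmult[OF this, of "1 / sqrt (2 * pi)"] show ?thesis
        unfolding std_normal_density_def by (simp add: mult_ac)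
    qed
    then have "((\<lambda>x. std_normal_density x *\<^sub>R g x) has_vector_derivative
        std_normal_density x *\<^sub>R g' x + (- x * std_normal_density x) *\<^sub>R g x) (at x)"
      using deriv by (rule has_vector_derivative_scaleR)
    then show ?thesis
      by (simp add: F_def[abs_def] F'_def scaleR_conv_of_real algebra_simps)
  qed
  have cF': "isCont F' x" for x
  proof -
    have "continuous_on UNIV F'"
      unfolding F'_def std_normal_density_def by (intro continuous_intros contg cont) auto
    then show ?thesis by (simp add: continuous_on_eq_continuous_at)
  qed
  have nF: "norm (F x) \<le> C * (std_normal_density x * (1 + \<bar>x\<bar>) ^ 3)" for x
    unfolding F_def using mult_left_mono[OF bd[of x], of "std_normal_density x"] by (simp add: mult_ac)
  have "((\<lambda>x. C * (std_normal_density x * (1 + \<bar>x\<bar>) ^ 3)) \<longlongrightarrow> 0) at_top"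
    unfolding std_normal_density_def by real_asymp
  then have top: "(F \<longlongrightarrow> 0) at_top"
    by (rule Lim_null_comparison[rotated]) (use nF in auto)
  have "((\<lambda>x. C * (std_normal_density x * (1 + \<bar>x\<bar>) ^ 3)) \<longlongrightarrow> 0) at_bot"
    unfolding std_normal_density_def by real_asymp
  then have bot: "(F \<longlongrightarrow> 0) at_bot"
    by (rule Lim_null_comparison[rotated]) (use nF in auto)
  have "(LBINT x=-\<infinity>..\<infinity>. F' x) = 0 - 0"
    by (rule interval_integral_FTC_integrable[where F = F])
       (use dF cF' iF' top bot in \<open>auto simp: ereal_tendsto_simps set_integrable_def\<close>)
  then have "integral\<^sup>L lborel F' = 0"
    by (simp add: interval_lebesgue_integral_def set_lebesgue_integral_def)
  then show ?thesis
    unfolding F'_def scaleR_diff_right using i1 i2 by (simp add: integral_density)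
qed

lemma power4_add_le: "(a + b) ^ 4 \<le> 8 * (a ^ 4 + b ^ 4)" for a b :: real
proof -
  have "(a + b) ^ 4 = ((a + b)\<^sup>2)\<^sup>2" by simp
  also have "\<dots> \<le> (2 * (a\<^sup>2 + b\<^sup>2))\<^sup>2"
    by (rule power_mono) (use sum_squares_bound[of a b] sum_squares_bound[of a "- b"] in \<open>auto simp: power2_sum\<close>)
  also have "\<dots> \<le> 8 * (a ^ 4 + b ^ 4)"
    using sum_squares_bound[of "a\<^sup>2" "b\<^sup>2"] by (simp add: power2_sum power_mult_distrib algebra_simps)
  finally show ?thesis .
qed

text \<open>Joint normality is encoded by the characteristic function of all linear combinations.
  Fourth moments and covariances are fields of their own, which avoids recovering them by
  differentiating \<open>char_G\<close>. Unit variances make \<open>G j\<close> itself the parameter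
  in the regression on \<open>G j\<close>.\<close>

locale gaussian_vector = prob_space M for M :: "'a measure" +
  fixes J :: "'i set" and G :: "'i \<Rightarrow> 'a \<Rightarrow> real" and T :: "'i \<Rightarrow> 'i \<Rightarrow> real"
  assumes finite_J[simp, intro]: "finite J"
    and measurable_G[measurable]: "\<And>j. j \<in> J \<Longrightarrow> G j \<in> borel_measurable M"
    and char_G: "\<And>c. (CLINT x|M. iexp (\<Sum>j\<in>J. c j * G j x))
        = of_real (exp (- (\<Sum>j\<in>J. \<Sum>k\<in>J. c j * c k * T j k) / 2))"
    and fourth_moment_G: "\<And>j. j \<in> J \<Longrightarrow> integrable M (\<lambda>x. G j x ^ 4)"
    and cov_G: "\<And>j k. j \<in> J \<Longrightarrow> k \<in> J \<Longrightarrow> (LINT x|M. G j x * G k x) = T j k"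
    and T_diag: "\<And>j. j \<in> J \<Longrightarrow> T j j = 1"
begin

lemma T_sym: "j \<in> J \<Longrightarrow> k \<in> J \<Longrightarrow> T j k = T k j"
  using cov_G[of j k] cov_G[of k j] by (simp add: mult.commute)

text \<open>Growth is measured in powers of \<open>weight\<close>. Fourth moments make its fourth
  power integrable, so a function of order 3 can still be multiplied by a coordinate.\<close>

abbreviation weight :: "('i \<Rightarrow> real) \<Rightarrow> real" where
  "weight y \<equiv> 1 + (\<Sum>k\<in>J. \<bar>y k\<bar>)"

abbreviation vec :: "'a \<Rightarrow> 'i \<Rightarrow> real" where
  "vec x \<equiv> (\<lambda>k\<in>J. G k x)"

lemma integrable_weight: "integrable M (\<lambda>x. weight (vec x) ^ 4)"
proof -
  have "integrable M (\<lambda>x. (1 + (\<Sum>k\<in>K. \<bar>G k x\<bar>)) ^ 4)" if "finite K" "K \<subseteq> J" for K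
    using that
  proof (induction K)
    case (insert k K)
    have [measurable]: "G i \<in> borel_measurable M" if "i \<in> insert k K" for i using that insert.prems by auto
    have "integrable M (\<lambda>x. 8 * ((1 + (\<Sum>k\<in>K. \<bar>G k x\<bar>)) ^ 4 + G k x ^ 4))"
      using insert fourth_moment_G[of k] by (intro integrable_mult_right Bochner_Integration.integrable_add) auto
    then show ?case
      by (rule Bochner_Integration.integrable_bound)
         (use insert.hyps power4_add_le[of "1 + (\<Sum>k\<in>K. \<bar>G k x\<bar>)" "\<bar>G k x\<bar>" for x] in \<open>auto simp: add_ac\<close>)
  qed simp
  from this[of J] show ?thesis by simp
qed

lemma integrable_weight_bound:
  fixes f :: "('i \<Rightarrow> real) \<Rightarrow> complex"
  assumes [measurable]: "f \<in> borel_measurable (PiM J (\<lambda>_. borel))"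
    and bd: "\<And>y. norm (f y) \<le> C * weight y ^ 4"
  shows "integrable M (\<lambda>x. f (vec x))"
proof (rule Bochner_Integration.integrable_bound[OF integrable_mult_right[OF integrable_weight, of C]])
  show "AE x in M. norm (f (vec x)) \<le> norm (C * weight (vec x) ^ 4)"
    using bd by (auto intro!: AE_I2 order_trans[OF bd] simp del: restrict_apply)
qed measurable

lemma weight_ge1: "1 \<le> weight y"
  by (simp add: sum_nonneg)

lemma abs_le_weight: "j \<in> J \<Longrightarrow> \<bar>y j\<bar> \<le> weight y"
  using member_le_sum[of j J "\<lambda>k. \<bar>y k\<bar>"] by (auto simp: add_increasing)

text \<open>Regression on \<open>G j\<close>: the residuals \<open>G k - T j k * G j\<close> are uncorrelated with, hence independent of, \<open>G j\<close>.\<close>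

lemma law_regression:
  assumes j: "j \<in> J"
  shows "distr M (PiM J (\<lambda>_. borel)) vec =
    distr (std_normal_distribution \<Otimes>\<^sub>M M) (PiM J (\<lambda>_. borel))
      (\<lambda>z. \<lambda>k\<in>J. T j k * fst z + (G k (snd z) - T j k * G j (snd z)))"
proof -
  interpret N: prob_space std_normal_distribution by (rule prob_space_normal_density) simp
  interpret P: pair_prob_space std_normal_distribution M ..
  have [measurable]: "G j \<in> borel_measurable M" using j by simp
  show ?thesis
  proof (rule joint_law_unique)
    show "prob_space M" "prob_space (std_normal_distribution \<Otimes>\<^sub>M M)" "finite J" by unfold_locales simp
    show "(CLINT x|M. iexp (\<Sum>k\<in>J. c k * G k x)) = (CLINT z|std_normal_distribution \<Otimes>\<^sub>M M.
       iexp (\<Sum>k\<in>J. c k * (T j k * fst z + (G k (snd z) - T j k * G j (snd z)))))" for c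
    proof -
      \<comment> \<open>\<open>b\<close> is the covariance of the linear form with
        \<open>G j\<close>. Removing \<open>b * G j\<close> lowers the variance of the form by
        \<open>b * b\<close>; the independent standard normal variable enters with coefficient
        \<open>b\<close> and restores it.\<close>
      define b where "b = (\<Sum>k\<in>J. c k * T j k)"
      define c' where "c' k = c k - (if k = j then b else 0)" for k
      have split: "(\<Sum>k\<in>J. c k * (T j k * x + (g k - T j k * g j))) = b * x + (\<Sum>k\<in>J. c' k * g k)" for x and g :: "'i \<Rightarrow> real"
      proof -
        have "(\<Sum>k\<in>J. c' k * g k) = (\<Sum>k\<in>J. c k * g k) - b * g j"
          using j by (simp add: c'_def left_diff_distrib sum_subtractf if_distrib[of "\<lambda>x. x * _"] cong: if_cong)
        then show ?thesis
          by (simp add: b_def algebra_simps sum.distrib sum_subtractf sum_distrib_left sum_distrib_right)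
      qed
      have b': "(\<Sum>k\<in>J. c k * T k j) = b"
        unfolding b_def using j T_sym by (intro sum.cong) auto
      have inner: "(\<Sum>k\<in>J. c' k * T i k) = (\<Sum>k\<in>J. c k * T i k) - b * T i j" for i
        using j by (simp add: c'_def left_diff_distrib sum_subtractf if_distrib[of "\<lambda>x. x * _"] cong: if_cong)
      have outer: "(\<Sum>i\<in>J. c' i * f i) = (\<Sum>i\<in>J. c i * f i) - b * f j" for f
        using j by (simp add: c'_def left_diff_distrib sum_subtractf if_distrib[of "\<lambda>x. x * _"] cong: if_cong)
      have "(\<Sum>i\<in>J. \<Sum>k\<in>J. c' i * c' k * T i k) = (\<Sum>i\<in>J. c' i * (\<Sum>k\<in>J. c' k * T i k))"
        by (simp add: sum_distrib_left mult.assoc)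
      also have "\<dots> = (\<Sum>i\<in>J. c i * (\<Sum>k\<in>J. c k * T i k)) - b * b"
        using j unfolding inner outer by (simp add: right_diff_distrib sum_subtractf T_diag b_def[symmetric])
           (simp add: mult.left_commute[of _ b] b' flip: sum_distrib_left)
      also have "(\<Sum>i\<in>J. c i * (\<Sum>k\<in>J. c k * T i k)) = (\<Sum>i\<in>J. \<Sum>k\<in>J. c i * c k * T i k)"
        by (simp add: sum_distrib_left mult.assoc)
      finally have Q: "(\<Sum>i\<in>J. \<Sum>k\<in>J. c' i * c' k * T i k) = (\<Sum>i\<in>J. \<Sum>k\<in>J. c i * c k * T i k) - b * b" .
      have iexp_add: "iexp (u + v) = iexp u * iexp v" for u v
        by (simp add: ring_distribs exp_add)
      have "(CLINT z|std_normal_distribution \<Otimes>\<^sub>M M.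
          iexp (\<Sum>k\<in>J. c k * (T j k * fst z + (G k (snd z) - T j k * G j (snd z)))))
        = (CLINT z|std_normal_distribution \<Otimes>\<^sub>M M. (\<lambda>(x, \<omega>). iexp (b * x) * iexp (\<Sum>k\<in>J. c' k * G k \<omega>)) z)"
        by (simp only: split[of "fst z" "\<lambda>k. G k (snd z)" for z] case_prod_beta' iexp_add)
      also have "\<dots> = (CLINT x|std_normal_distribution. CLINT \<omega>|M. iexp (b * x) * iexp (\<Sum>k\<in>J. c' k * G k \<omega>))"
      proof -
        have "integrable (std_normal_distribution \<Otimes>\<^sub>M M) (\<lambda>(x, \<omega>). iexp (b * x) * iexp (\<Sum>k\<in>J. c' k * G k \<omega>))"
          by (rule integrable_bounded_complex[of _ _ 1], unfold_locales) (auto simp: norm_mult)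
        from P.integral_fst'[OF this] show ?thesis by simp
      qed
      also have "\<dots> = char std_normal_distribution b * (CLINT \<omega>|M. iexp (\<Sum>k\<in>J. c' k * G k \<omega>))"
        by (simp only: char_def integral_mult_right_zero integral_mult_left_zero)
      also have "\<dots> = of_real (exp (- (b\<^sup>2) / 2)) * of_real (exp (- ((\<Sum>i\<in>J. \<Sum>k\<in>J. c i * c k * T i k) - b * b) / 2))"
        unfolding char_G Q by (simp add: char_std_normal_distribution)
      also have "\<dots> = (CLINT x|M. iexp (\<Sum>k\<in>J. c k * G k x))"
        unfolding char_G of_real_mult[symmetric] exp_add[symmetric]
        by (simp add: power2_eq_square field_simps)
      finally show ?thesis by simp
    qed
  qed measurable
qed

text \<open>For a fixed residual the regressed vector moves along a line in direction
  \<open>T j\<close>, with a standard normal parameter. Stein's identity holds on each line, and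
  Fubini integrates over the residuals. Only the derivative in this direction enters; for smooth
  \<open>h\<close> it is the sum of \<open>T j k\<close> times the partial derivatives.\<close>

theorem integration_by_parts:
  fixes h h' :: "('i \<Rightarrow> real) \<Rightarrow> complex"
  assumes j: "j \<in> J"
    and [measurable]: "h \<in> borel_measurable (PiM J (\<lambda>_. borel))" "h' \<in> borel_measurable (PiM J (\<lambda>_. borel))"
    and bd: "\<And>y. norm (h y) \<le> C * weight y ^ 3" and bd': "\<And>y. norm (h' y) \<le> C * weight y ^ 3"
    and deriv: "\<And>y s. ((\<lambda>s. h (\<lambda>k\<in>J. y k + s * T j k)) has_vector_derivative h' (\<lambda>k\<in>J. y k + s * T j k)) (at s)"
    and cont: "\<And>y. continuous_on UNIV (\<lambda>s. h' (\<lambda>k\<in>J. y k + s * T j k))"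
  shows "(CLINT x|M. of_real (G j x) * h (vec x)) = (CLINT x|M. h' (vec x))"
proof -
  interpret N: prob_space std_normal_distribution by (rule prob_space_normal_density) simp
  interpret P: pair_prob_space std_normal_distribution M ..
  have [measurable]: "G j \<in> borel_measurable M" using j by simp
  have C: "C \<ge> 0" using bd[of "\<lambda>_. 0"] order_trans[OF norm_ge_zero] by fastforce
  have pw: "weight y ^ 3 \<le> weight y ^ 4" for y by (rule power_increasing) (auto simp: sum_nonneg)
  define R where "R z = (\<lambda>k\<in>J. T j k * fst z + (G k (snd z) - T j k * G j (snd z)))" for z
  have [measurable]: "R \<in> measurable (std_normal_distribution \<Otimes>\<^sub>M M) (PiM J (\<lambda>_. borel))"
    unfolding R_def[abs_def] by measurable
  have law: "distr M (PiM J (\<lambda>_. borel)) vec = distr (std_normal_distribution \<Otimes>\<^sub>M M) (PiM J (\<lambda>_. borel)) R"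
    unfolding R_def[abs_def] by (rule law_regression[OF j])
  have transfer: "integrable (std_normal_distribution \<Otimes>\<^sub>M M) (\<lambda>z. f (R z)) \<and>
      (CLINT x|M. f (vec x)) = (CLINT \<omega>|M. CLINT x|std_normal_distribution. f (R (x, \<omega>)))"
    if [measurable]: "f \<in> borel_measurable (PiM J (\<lambda>_. borel))" and "\<And>y. norm (f y) \<le> C * weight y ^ 4"
    for f :: "('i \<Rightarrow> real) \<Rightarrow> complex"
  proof -
    have "integrable M (\<lambda>x. f (vec x))"
      by (rule integrable_weight_bound) fact+
    then have "integrable (distr M (PiM J (\<lambda>_. borel)) vec) f"
      by (simp add: integrable_distr_eq)
    then have i: "integrable (std_normal_distribution \<Otimes>\<^sub>M M) (\<lambda>z. f (R z))"
      unfolding law by (simp add: integrable_distr_eq)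
    have "(CLINT x|M. f (vec x)) = integral\<^sup>L (distr M (PiM J (\<lambda>_. borel)) vec) f"
      by (simp add: integral_distr)
    also have "\<dots> = (CLINT z|std_normal_distribution \<Otimes>\<^sub>M M. f (R z))"
      unfolding law by (simp add: integral_distr)
    also have "\<dots> = (CLINT \<omega>|M. CLINT x|std_normal_distribution. f (R (x, \<omega>)))"
      using P.integral_snd[of "\<lambda>x \<omega>. f (R (x, \<omega>))"] i by (simp add: case_prod_beta')
    finally show ?thesis using i by blast
  qed
  have R_line: "R (x, \<omega>) = (\<lambda>k\<in>J. (G k \<omega> - T j k * G j \<omega>) + x * T j k)" for x \<omega>
    by (auto simp: R_def fun_eq_iff)
  have inner: "(CLINT x|std_normal_distribution. of_real (R (x, \<omega>) j) * h (R (x, \<omega>)))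
      = (CLINT x|std_normal_distribution. h' (R (x, \<omega>)))" for \<omega>
  proof -
    \<comment> \<open>On one line the weight is at most \<open>W * (1 + \<bar>x\<bar>)\<close>. This
      turns bounds in powers of \<open>weight\<close> into the cubic bounds in \<open>x\<close> of
      Stein's identity, with a constant that depends on the residual.\<close>
    define W where "W = 1 + (\<Sum>k\<in>J. \<bar>G k \<omega> - T j k * G j \<omega>\<bar>) + (\<Sum>k\<in>J. \<bar>T j k\<bar>)"
    have W: "weight (R (x, \<omega>)) \<le> W * (1 + \<bar>x\<bar>)" for x
    proof -
      have "(\<Sum>k\<in>J. \<bar>R (x, \<omega>) k\<bar>) \<le> (\<Sum>k\<in>J. \<bar>G k \<omega> - T j k * G j \<omega>\<bar> + \<bar>x\<bar> * \<bar>T j k\<bar>)"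
        by (rule sum_mono) (simp add: R_line abs_mult[symmetric] abs_triangle_ineq)
      also have "\<dots> = (\<Sum>k\<in>J. \<bar>G k \<omega> - T j k * G j \<omega>\<bar>) + \<bar>x\<bar> * (\<Sum>k\<in>J. \<bar>T j k\<bar>)"
        by (simp add: sum.distrib sum_distrib_left)
      finally have "(\<Sum>k\<in>J. \<bar>R (x, \<omega>) k\<bar>)
          \<le> (\<Sum>k\<in>J. \<bar>G k \<omega> - T j k * G j \<omega>\<bar>) + \<bar>x\<bar> * (\<Sum>k\<in>J. \<bar>T j k\<bar>)" .
      moreover have "0 \<le> \<bar>x\<bar> * (1 + (\<Sum>k\<in>J. \<bar>G k \<omega> - T j k * G j \<omega>\<bar>))"
        by (intro mult_nonneg_nonneg sum_nonneg add_nonneg_nonneg) auto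
      moreover have "0 \<le> (\<Sum>k\<in>J. \<bar>T j k\<bar>)"
        by (rule sum_nonneg) simp
      moreover have "W * (1 + \<bar>x\<bar>) = 1 + (\<Sum>k\<in>J. \<bar>G k \<omega> - T j k * G j \<omega>\<bar>) + (\<Sum>k\<in>J. \<bar>T j k\<bar>)
          + \<bar>x\<bar> * (\<Sum>k\<in>J. \<bar>T j k\<bar>) + \<bar>x\<bar> * (1 + (\<Sum>k\<in>J. \<bar>G k \<omega> - T j k * G j \<omega>\<bar>))"
        by (simp add: W_def algebra_simps)
      ultimately show ?thesis by linarith
    qed
    have W3: "C * weight (R (x, \<omega>)) ^ 3 \<le> (C * W ^ 3) * (1 + \<bar>x\<bar>) ^ 3" for x
      using power_mono[OF W[of x], of 3] weight_ge1[of "R (x, \<omega>)"] C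
      by (simp add: power_mult_distrib mult.assoc mult_left_mono)
    have "(CLINT x|std_normal_distribution. of_real x * h (R (x, \<omega>)))
      = (CLINT x|std_normal_distribution. h' (R (x, \<omega>)))"
    proof (rule stein_identity)
      show "((\<lambda>x. h (R (x, \<omega>))) has_vector_derivative h' (R (x, \<omega>))) (at x)" for x
        unfolding R_line by (rule deriv)
      show "continuous_on UNIV (\<lambda>x. h' (R (x, \<omega>)))"
        unfolding R_line by (rule cont)
      show "norm (h (R (x, \<omega>))) \<le> (C * W ^ 3) * (1 + \<bar>x\<bar>) ^ 3" "norm (h' (R (x, \<omega>))) \<le> (C * W ^ 3) * (1 + \<bar>x\<bar>) ^ 3" for x
        using W3 bd bd' order_trans by blast+
    qed
    then show ?thesis using j by (simp add: R_def T_diag)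
  qed
  have bd4: "norm (of_real (y j) * h y) \<le> C * weight y ^ 4" for y
  proof -
    have "norm (of_real (y j) * h y) \<le> weight y * (C * weight y ^ 3)"
      unfolding norm_mult by (intro mult_mono bd) (use abs_le_weight[OF j, of y] weight_ge1[of y] in auto)
    then show ?thesis by (simp add: power4_eq_xxxx power3_eq_cube mult_ac)
  qed
  have bd4': "norm (h' y) \<le> C * weight y ^ 4" for y
    using bd'[of y] mult_left_mono[OF pw[of y] C] by linarith
  have [measurable]: "(\<lambda>y. y j) \<in> borel_measurable (PiM J (\<lambda>_. borel :: real measure))"
    using j by (rule measurable_component_singleton)
  have "(CLINT x|M. of_real (G j x) * h (vec x)) = (CLINT x|M. (\<lambda>y. of_real (y j) * h y) (vec x))"
    using j by simp
  also have "\<dots> = (CLINT \<omega>|M. CLINT x|std_normal_distribution. of_real (R (x, \<omega>) j) * h (R (x, \<omega>)))"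
    by (rule transfer[THEN conjunct2]) (use bd4 in auto)
  also have "\<dots> = (CLINT \<omega>|M. CLINT x|std_normal_distribution. h' (R (x, \<omega>)))"
    unfolding inner ..
  also have "\<dots> = (CLINT x|M. h' (vec x))"
    by (rule transfer[THEN conjunct2, symmetric]) (use bd4' in auto)
  finally show ?thesis .
qed

end

section \<open>Quadratic functionals of Gaussian vectors\<close>

context prob_space
begin

lemma integrable_of_square:
  fixes Y :: "'a \<Rightarrow> real"
  assumes [measurable]: "Y \<in> borel_measurable M" and Y2: "integrable M (\<lambda>x. (Y x)\<^sup>2)"
  shows "integrable M Y"
proof (rule Bochner_Integration.integrable_bound)
  show "integrable M (\<lambda>x. 1 + (Y x)\<^sup>2)" using Y2 by simp
  have "\<bar>y\<bar> \<le> 1 + y\<^sup>2" for y :: real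
    using sum_squares_bound[of 1 "\<bar>y\<bar>"] by simp
  then show "AE x in M. norm (Y x) \<le> norm (1 + (Y x)\<^sup>2)" by (auto simp: abs_of_nonneg)
qed simp

lemma expectation_abs_le_sqrt:
  fixes Y :: "'a \<Rightarrow> real"
  assumes [measurable]: "Y \<in> borel_measurable M" and Y2: "integrable M (\<lambda>x. (Y x)\<^sup>2)"
  shows "expectation (\<lambda>x. \<bar>Y x\<bar>) \<le> sqrt (expectation (\<lambda>x. (Y x)\<^sup>2))"
proof (rule real_le_rsqrt)
  have "0 \<le> variance (\<lambda>x. \<bar>Y x\<bar>)" by (rule variance_positive)
  also have "\<dots> = expectation (\<lambda>x. (Y x)\<^sup>2) - (expectation (\<lambda>x. \<bar>Y x\<bar>))\<^sup>2"
    using Y2 integrable_of_square[of Y] by (subst variance_eq) auto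
  finally show "(expectation (\<lambda>x. \<bar>Y x\<bar>))\<^sup>2 \<le> expectation (\<lambda>x. (Y x)\<^sup>2)" by simp
qed

lemma cauchy_schwarz_expectation:
  fixes X Y :: "'a \<Rightarrow> real"
  assumes [measurable]: "X \<in> borel_measurable M" "Y \<in> borel_measurable M"
    and X2: "integrable M (\<lambda>x. (X x)\<^sup>2)" and Y2: "integrable M (\<lambda>x. (Y x)\<^sup>2)"
  shows "integrable M (\<lambda>x. X x * Y x)"
    and "expectation (\<lambda>x. \<bar>X x * Y x\<bar>) \<le> sqrt (expectation (\<lambda>x. (X x)\<^sup>2)) * sqrt (expectation (\<lambda>x. (Y x)\<^sup>2))"
proof -
  have ineq: "\<bar>u * v\<bar> \<le> (l * u\<^sup>2 + v\<^sup>2 / l) / 2" if "l > 0" for u v l :: real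
  proof -
    have "0 \<le> (sqrt l * \<bar>u\<bar> - \<bar>v\<bar> / sqrt l)\<^sup>2" by simp
    also have "\<dots> = l * u\<^sup>2 + v\<^sup>2 / l - 2 * \<bar>u * v\<bar>"
      using that by (simp add: power2_diff power_mult_distrib power_divide abs_mult)
    finally show ?thesis by simp
  qed
  show int: "integrable M (\<lambda>x. X x * Y x)"
  proof (rule Bochner_Integration.integrable_bound)
    show "integrable M (\<lambda>x. (1 * (X x)\<^sup>2 + (Y x)\<^sup>2 / 1) / 2)" using X2 Y2 by simp
    show "AE x in M. norm (X x * Y x) \<le> norm ((1 * (X x)\<^sup>2 + (Y x)\<^sup>2 / 1) / 2)"
      using order_trans[OF ineq[of 1] abs_ge_self] by simp
  qed simp
  define a b where "a = sqrt (expectation (\<lambda>x. (X x)\<^sup>2))" and "b = sqrt (expectation (\<lambda>x. (Y x)\<^sup>2))"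
  have ab: "a \<ge> 0" "b \<ge> 0" "expectation (\<lambda>x. (X x)\<^sup>2) = a\<^sup>2" "expectation (\<lambda>x. (Y x)\<^sup>2) = b\<^sup>2"
    by (auto simp: a_def b_def)
  have "expectation (\<lambda>x. \<bar>X x * Y x\<bar>) \<le> a * b + e" if e: "e > 0" for e
  proof -
    \<comment> \<open>The optimal parameter in \<open>ineq\<close> is \<open>b / a\<close>. Shifting
      numerator and denominator by \<open>d > 0\<close> covers vanishing second moments and costs at
      most \<open>e\<close>.\<close>
    define d where "d = e / (a + b + 1)"
    have d: "d > 0" "d * (a + b) \<le> e"
      using e ab by (auto simp: d_def field_simps)
    define l where "l = (b + d) / (a + d)"
    have l: "l > 0" using ab d by (simp add: l_def)
    have "expectation (\<lambda>x. \<bar>X x * Y x\<bar>) \<le> expectation (\<lambda>x. (l * (X x)\<^sup>2 + (Y x)\<^sup>2 / l) / 2)"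
      using int X2 Y2 ineq[OF l] by (intro integral_mono) auto
    also have "\<dots> = (l * a\<^sup>2 + b\<^sup>2 / l) / 2"
      using X2 Y2 ab by simp
    finally have 1: "expectation (\<lambda>x. \<bar>X x * Y x\<bar>) \<le> (l * a\<^sup>2 + b\<^sup>2 / l) / 2" .
    have 2: "l * a\<^sup>2 \<le> (b + d) * a"
    proof -
      have "l * a\<^sup>2 = (b + d) * a * (a / (a + d))" by (simp add: l_def power2_eq_square)
      also have "\<dots> \<le> (b + d) * a * 1" using ab d by (intro mult_left_mono) auto
      finally show ?thesis by simp
    qed
    have 3: "b\<^sup>2 / l \<le> (a + d) * b"
    proof -
      have "b\<^sup>2 / l = (a + d) * b * (b / (b + d))" by (simp add: l_def power2_eq_square)
      also have "\<dots> \<le> (a + d) * b * 1" using ab d by (intro mult_left_mono) auto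
      finally show ?thesis by simp
    qed
    have "(l * a\<^sup>2 + b\<^sup>2 / l) / 2 \<le> ((b + d) * a + (a + d) * b) / 2"
      by (intro divide_right_mono add_mono 2 3) simp
    also have "\<dots> = a * b + d * (a + b) / 2"
      by (simp add: field_simps)
    also have "\<dots> \<le> a * b + e"
      using d e by simp
    finally show ?thesis using 1 by simp
  qed
  then show "expectation (\<lambda>x. \<bar>X x * Y x\<bar>) \<le> sqrt (expectation (\<lambda>x. (X x)\<^sup>2)) * sqrt (expectation (\<lambda>x. (Y x)\<^sup>2))"
    unfolding a_def[symmetric] b_def[symmetric] by (rule field_le_epsilon)
qed

text \<open>The first-order remainder of \<open>iexp\<close> is at most half the square of the
  argument, so a finite second moment bounds the error of the difference quotient by a multiple of
  \<open>\<bar>s - t\<bar>\<close>.\<close>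

lemma characteristic_function_derivative:
  fixes F :: "'a \<Rightarrow> real"
  assumes [measurable]: "F \<in> borel_measurable M" and F2: "integrable M (\<lambda>x. (F x)\<^sup>2)"
  shows "((\<lambda>t. CLINT x|M. iexp (t * F x)) has_vector_derivative
    \<i> * (CLINT x|M. of_real (F x) * iexp (t * F x))) (at t)"
proof -
  have F1: "integrable M F" by (rule integrable_of_square) (use F2 in auto)
  have i1: "integrable M (\<lambda>x. iexp (s * F x))" for s
    by (rule integrable_bounded_complex[OF prob_space_axioms, of _ 1]) auto
  have i2: "integrable M (\<lambda>x. of_real (F x) * iexp (t * F x))"
    by (rule Bochner_Integration.integrable_bound[OF F1]) (auto simp: norm_mult)
  define R where "R s x = iexp (s * F x) - iexp (t * F x) - of_real (s - t) * \<i> * (of_real (F x) * iexp (t * F x))" for s x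
  define D where "D s = (CLINT x|M. iexp (s * F x)) - (CLINT x|M. iexp (t * F x))
      - (s - t) *\<^sub>R (\<i> * (CLINT x|M. of_real (F x) * iexp (t * F x)))" for s
  have est: "norm (D s) \<le> expectation (\<lambda>x. (F x)\<^sup>2) * (s - t)\<^sup>2" for s
  proof -
    have iR: "integrable M (R s)"
      unfolding R_def[abs_def] by (intro Bochner_Integration.integrable_diff integrable_mult_right i1 i2)
    have "D s = (CLINT x|M. R s x)"
      unfolding R_def D_def using i1[of s] i1[of t] i2
      by (simp only: Bochner_Integration.integral_diff Bochner_Integration.integrable_diff integrable_mult_right
          integral_mult_right_zero scaleR_conv_of_real mult.assoc)
    also have "norm \<dots> \<le> (LINT x|M. norm (R s x))"
      by (rule integral_norm_bound)
    also have "\<dots> \<le> (LINT x|M. (s - t)\<^sup>2 * (F x)\<^sup>2)"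
    proof (rule integral_mono)
      show "integrable M (\<lambda>x. norm (R s x))" using iR by simp
      show "integrable M (\<lambda>x. (s - t)\<^sup>2 * (F x)\<^sup>2)" using F2 by simp
      fix x
      have "iexp (s * F x) = iexp (t * F x) * iexp ((s - t) * F x)"
        unfolding exp_add[symmetric] by (simp add: algebra_simps)
      then have "R s x = iexp (t * F x) * (iexp ((s - t) * F x) - (1 + \<i> * of_real ((s - t) * F x)))"
        unfolding R_def by (simp add: algebra_simps)
      also have "norm \<dots> = norm (iexp ((s - t) * F x) - (1 + \<i> * of_real ((s - t) * F x)))"
        by (rule norm_iexp_times)
      also have "\<dots> \<le> \<bar>(s - t) * F x\<bar>\<^sup>2 / 2"
        using iexp_approx1[of "(s - t) * F x" 1] by (simp add: numeral_2_eq_2)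
      also have "\<dots> \<le> (s - t)\<^sup>2 * (F x)\<^sup>2"
        by (simp add: power_mult_distrib)
      finally show "norm (R s x) \<le> (s - t)\<^sup>2 * (F x)\<^sup>2" .
    qed
    finally show ?thesis by (simp add: mult.commute)
  qed
  have "((\<lambda>s. expectation (\<lambda>x. (F x)\<^sup>2) * \<bar>s - t\<bar>) \<longlongrightarrow> expectation (\<lambda>x. (F x)\<^sup>2) * \<bar>t - t\<bar>) (at t)"
    by (intro tendsto_intros)
  then have lim: "((\<lambda>s. expectation (\<lambda>x. (F x)\<^sup>2) * \<bar>s - t\<bar>) \<longlongrightarrow> 0) (at t)" by simp
  have "((\<lambda>s. norm (D s) / norm (s - t)) \<longlongrightarrow> 0) (at t)"
  proof (rule tendsto_sandwich[OF _ _ tendsto_const lim])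
    have "norm (D s) / norm (s - t) \<le> expectation (\<lambda>x. (F x)\<^sup>2) * \<bar>s - t\<bar>" if "s \<noteq> t" for s
    proof -
      have "norm (D s) \<le> expectation (\<lambda>x. (F x)\<^sup>2) * (\<bar>s - t\<bar> * \<bar>s - t\<bar>)"
        using est[of s] by (simp add: power2_eq_square)
      then show ?thesis using that by (simp add: pos_divide_le_eq mult.assoc)
    qed
    then show "\<forall>\<^sub>F s in at t. norm (D s) / norm (s - t) \<le> expectation (\<lambda>x. (F x)\<^sup>2) * \<bar>s - t\<bar>"
      unfolding eventually_at_filter by (auto intro!: always_eventually)
  qed auto
  then show ?thesis
    unfolding has_vector_derivative_def has_derivative_iff_norm D_def
    by (intro conjI bounded_linear_scaleR_left)
qed

text \<open>Integrating factor: \<open>exp (s * t^2 / 2)\<close> times the characteristic function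
  equals 1 at 0, and its derivative is exactly the defect in \<open>ode\<close> times that
  factor.\<close>

lemma characteristic_function_near_gaussian:
  fixes F :: "'a \<Rightarrow> real"
  assumes [measurable]: "F \<in> borel_measurable M" and F2: "integrable M (\<lambda>x. (F x)\<^sup>2)"
    and s: "s \<ge> 0" and e: "e \<ge> 0"
    and ode: "\<And>t. norm (\<i> * (CLINT x|M. of_real (F x) * iexp (t * F x)) + of_real (s * t) * (CLINT x|M. iexp (t * F x))) \<le> \<bar>t\<bar> * e"
  shows "norm ((CLINT x|M. iexp (t * F x)) - of_real (exp (- (s * t\<^sup>2) / 2))) \<le> t\<^sup>2 * e"
proof -
  define \<phi> where "\<phi> t = (CLINT x|M. iexp (t * F x))" for t
  define \<phi>' where "\<phi>' t = \<i> * (CLINT x|M. of_real (F x) * iexp (t * F x))" for t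
  have d: "(\<phi> has_vector_derivative \<phi>' t) (at t)" for t
    unfolding \<phi>_def[abs_def] \<phi>'_def by (rule characteristic_function_derivative) (use F2 in auto)
  define g where "g t = exp (s * t\<^sup>2 / 2) *\<^sub>R \<phi> t" for t
  define g' where "g' t = exp (s * t\<^sup>2 / 2) *\<^sub>R (\<phi>' t + of_real (s * t) * \<phi> t)" for t
  have dg: "(g has_vector_derivative g' t) (at t)" for t
  proof -
    have "((\<lambda>t. exp (s * t\<^sup>2 / 2)) has_real_derivative exp (s * t\<^sup>2 / 2) * (s * t)) (at t)"
      by (auto intro!: derivative_eq_intros)
    from has_vector_derivative_scaleR[OF this d] show ?thesis
      by (simp add: g_def[abs_def] g'_def scaleR_conv_of_real algebra_simps)
  qed
  \<comment> \<open>Bounds the derivative on the whole segment from \<open>- \<bar>t\<bar>\<close>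
    to \<open>\<bar>t\<bar>\<close>. The exponential cancels when the integrating factor is removed,
    which leaves \<open>t^2 * e\<close>.\<close>
  define B where "B = exp (s * t\<^sup>2 / 2) * (\<bar>t\<bar> * e)"
  have "norm (g t - g 0) \<le> B * norm (t - 0)"
  proof (rule differentiable_bound[of "{- \<bar>t\<bar>..\<bar>t\<bar>}"])
    fix u assume u: "u \<in> {- \<bar>t\<bar>..\<bar>t\<bar>}"
    show "(g has_derivative (\<lambda>x. x *\<^sub>R g' u)) (at u within {- \<bar>t\<bar>..\<bar>t\<bar>})"
      using dg[of u] by (simp add: has_vector_derivative_def has_derivative_at_withinI)
    have "\<bar>u\<bar> \<le> \<bar>t\<bar>" using u by auto
    then have "u\<^sup>2 \<le> t\<^sup>2" by (simp add: abs_le_square_iff)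
    then have 1: "exp (s * u\<^sup>2 / 2) \<le> exp (s * t\<^sup>2 / 2)" using s by (simp add: mult_left_mono)
    have "norm (\<phi>' u + of_real (s * u) * \<phi> u) \<le> \<bar>u\<bar> * e"
      using ode[of u] by (simp add: \<phi>_def \<phi>'_def)
    also have "\<dots> \<le> \<bar>t\<bar> * e" using u e by (intro mult_right_mono) auto
    finally have 2: "norm (\<phi>' u + of_real (s * u) * \<phi> u) \<le> \<bar>t\<bar> * e" .
    have 3: "norm (g' u) \<le> B"
      unfolding norm_scaleR g'_def B_def using 1 2 by (intro mult_mono) auto
    show "onorm (\<lambda>x. x *\<^sub>R g' u) \<le> B"
    proof (rule onorm_le)
      fix x :: real
      show "norm (x *\<^sub>R g' u) \<le> B * norm x"
        using mult_left_mono[OF 3, of "\<bar>x\<bar>"] by (simp add: mult_ac)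
    qed
  qed auto
  then have 1: "norm (g t - 1) \<le> B * \<bar>t\<bar>" by (simp add: g_def \<phi>_def prob_space)
  have "\<phi> t - of_real (exp (- (s * t\<^sup>2) / 2)) = exp (- (s * t\<^sup>2) / 2) *\<^sub>R (g t - 1)"
    unfolding g_def scaleR_diff_right scaleR_scaleR mult_exp_exp by (simp add: scaleR_conv_of_real)
  then have "norm (\<phi> t - of_real (exp (- (s * t\<^sup>2) / 2))) = exp (- (s * t\<^sup>2) / 2) * norm (g t - 1)"
    by simp
  also have "\<dots> \<le> exp (- (s * t\<^sup>2) / 2) * (B * \<bar>t\<bar>)"
    by (intro mult_left_mono 1) auto
  also have "\<dots> = (exp (- (s * t\<^sup>2) / 2) * exp (s * t\<^sup>2 / 2)) * (\<bar>t\<bar> * \<bar>t\<bar>) * e"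
    unfolding B_def by (simp only: mult_ac)
  also have "\<dots> = t\<^sup>2 * e"
    unfolding mult_exp_exp by (simp add: power2_eq_square)
  finally show ?thesis by (simp add: \<phi>_def)
qed

end

section \<open>Quadratic forms of a Gaussian vector\<close>

context gaussian_vector
begin

text \<open>An element of the second Wiener chaos; with \<open>r = 1 / sqrt n\<close> and the
  normalised increments it is the \<open>F\<close> of the overview.\<close>

definition chaos :: "real \<Rightarrow> ('i \<Rightarrow> real) \<Rightarrow> real" where
  "chaos r y = r * (\<Sum>i\<in>J. (y i)\<^sup>2 - 1)"

definition lin :: "'i \<Rightarrow> ('i \<Rightarrow> real) \<Rightarrow> real" where
  "lin j y = (\<Sum>k\<in>J. T j k * y k)"

text \<open>With \<open>r = 1 / sqrt n\<close> this is the \<open>Q\<close> of the overview. In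
  Malliavin terms \<open>2 * quad r\<close> is half the squared norm of the derivative of
  \<open>chaos r\<close>, the quantity whose fluctuation measures the distance to a normal
  law.\<close>

definition quad :: "real \<Rightarrow> ('i \<Rightarrow> real) \<Rightarrow> real" where
  "quad r y = r\<^sup>2 * (\<Sum>i\<in>J. y i * lin i y)"

definition T2 :: "'i \<Rightarrow> 'i \<Rightarrow> real" where
  "T2 j l = (\<Sum>k\<in>J. T j k * T k l)"

definition lin2 :: "'i \<Rightarrow> ('i \<Rightarrow> real) \<Rightarrow> real" where
  "lin2 j y = (\<Sum>k\<in>J. T2 j k * y k)"

lemma measurable_poly[measurable]:
  shows "chaos r \<in> borel_measurable (PiM J (\<lambda>_. borel))"
    and "lin j \<in> borel_measurable (PiM J (\<lambda>_. borel))"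
    and "lin2 j \<in> borel_measurable (PiM J (\<lambda>_. borel))"
    and "quad r \<in> borel_measurable (PiM J (\<lambda>_. borel))"
  unfolding chaos_def[abs_def] lin_def[abs_def] lin2_def[abs_def] quad_def[abs_def] by measurable

lemma lin_bound: "\<exists>A\<ge>0. \<forall>y. \<bar>\<Sum>k\<in>J. c k * y k\<bar> \<le> A * weight y"
proof (intro exI conjI allI)
  let ?A = "\<Sum>k\<in>J. \<bar>c k\<bar>"
  show "0 \<le> ?A" by (rule sum_nonneg) simp
  fix y
  have "\<bar>\<Sum>k\<in>J. c k * y k\<bar> \<le> (\<Sum>k\<in>J. \<bar>c k * y k\<bar>)" by (rule sum_abs)
  also have "\<dots> \<le> (\<Sum>k\<in>J. \<bar>c k\<bar> * weight y)"
    unfolding abs_mult by (intro sum_mono mult_left_mono abs_le_weight) auto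
  finally show "\<bar>\<Sum>k\<in>J. c k * y k\<bar> \<le> ?A * weight y" by (simp add: sum_distrib_right)
qed

lemma quad_bound: "\<exists>A\<ge>0. \<forall>y. \<bar>quad r y\<bar> \<le> A * weight y ^ 2"
proof -
  have "\<forall>i. \<exists>A\<ge>0. \<forall>y. \<bar>lin i y\<bar> \<le> A * weight y" unfolding lin_def using lin_bound by blast
  then obtain A where A: "\<And>i. A i \<ge> 0" "\<And>i y. \<bar>lin i y\<bar> \<le> A i * weight y" by metis
  show ?thesis
  proof (intro exI conjI allI)
    show "0 \<le> r\<^sup>2 * (\<Sum>i\<in>J. A i)" using A(1) by (intro mult_nonneg_nonneg sum_nonneg) auto
    fix y
    have "\<bar>\<Sum>i\<in>J. y i * lin i y\<bar> \<le> (\<Sum>i\<in>J. \<bar>y i * lin i y\<bar>)" by (rule sum_abs)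
    also have "\<dots> \<le> (\<Sum>i\<in>J. weight y * (A i * weight y))"
      unfolding abs_mult using A weight_ge1[of y] by (intro sum_mono mult_mono abs_le_weight) auto
    also have "\<dots> = (\<Sum>i\<in>J. A i) * weight y ^ 2"
      by (simp add: sum_distrib_left sum_distrib_right power2_eq_square mult_ac)
    finally show "\<bar>quad r y\<bar> \<le> r\<^sup>2 * (\<Sum>i\<in>J. A i) * weight y ^ 2"
      unfolding quad_def abs_mult by (simp add: mult.assoc mult_left_mono)
  qed
qed

lemma weight_power_mono: "m \<le> n \<Longrightarrow> weight y ^ m \<le> weight y ^ n"
  by (rule power_increasing[OF _ weight_ge1])

lemma cov_lin:
  assumes "\<And>k. k \<in> J \<Longrightarrow> a k = a' k"
  shows "(LINT x|M. (\<Sum>k\<in>J. a k * G k x) * (\<Sum>l\<in>J. b l * G l x)) = (\<Sum>k\<in>J. \<Sum>l\<in>J. a k * b l * T k l)"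
    and "integrable M (\<lambda>x. (\<Sum>k\<in>J. a k * G k x) * (\<Sum>l\<in>J. b l * G l x))"
proof -
  have i: "integrable M (\<lambda>x. G k x * G l x)" if "k \<in> J" "l \<in> J" for k l
  proof -
    have [measurable]: "(\<lambda>y. y k) \<in> borel_measurable (PiM J (\<lambda>_. borel :: real measure))"
      "(\<lambda>y. y l) \<in> borel_measurable (PiM J (\<lambda>_. borel :: real measure))"
      using that by (auto intro: measurable_component_singleton)
    have "integrable M (\<lambda>x. (\<lambda>y. complex_of_real (y k * y l)) (vec x))"
    proof (rule integrable_weight_bound[of _ 1])
      fix y
      have "norm (complex_of_real (y k * y l)) \<le> weight y * weight y"
        unfolding norm_of_real abs_mult using weight_ge1[of y] that by (intro mult_mono abs_le_weight) auto
      also have "\<dots> \<le> 1 * weight y ^ 4"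
        using weight_power_mono[of 2 4 y] by (simp add: power2_eq_square)
      finally show "norm (complex_of_real (y k * y l)) \<le> 1 * weight y ^ 4" .
    qed measurable
    then show ?thesis using that by (simp add: complex_of_real_integrable_eq flip: of_real_mult)
  qed
  have eq: "(\<Sum>k\<in>J. a k * G k x) * (\<Sum>l\<in>J. b l * G l x) = (\<Sum>k\<in>J. \<Sum>l\<in>J. a k * b l * (G k x * G l x))" for x
    unfolding sum_product by (simp add: mult_ac)
  show "integrable M (\<lambda>x. (\<Sum>k\<in>J. a k * G k x) * (\<Sum>l\<in>J. b l * G l x))"
    unfolding eq by (intro Bochner_Integration.integrable_sum integrable_mult_right i)
  show "(LINT x|M. (\<Sum>k\<in>J. a k * G k x) * (\<Sum>l\<in>J. b l * G l x)) = (\<Sum>k\<in>J. \<Sum>l\<in>J. a k * b l * T k l)"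
    unfolding eq by (simp add: i cov_G)
qed

lemma lin_vec: "lin j (vec x) = (\<Sum>k\<in>J. T j k * G k x)"
  unfolding lin_def by (intro sum.cong) auto

lemma lin2_vec: "lin2 j (vec x) = (\<Sum>k\<in>J. T2 j k * G k x)"
  unfolding lin2_def by (intro sum.cong) auto

lemma quad_vec: "quad r (vec x) = r\<^sup>2 * (\<Sum>j\<in>J. G j x * lin j (vec x))"
  unfolding quad_def by (intro arg_cong2[of _ _ _ _ "(*)"] sum.cong) auto

lemma chaos_vec: "chaos r (vec x) = r * (\<Sum>j\<in>J. (G j x)\<^sup>2 - 1)"
  unfolding chaos_def by (intro arg_cong2[of _ _ _ _ "(*)"] sum.cong) auto

abbreviation line :: "'i \<Rightarrow> ('i \<Rightarrow> real) \<Rightarrow> real \<Rightarrow> 'i \<Rightarrow> real" where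
  "line j y s \<equiv> (\<lambda>k\<in>J. y k + s * T j k)"

lemma chaos_line_deriv:
  "((\<lambda>s. chaos r (line j y s)) has_real_derivative 2 * r * lin j (line j y s)) (at s)"
proof -
  have "chaos r (line j y s) = r * (\<Sum>i\<in>J. (y i + s * T j i)\<^sup>2 - 1)" for s
    unfolding chaos_def by (intro arg_cong2[of _ _ _ _ "(*)"] sum.cong) auto
  then have "((\<lambda>s. chaos r (line j y s)) has_real_derivative r * (\<Sum>i\<in>J. 2 * (y i + s * T j i) * T j i)) (at s)"
    by (auto intro!: derivative_eq_intros simp: algebra_simps)
  also have "r * (\<Sum>i\<in>J. 2 * (y i + s * T j i) * T j i) = 2 * r * lin j (line j y s)"
    unfolding lin_def by (simp add: sum_distrib_left mult_ac)
  finally show ?thesis .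
qed

lemma lin_line: "lin i (line j y s) = (\<Sum>k\<in>J. T i k * y k) + s * T2 i j"
  if "j \<in> J"
proof -
  have "lin i (line j y s) = (\<Sum>k\<in>J. T i k * (y k + s * T j k))"
    unfolding lin_def by (intro sum.cong) auto
  also have "\<dots> = (\<Sum>k\<in>J. T i k * y k) + s * (\<Sum>k\<in>J. T i k * T j k)"
    by (simp add: algebra_simps sum.distrib sum_distrib_left)
  also have "(\<Sum>k\<in>J. T i k * T j k) = T2 i j"
    unfolding T2_def using that T_sym by (intro sum.cong) auto
  finally show ?thesis .
qed

text \<open>The product rule gives two terms. Both are equal to \<open>lin2 j\<close>, one by
  associativity of the matrix product and one by symmetry of \<open>T2\<close>.\<close>

lemma quad_line_deriv:
  assumes j: "j \<in> J"
  shows "((\<lambda>s. quad r (line j y s)) has_real_derivative 2 * r\<^sup>2 * lin2 j (line j y s)) (at s)"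
proof -
  have q: "quad r (line j y s) = r\<^sup>2 * (\<Sum>i\<in>J. (y i + s * T j i) * ((\<Sum>k\<in>J. T i k * y k) + s * T2 i j))" for s
    unfolding quad_def lin_line[OF j] by (intro arg_cong2[of _ _ _ _ "(*)"] sum.cong) auto
  have s1: "(\<Sum>i\<in>J. T j i * ((\<Sum>k\<in>J. T i k * y k) + s * T2 i j)) = lin2 j (line j y s)"
  proof -
    have "(\<Sum>i\<in>J. T j i * ((\<Sum>k\<in>J. T i k * y k) + s * T2 i j)) = (\<Sum>i\<in>J. T j i * lin i (line j y s))"
      by (simp add: lin_line[OF j])
    also have "\<dots> = (\<Sum>i\<in>J. \<Sum>k\<in>J. T j i * T i k * line j y s k)"
      unfolding lin_def by (simp add: sum_distrib_left mult.assoc)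
    also have "\<dots> = (\<Sum>k\<in>J. \<Sum>i\<in>J. T j i * T i k * line j y s k)"
      by (rule sum.swap)
    finally show ?thesis unfolding lin2_def T2_def by (simp add: sum_distrib_right)
  qed
  have s2: "(\<Sum>i\<in>J. (y i + s * T j i) * T2 i j) = lin2 j (line j y s)"
  proof -
    have "T2 i j = T2 j i" if "i \<in> J" for i
      unfolding T2_def using that j T_sym by (intro sum.cong) (auto simp: mult.commute)
    then show ?thesis unfolding lin2_def by (intro sum.cong) (auto simp: mult.commute)
  qed
  have "((\<lambda>s. quad r (line j y s)) has_real_derivative r\<^sup>2 * (\<Sum>i\<in>J. T j i * ((\<Sum>k\<in>J. T i k * y k) + s * T2 i j)
      + (y i + s * T j i) * T2 i j)) (at s)"
    unfolding q by (auto intro!: derivative_eq_intros simp: mult_ac)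
  also have "r\<^sup>2 * (\<Sum>i\<in>J. T j i * ((\<Sum>k\<in>J. T i k * y k) + s * T2 i j) + (y i + s * T j i) * T2 i j)
      = 2 * r\<^sup>2 * lin2 j (line j y s)"
    unfolding sum.distrib s1 s2 by simp
  finally show ?thesis .
qed

lemma continuous_line:
  assumes j: "j \<in> J"
  shows "continuous_on UNIV (\<lambda>s. chaos r (line j y s))" "continuous_on UNIV (\<lambda>s. quad r (line j y s))"
    "continuous_on UNIV (\<lambda>s. lin i (line j y s))" "continuous_on UNIV (\<lambda>s. lin2 i (line j y s))"
    "continuous_on UNIV (\<lambda>s. line j y s j)"
proof -
  show "continuous_on UNIV (\<lambda>s. chaos r (line j y s))"
    by (rule DERIV_continuous_on[OF has_field_derivative_at_within, OF chaos_line_deriv])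
  show "continuous_on UNIV (\<lambda>s. quad r (line j y s))"
    by (rule DERIV_continuous_on[OF has_field_derivative_at_within, OF quad_line_deriv[OF j]])
  show "continuous_on UNIV (\<lambda>s. lin i (line j y s))"
    unfolding lin_line[OF j] by (intro continuous_intros)
  have "lin2 i (line j y s) = (\<Sum>k\<in>J. T2 i k * (y k + s * T j k))" for s
    unfolding lin2_def by (intro sum.cong) auto
  then show "continuous_on UNIV (\<lambda>s. lin2 i (line j y s))"
    by (simp only:) (intro continuous_intros)
  show "continuous_on UNIV (\<lambda>s. line j y s j)"
    using j by (simp, intro continuous_intros)
qed

text \<open>Integration by parts for the coordinate \<open>y j\<close> times the exponential.
  Differentiating the coordinate gives \<open>T j j = 1\<close>, a term that cancels against the
  \<open>- 1\<close>; differentiating the exponential gives the factor \<open>lin j\<close>.\<close>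

lemma chaos_by_parts:
  assumes j: "j \<in> J"
  shows "(CLINT x|M. of_real ((G j x)\<^sup>2 - 1) * iexp (t * chaos r (vec x)))
    = 2 * \<i> * of_real (t * r) * (CLINT x|M. of_real (G j x * lin j (vec x)) * iexp (t * chaos r (vec x)))"
proof -
  have [measurable]: "(\<lambda>y. y j) \<in> borel_measurable (PiM J (\<lambda>_. borel :: real measure))" "G j \<in> borel_measurable M"
    using j by (auto intro: measurable_component_singleton)
  obtain A where A: "A \<ge> 0" "\<And>y. \<bar>lin j y\<bar> \<le> A * weight y"
    unfolding lin_def using lin_bound by blast
  define h where "h y = of_real (y j) * iexp (t * chaos r y)" for y
  define g where "g y = of_real (y j * lin j y) * iexp (t * chaos r y)" for y
  define h' where "h' y = iexp (t * chaos r y) + 2 * \<i> * of_real (t * r) * g y" for y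
  have [measurable]: "h \<in> borel_measurable (PiM J (\<lambda>_. borel))" "h' \<in> borel_measurable (PiM J (\<lambda>_. borel))"
    "g \<in> borel_measurable (PiM J (\<lambda>_. borel))"
    unfolding h_def[abs_def] h'_def[abs_def] g_def[abs_def] by measurable
  have g_bd: "norm (g y) \<le> A * weight y ^ 2" for y
  proof -
    have "norm (g y) = \<bar>y j\<bar> * \<bar>lin j y\<bar>" by (simp add: g_def norm_mult)
    also have "\<dots> \<le> weight y * (A * weight y)"
      using A weight_ge1[of y] j by (intro mult_mono abs_le_weight) auto
    finally show ?thesis by (simp add: power2_eq_square mult_ac)
  qed
  define C where "C = 1 + 2 * \<bar>t * r\<bar> * A"
  have C: "C \<ge> 1" using A by (simp add: C_def)
  have wC: "weight y ^ 3 \<le> C * weight y ^ 3" for y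
  proof -
    have "0 \<le> weight y ^ 3" using weight_ge1[of y] by (intro zero_le_power) linarith
    from mult_right_mono[OF C this] show ?thesis by simp
  qed
  have parts: "(CLINT x|M. of_real (G j x) * h (vec x)) = (CLINT x|M. h' (vec x))"
  proof (rule integration_by_parts[OF j])
    fix y
    have "norm (h y) = \<bar>y j\<bar> ^ 1" by (simp add: h_def norm_mult)
    also have "\<dots> \<le> weight y ^ 3"
      using abs_le_weight[OF j, of y] weight_power_mono[of 1 3 y] by simp
    finally show "norm (h y) \<le> C * weight y ^ 3" using wC[of y] by simp
    have "norm (h' y) \<le> norm (iexp (t * chaos r y)) + norm (2 * \<i> * of_real (t * r) * g y)"
      unfolding h'_def by (rule norm_triangle_ineq)
    also have "\<dots> = 1 + 2 * \<bar>t * r\<bar> * norm (g y)"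
      by (simp add: norm_mult abs_mult)
    also have "\<dots> \<le> weight y ^ 2 + 2 * \<bar>t * r\<bar> * (A * weight y ^ 2)"
      using weight_power_mono[of 0 2 y] by (intro add_mono mult_left_mono g_bd) auto
    also have "\<dots> = C * weight y ^ 2" by (simp add: C_def algebra_simps)
    also have "\<dots> \<le> C * weight y ^ 3"
      using C weight_power_mono[of 2 3 y] by (intro mult_left_mono) auto
    finally show "norm (h' y) \<le> C * weight y ^ 3" .
    show "continuous_on UNIV (\<lambda>s. h' (line j y s))"
      unfolding h'_def g_def by (intro continuous_intros continuous_line j)
    fix s
    have "((\<lambda>s. t * chaos r (line j y s)) has_vector_derivative t * (2 * r * lin j (line j y s))) (at s)"
      using DERIV_cmult[OF chaos_line_deriv[of r y j s], of t] by (simp add: has_real_derivative_iff_has_vector_derivative)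
    from vector_diff_chain_at[OF this has_vector_derivative_iexp]
    have 1: "((\<lambda>s. iexp (t * chaos r (line j y s))) has_vector_derivative
       (t * (2 * r * lin j (line j y s))) *\<^sub>R (\<i> * iexp (t * chaos r (line j y s)))) (at s)"
      by (simp add: o_def)
    have "((\<lambda>s. line j y s j) has_real_derivative 1) (at s)"
      using j T_diag[OF j] by (auto intro!: derivative_eq_intros)
    from has_vector_derivative_scaleR[OF this 1]
    show "((\<lambda>s. h (line j y s)) has_vector_derivative h' (line j y s)) (at s)"
      by (simp add: h_def[abs_def] h'_def g_def scaleR_conv_of_real algebra_simps)
  qed measurable
  have gvec: "g (vec x) = of_real (G j x * lin j (vec x)) * iexp (t * chaos r (vec x))" for x
    unfolding g_def by (simp only: restrict_apply' j)
  have ig: "integrable M (\<lambda>x. g (vec x))"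
  proof (rule integrable_weight_bound[of _ A])
    show "norm (g y) \<le> A * weight y ^ 4" for y
      using g_bd[of y] mult_left_mono[OF weight_power_mono[of 2 4 y] A(1)] by linarith
  qed measurable
  have ie: "integrable M (\<lambda>x. iexp (t * chaos r (vec x)))"
    by (rule integrable_bounded_complex[OF prob_space_axioms, of _ 1]) auto
  have ih: "integrable M (\<lambda>x. (\<lambda>y. of_real (y j) * h y) (vec x))"
  proof (rule integrable_weight_bound[of _ 1])
    fix y
    have "norm (of_real (y j) * h y) = \<bar>y j\<bar> * \<bar>y j\<bar>" by (simp add: h_def norm_mult)
    also have "\<dots> \<le> weight y * weight y"
      using weight_ge1[of y] j by (intro mult_mono abs_le_weight) auto
    also have "\<dots> \<le> 1 * weight y ^ 4"
      using weight_power_mono[of 2 4 y] by (simp add: power2_eq_square)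
    finally show "norm (of_real (y j) * h y) \<le> 1 * weight y ^ 4" .
  qed measurable
  have ih': "integrable M (\<lambda>x. of_real (G j x) * h (vec x))"
    using ih j by simp
  have "(CLINT x|M. of_real ((G j x)\<^sup>2 - 1) * iexp (t * chaos r (vec x)))
     = (CLINT x|M. of_real (G j x) * h (vec x) - iexp (t * chaos r (vec x)))"
    using j by (intro Bochner_Integration.integral_cong) (auto simp: h_def algebra_simps power2_eq_square)
  also have "\<dots> = (CLINT x|M. h' (vec x)) - (CLINT x|M. iexp (t * chaos r (vec x)))"
    using ih' ie by (simp only: Bochner_Integration.integral_diff parts)
  also have "(CLINT x|M. h' (vec x)) = (CLINT x|M. iexp (t * chaos r (vec x))) + 2 * \<i> * of_real (t * r) * (CLINT x|M. g (vec x))"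
    unfolding h'_def using ie ig by (simp only: Bochner_Integration.integral_add integrable_mult_right integral_mult_right_zero)
  finally show ?thesis
    using gvec by (simp only: add_diff_cancel_left')
qed

lemma integrable_quad_moments:
  shows "integrable M (\<lambda>x. quad r (vec x))" "integrable M (\<lambda>x. (quad r (vec x))\<^sup>2)"
    "integrable M (\<lambda>x. (chaos r (vec x))\<^sup>2)"
proof -
  obtain A where A: "A \<ge> 0" "\<And>y. \<bar>quad r y\<bar> \<le> A * weight y ^ 2"
    using quad_bound by blast
  have "integrable M (\<lambda>x. (\<lambda>y. complex_of_real ((quad r y)\<^sup>2)) (vec x))"
  proof (rule integrable_weight_bound[of _ "A\<^sup>2"])
    fix y
    have "(quad r y)\<^sup>2 \<le> (A * weight y ^ 2)\<^sup>2"
      using A(2)[of y] by (rule power2_le_iff_abs_le[THEN iffD2, rotated]) (use A(1) in simp)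
    then show "norm (complex_of_real ((quad r y)\<^sup>2)) \<le> A\<^sup>2 * weight y ^ 4"
      by (simp add: power_mult_distrib del: of_real_power)
  qed measurable
  then show q2: "integrable M (\<lambda>x. (quad r (vec x))\<^sup>2)"
    by (simp only: complex_of_real_integrable_eq)
  show "integrable M (\<lambda>x. quad r (vec x))"
    by (rule integrable_of_square) (use q2 in auto)
  have "integrable M (\<lambda>x. (\<lambda>y. complex_of_real ((chaos r y)\<^sup>2)) (vec x))"
  proof (rule integrable_weight_bound[of _ "(\<bar>r\<bar> * (1 + card J))\<^sup>2"])
    fix y
    have w: "1 \<le> weight y ^ 2" using weight_power_mono[of 0 2 y] by simp
    have "(y i)\<^sup>2 \<le> weight y ^ 2" if "i \<in> J" for i
      using power_mono[OF abs_le_weight[OF that, of y], of 2] by simp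
    then have "\<bar>(y i)\<^sup>2 - 1\<bar> \<le> weight y ^ 2" if "i \<in> J" for i
      using w that zero_le_power2[of "y i"] by (smt (verit))
    then have "(\<Sum>i\<in>J. \<bar>(y i)\<^sup>2 - 1\<bar>) \<le> card J * weight y ^ 2"
      by (intro order_trans[OF sum_bounded_above]) auto
    then have "\<bar>\<Sum>i\<in>J. (y i)\<^sup>2 - 1\<bar> \<le> card J * weight y ^ 2"
      by (rule order_trans[OF sum_abs])
    also have "\<dots> \<le> (1 + card J) * weight y ^ 2" by (intro mult_right_mono) auto
    finally have "\<bar>chaos r y\<bar> \<le> \<bar>\<bar>r\<bar> * ((1 + card J) * weight y ^ 2)\<bar>"
      unfolding chaos_def abs_mult by (simp add: mult_left_mono)
    then have "(chaos r y)\<^sup>2 \<le> (\<bar>r\<bar> * ((1 + card J) * weight y ^ 2))\<^sup>2"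
      by (simp only: abs_le_square_iff)
    then show "norm (complex_of_real ((chaos r y)\<^sup>2)) \<le> (\<bar>r\<bar> * (1 + card J))\<^sup>2 * weight y ^ 4"
      by (simp add: power_mult_distrib mult.assoc del: of_real_power)
  qed measurable
  then show "integrable M (\<lambda>x. (chaos r (vec x))\<^sup>2)"
    by (simp only: complex_of_real_integrable_eq)
qed

lemma integrable_G_lin: "j \<in> J \<Longrightarrow> integrable M (\<lambda>x. G j x * lin j (vec x))"
  and expectation_G_lin: "j \<in> J \<Longrightarrow> expectation (\<lambda>x. G j x * lin j (vec x)) = (\<Sum>l\<in>J. (T j l)\<^sup>2)"
proof -
  assume j: "j \<in> J"
  define a where "a k = (if k = j then 1 else 0 :: real)" for k
  have G: "G j x = (\<Sum>k\<in>J. a k * G k x)" for x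
    using j by (simp add: a_def if_distrib[of "\<lambda>x. x * _"] cong: if_cong)
  show "integrable M (\<lambda>x. G j x * lin j (vec x))"
    unfolding lin_vec G by (rule cov_lin) simp
  have "expectation (\<lambda>x. G j x * lin j (vec x)) = (\<Sum>k\<in>J. \<Sum>l\<in>J. a k * T j l * T k l)"
    unfolding lin_vec G by (rule cov_lin) simp
  also have "\<dots> = (\<Sum>k\<in>J. if k = j then (\<Sum>l\<in>J. T j l * T k l) else 0)"
    by (intro sum.cong) (auto simp: a_def)
  also have "\<dots> = (\<Sum>l\<in>J. (T j l)\<^sup>2)" using j by (simp add: power2_eq_square)
  finally show "expectation (\<lambda>x. G j x * lin j (vec x)) = (\<Sum>l\<in>J. (T j l)\<^sup>2)" .
qed

lemma expectation_quad: "expectation (\<lambda>x. quad r (vec x)) = r\<^sup>2 * (\<Sum>j\<in>J. \<Sum>l\<in>J. (T j l)\<^sup>2)"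
  unfolding quad_vec by (simp add: integrable_G_lin expectation_G_lin)

text \<open>Sum of \<open>chaos_by_parts\<close> over \<open>j\<close>. As the left side is
  \<open>- \<i>\<close> times the derivative of the characteristic function, a constant
  \<open>quad\<close> would turn this into the differential equation of a normal law.\<close>

lemma chaos_characteristic_ode:
  "(CLINT x|M. of_real (chaos r (vec x)) * iexp (t * chaos r (vec x)))
    = 2 * \<i> * of_real t * (CLINT x|M. of_real (quad r (vec x)) * iexp (t * chaos r (vec x)))"
proof -
  have i1: "integrable M (\<lambda>x. of_real (G j x * lin j (vec x)) * iexp (t * chaos r (vec x)))" if "j \<in> J" for j
  proof (rule Bochner_Integration.integrable_bound[OF integrable_G_lin[OF that]])
    have [measurable]: "G j \<in> borel_measurable M" using that by simp
    show "(\<lambda>x. of_real (G j x * lin j (vec x)) * iexp (t * chaos r (vec x))) \<in> borel_measurable M" by measurable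
  qed (auto simp: norm_mult)
  have i2: "integrable M (\<lambda>x. of_real ((G j x)\<^sup>2 - 1) * iexp (t * chaos r (vec x)))" if "j \<in> J" for j
  proof (rule Bochner_Integration.integrable_bound)
    have [measurable]: "G j \<in> borel_measurable M" using that by simp
    define a where "a k = (if k = j then 1 else 0 :: real)" for k
    have G: "G j x = (\<Sum>k\<in>J. a k * G k x)" for x
      using that by (simp add: a_def if_distrib[of "\<lambda>x. x * _"] cong: if_cong)
    have "integrable M (\<lambda>x. G j x * G j x)"
      unfolding G by (rule cov_lin) simp
    then show "integrable M (\<lambda>x. (G j x)\<^sup>2 - 1)"
      by (simp add: power2_eq_square)
    show "(\<lambda>x. of_real ((G j x)\<^sup>2 - 1) * iexp (t * chaos r (vec x))) \<in> borel_measurable M" by measurable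
  qed (auto simp: norm_mult simp flip: of_real_power of_real_diff)
  have "(CLINT x|M. of_real (chaos r (vec x)) * iexp (t * chaos r (vec x)))
    = (CLINT x|M. (\<Sum>j\<in>J. of_real r * (of_real ((G j x)\<^sup>2 - 1) * iexp (t * chaos r (vec x)))))"
    by (intro Bochner_Integration.integral_cong refl)
       (subst chaos_vec, simp only: of_real_mult of_real_sum sum_distrib_left sum_distrib_right mult.assoc)
  also have "\<dots> = (\<Sum>j\<in>J. of_real r * (CLINT x|M. of_real ((G j x)\<^sup>2 - 1) * iexp (t * chaos r (vec x))))"
    using i2 by (subst Bochner_Integration.integral_sum) (auto intro!: sum.cong)
  also have "\<dots> = (\<Sum>j\<in>J. 2 * \<i> * of_real t * (of_real (r\<^sup>2) * (CLINT x|M. of_real (G j x * lin j (vec x)) * iexp (t * chaos r (vec x)))))"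
    by (intro sum.cong refl, subst chaos_by_parts, assumption) (simp add: power2_eq_square mult_ac)
  also have "\<dots> = 2 * \<i> * of_real t * (\<Sum>j\<in>J. (CLINT x|M. of_real (r\<^sup>2) * (of_real (G j x * lin j (vec x)) * iexp (t * chaos r (vec x)))))"
    by (simp only: sum_distrib_left integral_mult_right_zero)
  also have "(\<Sum>j\<in>J. (CLINT x|M. of_real (r\<^sup>2) * (of_real (G j x * lin j (vec x)) * iexp (t * chaos r (vec x)))))
     = (CLINT x|M. (\<Sum>j\<in>J. of_real (r\<^sup>2) * (of_real (G j x * lin j (vec x)) * iexp (t * chaos r (vec x)))))"
    using i1 by (intro Bochner_Integration.integral_sum[symmetric] integrable_mult_right) auto
  also have "\<dots> = (CLINT x|M. of_real (quad r (vec x)) * iexp (t * chaos r (vec x)))"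
    by (intro Bochner_Integration.integral_cong refl)
       (subst quad_vec, simp only: of_real_mult of_real_sum sum_distrib_left sum_distrib_right mult.assoc)
  finally show ?thesis .
qed

text \<open>In the square of \<open>quad\<close>, a single factor \<open>G j\<close> is integrated
  by parts against \<open>lin j\<close> times the second copy of \<open>quad\<close>, a function of
  cubic growth.\<close>

lemma second_moment_by_parts:
  assumes j: "j \<in> J"
  shows "expectation (\<lambda>x. G j x * (lin j (vec x) * quad r (vec x)))
    = T2 j j * expectation (\<lambda>x. quad r (vec x)) + 2 * r\<^sup>2 * (\<Sum>l\<in>J. (T2 j l)\<^sup>2)" (is ?eq)
    and "integrable M (\<lambda>x. G j x * (lin j (vec x) * quad r (vec x)))" (is ?int)
proof -
  have [measurable]: "(\<lambda>y. y j) \<in> borel_measurable (PiM J (\<lambda>_. borel :: real measure))" "G j \<in> borel_measurable M"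
    using j by (auto intro: measurable_component_singleton)
  obtain A where A: "A \<ge> 0" "\<And>y. \<bar>lin j y\<bar> \<le> A * weight y"
    unfolding lin_def using lin_bound by blast
  obtain A2 where A2: "A2 \<ge> 0" "\<And>y. \<bar>lin2 j y\<bar> \<le> A2 * weight y"
    unfolding lin2_def using lin_bound by blast
  obtain Q where Q: "Q \<ge> 0" "\<And>y. \<bar>quad r y\<bar> \<le> Q * weight y ^ 2"
    using quad_bound by blast
  define h where "h y = complex_of_real (lin j y * quad r y)" for y
  define h' where "h' y = complex_of_real (T2 j j * quad r y + lin j y * (2 * r\<^sup>2 * lin2 j y))" for y
  have [measurable]: "h \<in> borel_measurable (PiM J (\<lambda>_. borel))" "h' \<in> borel_measurable (PiM J (\<lambda>_. borel))"
    unfolding h_def[abs_def] h'_def[abs_def] by measurable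
  define C where "C = A * Q + \<bar>T2 j j\<bar> * Q + 2 * r\<^sup>2 * (A * A2)"
  have C: "A * Q \<le> C" "C \<ge> 0" using A Q A2 by (simp_all add: C_def)
  have w0: "0 \<le> weight y ^ n" for y n using weight_ge1[of y] by simp
  have h_bd: "norm (h y) \<le> C * weight y ^ 3" for y
  proof -
    have "norm (h y) \<le> (A * weight y) * (Q * weight y ^ 2)"
      unfolding h_def norm_of_real abs_mult using A Q weight_ge1[of y] by (intro mult_mono) auto
    also have "\<dots> = (A * Q) * weight y ^ 3" by (simp add: power2_eq_square power3_eq_cube mult_ac)
    also have "\<dots> \<le> C * weight y ^ 3" by (rule mult_right_mono[OF C(1) w0])
    finally show ?thesis .
  qed
  have h'_bd: "norm (h' y) \<le> C * weight y ^ 2" for y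
  proof -
    have "norm (h' y) \<le> \<bar>T2 j j\<bar> * \<bar>quad r y\<bar> + 2 * r\<^sup>2 * (\<bar>lin j y\<bar> * \<bar>lin2 j y\<bar>)"
      unfolding h'_def norm_of_real by (rule order_trans[OF abs_triangle_ineq]) (simp add: abs_mult mult_ac)
    also have "\<dots> \<le> \<bar>T2 j j\<bar> * (Q * weight y ^ 2) + 2 * r\<^sup>2 * ((A * weight y) * (A2 * weight y))"
      using A Q A2 weight_ge1[of y] by (intro add_mono mult_left_mono mult_mono) auto
    also have "\<dots> = (\<bar>T2 j j\<bar> * Q + 2 * r\<^sup>2 * (A * A2)) * weight y ^ 2"
      by (simp add: power2_eq_square algebra_simps)
    also have "\<dots> \<le> C * weight y ^ 2"
      using A Q by (intro mult_right_mono[OF _ w0]) (simp add: C_def)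
    finally show ?thesis .
  qed
  have parts: "(CLINT x|M. of_real (G j x) * h (vec x)) = (CLINT x|M. h' (vec x))"
  proof (rule integration_by_parts[OF j])
    fix y
    show "norm (h y) \<le> C * weight y ^ 3" by (rule h_bd)
    show "norm (h' y) \<le> C * weight y ^ 3"
      using h'_bd[of y] mult_left_mono[OF weight_power_mono[of 2 3 y] C(2)] by linarith
    show "continuous_on UNIV (\<lambda>s. h' (line j y s))"
      unfolding h'_def by (intro continuous_intros continuous_line j)
    fix s
    have "((\<lambda>s. lin j (line j y s)) has_real_derivative T2 j j) (at s)"
      unfolding lin_line[OF j] by (auto intro!: derivative_eq_intros)
    from DERIV_mult[OF this quad_line_deriv[OF j]]
    have "((\<lambda>s. lin j (line j y s) * quad r (line j y s)) has_real_derivative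
      (T2 j j * quad r (line j y s) + lin j (line j y s) * (2 * r\<^sup>2 * lin2 j (line j y s)))) (at s)"
      by (simp add: mult_ac)
    from has_vector_derivative_of_real[OF this]
    show "((\<lambda>s. h (line j y s)) has_vector_derivative h' (line j y s)) (at s)"
      by (simp only: h_def h'_def)
  qed measurable
  have "integrable M (\<lambda>x. (\<lambda>y. of_real (y j) * h y) (vec x))"
  proof (rule integrable_weight_bound[of _ C])
    fix y
    have "norm (of_real (y j) * h y) \<le> weight y * (C * weight y ^ 3)"
      unfolding norm_mult using abs_le_weight[OF j, of y] weight_ge1[of y] by (intro mult_mono h_bd) auto
    then show "norm (of_real (y j) * h y) \<le> C * weight y ^ 4"
      by (simp add: power4_eq_xxxx power3_eq_cube mult_ac)
  qed measurable
  moreover have "of_real (G j x) * h (vec x) = complex_of_real (G j x * (lin j (vec x) * quad r (vec x)))" for x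
    by (simp add: h_def)
  ultimately show ?int
    using j by (simp add: complex_of_real_integrable_eq del: of_real_mult)
  have "complex_of_real (expectation (\<lambda>x. G j x * (lin j (vec x) * quad r (vec x)))) = (CLINT x|M. of_real (G j x) * h (vec x))"
    by (simp only: h_def of_real_mult[symmetric] integral_complex_of_real)
  also have "\<dots> = complex_of_real (expectation (\<lambda>x. T2 j j * quad r (vec x) + lin j (vec x) * (2 * r\<^sup>2 * lin2 j (vec x))))"
    by (simp only: parts h'_def integral_complex_of_real)
  finally have "expectation (\<lambda>x. G j x * (lin j (vec x) * quad r (vec x)))
      = expectation (\<lambda>x. T2 j j * quad r (vec x) + 2 * r\<^sup>2 * (lin j (vec x) * lin2 j (vec x)))"
    by (simp only: of_real_eq_iff mult_ac)
  also have "\<dots> = T2 j j * expectation (\<lambda>x. quad r (vec x)) + 2 * r\<^sup>2 * expectation (\<lambda>x. lin j (vec x) * lin2 j (vec x))"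
    using integrable_quad_moments(1)[of r] cov_lin(2)[of "T j" "T j" "T2 j"]
    by (simp add: lin_vec lin2_vec)
  also have "expectation (\<lambda>x. lin j (vec x) * lin2 j (vec x)) = (\<Sum>k\<in>J. \<Sum>l\<in>J. T j k * T2 j l * T k l)"
    unfolding lin_vec lin2_vec by (rule cov_lin) simp
  also have "\<dots> = (\<Sum>l\<in>J. \<Sum>k\<in>J. T j k * T2 j l * T k l)"
    by (rule sum.swap)
  also have "\<dots> = (\<Sum>l\<in>J. (T2 j l)\<^sup>2)"
    by (intro sum.cong refl) (simp add: T2_def power2_eq_square sum_distrib_left sum_distrib_right mult_ac)
  finally show ?eq .
qed

text \<open>Summing \<open>second_moment_by_parts\<close> over \<open>j\<close>, the first terms add
  up to the squared mean, because the trace of \<open>T2\<close> is the squared Frobenius norm of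
  \<open>T\<close>. The second terms are the variance.\<close>

lemma quad_variance:
  "expectation (\<lambda>x. (quad r (vec x) - expectation (\<lambda>x. quad r (vec x)))\<^sup>2) = 2 * r ^ 4 * (\<Sum>j\<in>J. \<Sum>l\<in>J. (T2 j l)\<^sup>2)"
proof -
  let ?q = "expectation (\<lambda>x. quad r (vec x))"
  have "expectation (\<lambda>x. (quad r (vec x))\<^sup>2) = expectation (\<lambda>x. r\<^sup>2 * (\<Sum>j\<in>J. G j x * (lin j (vec x) * quad r (vec x))))"
  proof (intro Bochner_Integration.integral_cong refl)
    fix x
    have "(quad r (vec x))\<^sup>2 = r\<^sup>2 * (\<Sum>j\<in>J. G j x * lin j (vec x)) * quad r (vec x)"
      unfolding power2_eq_square[of "quad r (vec x)"] by (simp only: quad_vec[symmetric])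
    then show "(quad r (vec x))\<^sup>2 = r\<^sup>2 * (\<Sum>j\<in>J. G j x * (lin j (vec x) * quad r (vec x)))"
      by (simp only: mult.assoc sum_distrib_right)
  qed
  also have "\<dots> = r\<^sup>2 * (\<Sum>j\<in>J. T2 j j * ?q + 2 * r\<^sup>2 * (\<Sum>l\<in>J. (T2 j l)\<^sup>2))"
    by (simp add: second_moment_by_parts)
  also have "\<dots> = (r\<^sup>2 * (\<Sum>j\<in>J. T2 j j)) * ?q + 2 * r ^ 4 * (\<Sum>j\<in>J. \<Sum>l\<in>J. (T2 j l)\<^sup>2)"
    by (simp add: sum.distrib sum_distrib_left sum_distrib_right power4_eq_xxxx power2_eq_square algebra_simps)
  also have "(\<Sum>j\<in>J. T2 j j) = (\<Sum>j\<in>J. \<Sum>l\<in>J. (T j l)\<^sup>2)"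
    unfolding T2_def using T_sym by (intro sum.cong) (auto simp: power2_eq_square)
  finally have "expectation (\<lambda>x. (quad r (vec x))\<^sup>2) = ?q\<^sup>2 + 2 * r ^ 4 * (\<Sum>j\<in>J. \<Sum>l\<in>J. (T2 j l)\<^sup>2)"
    by (simp only: expectation_quad[symmetric] power2_eq_square[of ?q])
  then show ?thesis
    by (subst variance_eq) (auto intro: integrable_quad_moments)
qed

text \<open>Replacing \<open>quad\<close> by its mean in the differential equation costs at most its
  standard deviation, times \<open>2 * \<bar>t\<bar>\<close>. The variance of the comparison law is
  therefore twice the mean of \<open>quad\<close>.\<close>

theorem chaos_characteristic_function:
  "norm ((CLINT x|M. iexp (t * chaos r (vec x))) - of_real (exp (- (2 * r\<^sup>2 * (\<Sum>j\<in>J. \<Sum>l\<in>J. (T j l)\<^sup>2) * t\<^sup>2) / 2)))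
    \<le> t\<^sup>2 * (2 * sqrt (2 * r ^ 4 * (\<Sum>j\<in>J. \<Sum>l\<in>J. (T2 j l)\<^sup>2)))"
proof (rule characteristic_function_near_gaussian)
  let ?q = "expectation (\<lambda>x. quad r (vec x))"
  fix t
  let ?e = "\<lambda>x. iexp (t * chaos r (vec x))"
  have ie: "integrable M ?e"
    by (rule integrable_bounded_complex[OF prob_space_axioms, of _ 1]) auto
  have iq: "integrable M (\<lambda>x. of_real (quad r (vec x)) * ?e x)"
    by (rule Bochner_Integration.integrable_bound[OF integrable_quad_moments(1)[of r]]) (auto simp: norm_mult)
  let ?I = "CLINT x|M. of_real (quad r (vec x) - ?q) * ?e x"
  have "norm ?I \<le> (LINT x|M. norm (of_real (quad r (vec x) - ?q) * ?e x))"
    by (rule integral_norm_bound)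
  also have "\<dots> = (LINT x|M. \<bar>quad r (vec x) - ?q\<bar>)"
    by (simp only: norm_mult norm_of_real norm_exp_i_times mult_1_right)
  also have "\<dots> \<le> sqrt (expectation (\<lambda>x. (quad r (vec x) - ?q)\<^sup>2))"
  proof (rule expectation_abs_le_sqrt)
    show "integrable M (\<lambda>x. (quad r (vec x) - ?q)\<^sup>2)"
      using integrable_quad_moments[of r] by (simp add: power2_diff)
  qed measurable
  also have "\<dots> = sqrt (2 * r ^ 4 * (\<Sum>j\<in>J. \<Sum>l\<in>J. (T2 j l)\<^sup>2))"
    by (simp only: quad_variance)
  finally have n: "norm ?I \<le> sqrt (2 * r ^ 4 * (\<Sum>j\<in>J. \<Sum>l\<in>J. (T2 j l)\<^sup>2))" .
  have I: "?I = (CLINT x|M. of_real (quad r (vec x)) * ?e x) - of_real ?q * (CLINT x|M. ?e x)"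
    using ie iq by (simp only: of_real_diff left_diff_distrib Bochner_Integration.integral_diff
        integrable_mult_right integral_mult_right_zero)
  have "\<i> * (CLINT x|M. of_real (chaos r (vec x)) * ?e x) + of_real (2 * r\<^sup>2 * (\<Sum>j\<in>J. \<Sum>l\<in>J. (T j l)\<^sup>2) * t) * (CLINT x|M. ?e x)
     = - (2 * of_real t * ?I)"
  proof -
    have "2 * r\<^sup>2 * (\<Sum>j\<in>J. \<Sum>l\<in>J. (T j l)\<^sup>2) = 2 * ?q" by (simp only: expectation_quad mult.assoc)
    moreover have "\<i> * (2 * \<i> * of_real t * a) + of_real (2 * q * t) * b = - (2 * of_real t * (a - of_real q * b))" for a b q
      by (simp add: algebra_simps)
    ultimately show ?thesis unfolding chaos_characteristic_ode I by (simp only:)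
  qed
  then have "norm (\<i> * (CLINT x|M. of_real (chaos r (vec x)) * ?e x)
      + of_real (2 * r\<^sup>2 * (\<Sum>j\<in>J. \<Sum>l\<in>J. (T j l)\<^sup>2) * t) * (CLINT x|M. ?e x)) = 2 * \<bar>t\<bar> * norm ?I"
    by (simp only: norm_minus_cancel norm_mult norm_of_real norm_numeral)
  also have "\<dots> \<le> 2 * \<bar>t\<bar> * sqrt (2 * r ^ 4 * (\<Sum>j\<in>J. \<Sum>l\<in>J. (T2 j l)\<^sup>2))"
    by (rule mult_left_mono[OF n]) simp
  finally show "norm (\<i> * (CLINT x|M. of_real (chaos r (vec x)) * ?e x)
      + of_real (2 * r\<^sup>2 * (\<Sum>j\<in>J. \<Sum>l\<in>J. (T j l)\<^sup>2) * t) * (CLINT x|M. ?e x))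
    \<le> \<bar>t\<bar> * (2 * sqrt (2 * r ^ 4 * (\<Sum>j\<in>J. \<Sum>l\<in>J. (T2 j l)\<^sup>2)))"
    by (simp only: mult_ac)
qed (auto intro!: integrable_quad_moments mult_nonneg_nonneg sum_nonneg)

end

section \<open>Covariances of filtered increments\<close>

text \<open>Covariance at lag \<open>x\<close> of the filtered increments for mesh 1: as the
  coefficients sum to zero, only the part \<open>\<bar>t - s\<bar> powr (2 * H)\<close> of the
  covariance of the process survives. The lag is real so that differences of indices may be
  negative.\<close>

definition filter_cov :: "real \<Rightarrow> nat \<Rightarrow> (nat \<Rightarrow> real) \<Rightarrow> real \<Rightarrow> real" where
  "filter_cov H p a x = - (\<Sum>k\<le>p. \<Sum>l\<le>p. a k * a l * \<bar>x + real k - real l\<bar> powr (2 * H)) / 2"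

lemma filter_cov_minus: "filter_cov H p a (- x) = filter_cov H p a x"
proof -
  have "(\<Sum>k\<le>p. \<Sum>l\<le>p. a k * a l * \<bar>- x + real k - real l\<bar> powr (2 * H))
      = (\<Sum>l\<le>p. \<Sum>k\<le>p. a k * a l * \<bar>- x + real k - real l\<bar> powr (2 * H))"
    by (rule sum.swap)
  also have "\<dots> = (\<Sum>l\<le>p. \<Sum>k\<le>p. a l * a k * \<bar>x + real l - real k\<bar> powr (2 * H))"
  proof (intro sum.cong refl)
    fix k l
    have "\<bar>- x + real k - real l\<bar> = \<bar>x + real l - real k\<bar>" by linarith
    then show "a k * a l * \<bar>- x + real k - real l\<bar> powr (2 * H) = a l * a k * \<bar>x + real l - real k\<bar> powr (2 * H)"
      by (simp add: mult_ac)
  qed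
  finally show ?thesis by (simp add: filter_cov_def)
qed

lemma increment_variance_eq: "increment_variance H p a \<Delta> = \<Delta> powr (2 * H) * filter_cov H p a 0"
  by (simp add: increment_variance_def filter_cov_def)

section \<open>Positivity of the variance through a spectral representation\<close>

lemma integrable_powr_near_0:
  assumes "-1 < b"
  shows "integrable lborel (\<lambda>u::real. indicator {0..1} u * u powr b)"
proof -
  have "(\<lambda>u::real. u powr b) integrable_on {0..1}"
    using has_integral_powr_from_0[OF assms, of 1] by (auto simp: integrable_on_def)
  then have "(\<lambda>u::real. u powr b) absolutely_integrable_on {0..1}"
    by (rule nonnegative_absolutely_integrable_1) simp
  then show ?thesis
    unfolding set_integrable_def by (subst (asm) integrable_completion) auto
qed

lemma integrable_powr_at_infinity:
  assumes "b < -1"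
  shows "integrable lborel (\<lambda>u::real. indicator {1..} u * u powr b)"
proof -
  have "(\<lambda>u::real. u powr b) integrable_on {1..}"
    using has_integral_powr_to_inf[OF assms, of 1] by (auto simp: integrable_on_def)
  then have "(\<lambda>u::real. u powr b) absolutely_integrable_on {1..}"
    by (rule nonnegative_absolutely_integrable_1) simp
  then show ?thesis
    unfolding set_integrable_def by (subst (asm) integrable_completion) auto
qed

definition spectral_integrand :: "real \<Rightarrow> real \<Rightarrow> real \<Rightarrow> real" where
  "spectral_integrand H x u = indicator {0<..} u * ((1 - cos (x * u)) * u powr (-1 - 2 * H))"

lemma measurable_spectral_integrand[measurable]: "spectral_integrand H x \<in> borel_measurable borel"
  unfolding spectral_integrand_def[abs_def] by measurable

text \<open>Integrability holds because \<open>1 - cos u\<close> is at most \<open>u^2\<close> near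
  0 and at most 2 at infinity. The power of \<open>\<bar>x\<bar>\<close> comes out of the
  substitution of \<open>x * u\<close> for \<open>u\<close>; evenness of the cosine covers negative
  \<open>x\<close>.\<close>

lemma spectral_scaling:
  assumes H: "0 < H" "H < 1"
  shows "integrable lborel (spectral_integrand H x)"
    and "(LINT u|lborel. spectral_integrand H x u) = \<bar>x\<bar> powr (2 * H) * (LINT u|lborel. spectral_integrand H 1 u)"
proof -
  have base: "integrable lborel (spectral_integrand H 1)"
  proof (rule Bochner_Integration.integrable_bound)
    show "integrable lborel (\<lambda>u::real. indicator {0..1} u * u powr (1 - 2 * H) + 2 * (indicator {1..} u * u powr (-1 - 2 * H)))"
      using H by (intro Bochner_Integration.integrable_add integrable_mult_right integrable_powr_near_0 integrable_powr_at_infinity) auto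
    have "\<bar>spectral_integrand H 1 u\<bar> \<le> indicator {0..1} u * u powr (1 - 2 * H) + 2 * (indicator {1..} u * u powr (-1 - 2 * H))" for u
    proof -
      consider "u \<le> 0" | "0 < u" "u < 1" | "1 \<le> u" by linarith
      then show ?thesis
      proof cases
        case 1
        then show ?thesis by (simp add: spectral_integrand_def)
      next
        case 2
        have "1 - cos u = 2 * (sin (u / 2))\<^sup>2" using cos_double_sin[of "u / 2"] by simp
        also have "\<dots> \<le> 2 * (u / 2)\<^sup>2"
          by (intro mult_left_mono abs_le_square_iff[THEN iffD1, OF abs_sin_x_le_abs_x]) simp
        finally have "1 - cos u \<le> u\<^sup>2" by (simp add: power_divide) (use zero_le_power2[of u] in linarith)
        then have "\<bar>1 - cos u\<bar> * u powr (-1 - 2 * H) \<le> u\<^sup>2 * u powr (-1 - 2 * H)"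
          by (intro mult_right_mono) auto
        also have "\<dots> = u powr 2 * u powr (-1 - 2 * H)" using 2 by (simp add: powr_numeral)
        also have "\<dots> = u powr (1 - 2 * H)" by (simp flip: powr_add)
        finally show ?thesis using 2 by (simp add: spectral_integrand_def abs_mult)
      next
        case 3
        have "\<bar>1 - cos u\<bar> \<le> 2" using cos_le_one[of u] cos_ge_minus_one[of u] by linarith
        then have "\<bar>1 - cos u\<bar> * u powr (-1 - 2 * H) \<le> 2 * u powr (-1 - 2 * H)"
          by (intro mult_right_mono) auto
        then have "\<bar>spectral_integrand H 1 u\<bar> \<le> 2 * (indicator {1..} u * u powr (-1 - 2 * H))"
          using 3 by (simp add: spectral_integrand_def abs_mult)
        moreover have "0 \<le> indicator {0..1} u * u powr (1 - 2 * H)" by simp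
        ultimately show ?thesis by linarith
      qed
    qed
    then show "AE u in lborel. norm (spectral_integrand H 1 u) \<le>
        norm (indicator {0..1} u * u powr (1 - 2 * H) + 2 * (indicator {1..} u * u powr (-1 - 2 * H)))"
      unfolding real_norm_def by (intro AE_I2 order_trans[OF _ abs_ge_self])
  qed simp
  have pos: "integrable lborel (spectral_integrand H x) \<and>
      (LINT u|lborel. spectral_integrand H x u) = x powr (2 * H) * (LINT u|lborel. spectral_integrand H 1 u)"
    if x: "x > 0" for x
  proof -
    have eq: "spectral_integrand H 1 (0 + x * u) = x powr (-1 - 2 * H) * spectral_integrand H x u" for u
      using x by (auto simp: spectral_integrand_def indicator_def powr_mult zero_less_mult_iff)
    have i: "integrable lborel (\<lambda>u. x powr (-1 - 2 * H) * spectral_integrand H x u)"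
      using lborel_integrable_real_affine[OF base, of x 0] x unfolding eq by simp
    then have i': "integrable lborel (spectral_integrand H x)"
      using x by (subst (asm) integrable_mult_left_iff) auto
    have "(LINT u|lborel. spectral_integrand H 1 u) = x * (x powr (-1 - 2 * H) * (LINT u|lborel. spectral_integrand H x u))"
      using lborel_integral_real_affine[of x "spectral_integrand H 1" 0] x unfolding eq by simp
    then have "x powr (2 * H) * (LINT u|lborel. spectral_integrand H 1 u)
        = (x powr (2 * H) * (x powr 1 * x powr (-1 - 2 * H))) * (LINT u|lborel. spectral_integrand H x u)"
      using x by simp
    also have "x powr (2 * H) * (x powr 1 * x powr (-1 - 2 * H)) = 1"
      unfolding powr_add[symmetric] using x by simp
    finally have "x powr (2 * H) * (LINT u|lborel. spectral_integrand H 1 u) = (LINT u|lborel. spectral_integrand H x u)"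
      by (simp only: mult_1)
    from i' this[symmetric] show ?thesis by (rule conjI)
  qed
  have neg: "spectral_integrand H (- x) = spectral_integrand H x" for x
    by (simp add: spectral_integrand_def fun_eq_iff)
  have zero: "spectral_integrand H 0 = (\<lambda>_. 0)"
    by (simp add: spectral_integrand_def fun_eq_iff)
  have "integrable lborel (spectral_integrand H x) \<and>
      (LINT u|lborel. spectral_integrand H x u) = \<bar>x\<bar> powr (2 * H) * (LINT u|lborel. spectral_integrand H 1 u)"
  proof (cases x "0::real" rule: linorder_cases)
    case less
    then show ?thesis using pos[of "- x"] by (simp add: neg)
  next
    case equal
    then show ?thesis by (simp add: zero)
  next
    case greater
    then show ?thesis using pos[of x] by simp
  qed
  then show "integrable lborel (spectral_integrand H x)"
    and "(LINT u|lborel. spectral_integrand H x u) = \<bar>x\<bar> powr (2 * H) * (LINT u|lborel. spectral_integrand H 1 u)"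
    by blast+
qed

text \<open>The two sums are the real and imaginary part of the polynomial with coefficients
  \<open>a k\<close> at the point \<open>cis u\<close>. This polynomial is nonzero and has finitely
  many roots, and \<open>cis\<close> is injective on the unit interval since
  \<open>1 < pi\<close>.\<close>

lemma finite_trigonometric_zeros:
  assumes "\<exists>k\<le>p. a k \<noteq> 0"
  shows "finite {u::real. u \<in> {0<..<1} \<and> (\<Sum>k\<le>p. a k * cos (real k * u)) = 0 \<and> (\<Sum>k\<le>p. a k * sin (real k * u)) = 0}"
    (is "finite ?Z")
proof (rule finite_imageD)
  have "cis ` ?Z \<subseteq> {z. (\<Sum>k\<le>p. complex_of_real (a k) * z ^ k) = 0}"
  proof safe
    fix u :: real
    assume "(\<Sum>k\<le>p. a k * cos (real k * u)) = 0" "(\<Sum>k\<le>p. a k * sin (real k * u)) = 0"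
    then show "(\<Sum>k\<le>p. complex_of_real (a k) * cis u ^ k) = 0"
      unfolding Complex.DeMoivre by (simp add: complex_eq_iff)
  qed
  moreover have "finite {z. (\<Sum>k\<le>p. complex_of_real (a k) * z ^ k) = 0}"
    using assms by (subst polyfun_finite_roots) auto
  ultimately show "finite (cis ` ?Z)" by (rule finite_subset)
  show "inj_on cis ?Z"
  proof (rule inj_onI)
    fix u v assume *: "u \<in> ?Z" "v \<in> ?Z" "cis u = cis v"
    have pi: "pi > 1" using pi_gt3 by simp
    have "0 \<le> u" "u \<le> pi" "0 \<le> v" "v \<le> pi" using *(1,2) pi by auto
    moreover have "cos u = cos v" using arg_cong[OF *(3), of Re] by simp
    ultimately show "u = v" by (rule cos_inj_pi)
  qed
qed

text \<open>Spectral representation: \<open>\<bar>x\<bar> powr (2 * H)\<close> is a multiple of the integral of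
  \<open>(1 - cos (x u)) u powr (-1 - 2 H)\<close> over \<open>u > 0\<close>, so the variance is the integral of the squared modulus of
  \<open>\<Sum> a\<^sub>k exp (i k u)\<close>.\<close>

lemma filter_cov_0_pos:
  assumes H: "0 < H" "H < 1" and a: "zero_sum_filter p a" and m: "has_filter_order p a m"
  shows "filter_cov H p a 0 > 0"
proof -
  have nz: "\<exists>k\<le>p. a k \<noteq> 0"
  proof (rule ccontr)
    assume "\<not> ?thesis"
    then show False using m by (simp add: has_filter_order_def)
  qed
  have sum0: "(\<Sum>k\<le>p. a k) = 0" using a by (simp add: zero_sum_filter_def)
  define c where "c = (LINT u|lborel. spectral_integrand H 1 u)"
  define Q where "Q u = (\<Sum>k\<le>p. a k * cos (real k * u))\<^sup>2 + (\<Sum>k\<le>p. a k * sin (real k * u))\<^sup>2" for u :: real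
  \<comment> \<open>The constant 1 contributes the squared sum of the coefficients, which is 0; by
    the addition theorem the cosines contribute minus the squared modulus
    \<open>Q u\<close>.\<close>
  have Q: "(\<Sum>k\<le>p. \<Sum>l\<le>p. a k * a l * (1 - cos ((real k - real l) * u))) = - Q u" for u
  proof -
    have "(\<Sum>k\<le>p. \<Sum>l\<le>p. a k * a l * (1 - cos ((real k - real l) * u)))
      = (\<Sum>k\<le>p. \<Sum>l\<le>p. a k * a l - ((a k * cos (real k * u)) * (a l * cos (real l * u)) + (a k * sin (real k * u)) * (a l * sin (real l * u))))"
      by (intro sum.cong refl) (simp add: left_diff_distrib cos_diff algebra_simps)
    also have "\<dots> = (\<Sum>k\<le>p. a k) * (\<Sum>k\<le>p. a k) - Q u"
      unfolding Q_def power2_eq_square sum_product by (simp add: sum_subtractf sum.distrib)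
    finally show ?thesis using sum0 by simp
  qed
  define g where "g u = (\<Sum>k\<le>p. \<Sum>l\<le>p. a k * a l * spectral_integrand H (real k - real l) u)" for u :: real
  have g: "g u = - (indicator {0<..} u * (Q u * u powr (-1 - 2 * H)))" for u
  proof -
    have "g u = indicator {0<..} u * u powr (-1 - 2 * H) * (\<Sum>k\<le>p. \<Sum>l\<le>p. a k * a l * (1 - cos ((real k - real l) * u)))"
      unfolding g_def spectral_integrand_def by (simp add: sum_distrib_left mult_ac)
    then show ?thesis unfolding Q by simp
  qed
  have gi: "integrable lborel g"
    unfolding g_def[abs_def] by (intro Bochner_Integration.integrable_sum integrable_mult_right spectral_scaling H)
  have "integral\<^sup>L lborel g = (\<Sum>k\<le>p. \<Sum>l\<le>p. a k * a l * (\<bar>real k - real l\<bar> powr (2 * H) * c))"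
    unfolding g_def c_def by (simp add: spectral_scaling(1)[OF H] flip: spectral_scaling(2)[OF H])
  also have "\<dots> = - 2 * (filter_cov H p a 0 * c)"
    by (simp add: filter_cov_def sum_distrib_right mult.assoc)
  finally have ig: "filter_cov H p a 0 * c = (LINT u|lborel. - g u) / 2" by simp
  have gpos: "0 \<le> - g u" for u by (simp add: g Q_def)
  \<comment> \<open>A vanishing integral would force \<open>Q u = 0\<close> for almost every
    \<open>u\<close> in the open unit interval, against the finiteness of the zeros.\<close>
  have "(LINT u|lborel. - g u) \<noteq> 0"
  proof
    assume "(LINT u|lborel. - g u) = 0"
    then have "AE u in lborel. - g u = 0"
      by (subst (asm) integral_nonneg_eq_0_iff_AE) (use gi gpos in auto)
    moreover have "AE u in lborel. u \<notin> {u::real. u \<in> {0<..<1} \<and> (\<Sum>k\<le>p. a k * cos (real k * u)) = 0 \<and> (\<Sum>k\<le>p. a k * sin (real k * u)) = 0}"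
      using finite_imp_null_set_lborel[OF finite_trigonometric_zeros[OF nz]] by (rule AE_not_in)
    ultimately have "AE u in lborel. u \<notin> {0<..<1::real}"
    proof eventually_elim
      case (elim u)
      show ?case
      proof
        assume u: "u \<in> {0<..<1}"
        then have "Q u = 0" using elim(1) by (auto simp: g)
        then show False using elim(2) u by (auto simp: Q_def sum_power2_eq_zero_iff)
      qed
    qed
    then have "{0<..<1::real} \<in> null_sets lborel"
      by (subst AE_iff_null_sets) auto
    then show False by (simp add: null_sets_def)
  qed
  moreover have "0 \<le> (LINT u|lborel. - g u)"
    by (rule integral_nonneg_AE) (use gpos in auto)
  ultimately have "0 < filter_cov H p a 0 * c" using ig by simp
  \<comment> \<open>The product with \<open>c\<close> is already known to be positive, so a weak
    inequality for \<open>c\<close> decides the sign of the other factor.\<close>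
  moreover have "0 \<le> c"
    unfolding c_def by (rule integral_nonneg_AE) (auto simp: spectral_integrand_def)
  ultimately show ?thesis by (simp add: zero_less_mult_iff)
qed

text \<open>In the binomial expansion the exponents \<open>r\<close> and \<open>n - r\<close> add up
  to less than \<open>2 * m\<close>, so one of the two moments has order below \<open>m\<close> and
  vanishes.\<close>

lemma filter_difference_moments:
  assumes m: "has_filter_order p a m" and n: "n < 2 * m"
  shows "(\<Sum>k\<le>p. \<Sum>l\<le>p. a k * a l * (real k - real l) ^ n) = 0"
proof -
  have z: "(\<Sum>k\<le>p. a k * real k ^ r) = 0" if "r < m" for r
    using m that by (simp add: has_filter_order_def)
  have "(\<Sum>k\<le>p. \<Sum>l\<le>p. a k * a l * (real k - real l) ^ n)
    = (\<Sum>k\<le>p. \<Sum>l\<le>p. \<Sum>r\<le>n. real (n choose r) * (- 1) ^ (n - r) * ((a k * real k ^ r) * (a l * real l ^ (n - r))))"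
  proof (intro sum.cong refl)
    fix k l
    have "(real k - real l) ^ n = (\<Sum>r\<le>n. real (n choose r) * real k ^ r * (- real l) ^ (n - r))"
      using binomial_ring[of "real k" "- real l" n] by simp
    also have "\<dots> = (\<Sum>r\<le>n. real (n choose r) * (- 1) ^ (n - r) * (real k ^ r * real l ^ (n - r)))"
      by (intro sum.cong refl) (simp add: power_minus[of "real l"])
    finally show "a k * a l * (real k - real l) ^ n = (\<Sum>r\<le>n. real (n choose r) * (- 1) ^ (n - r) * ((a k * real k ^ r) * (a l * real l ^ (n - r))))"
      by (simp add: sum_distrib_left mult_ac)
  qed
  also have "\<dots> = (\<Sum>r\<le>n. \<Sum>k\<le>p. \<Sum>l\<le>p. real (n choose r) * (- 1) ^ (n - r) * ((a k * real k ^ r) * (a l * real l ^ (n - r))))"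
    by (subst sum.swap[of _ "{..n}"], subst sum.swap[of _ "{..n}"]) (rule refl)
  also have "\<dots> = (\<Sum>r\<le>n. real (n choose r) * (- 1) ^ (n - r) * ((\<Sum>k\<le>p. a k * real k ^ r) * (\<Sum>l\<le>p. a l * real l ^ (n - r))))"
    by (simp only: sum_product) (simp only: sum_distrib_left)
  also have "\<dots> = 0"
  proof (intro sum.neutral ballI)
    fix r assume "r \<in> {..n}"
    then have "r < m \<or> n - r < m" using n by auto
    then show "real (n choose r) * (- 1) ^ (n - r) * ((\<Sum>k\<le>p. a k * real k ^ r) * (\<Sum>l\<le>p. a l * real l ^ (n - r))) = 0"
      using z by auto
  qed
  finally show ?thesis .
qed

text \<open>Taylor expansion of \<open>(k + x) powr (2 * H)\<close> to order \<open>2 * m\<close>,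
  with \<open>x = i - l\<close>: the double filter kills the polynomial part, and the remainder is
  largest at the base point \<open>k - p\<close>, which is positive because
  \<open>p < k\<close>.\<close>

lemma filter_cov_taylor:
  assumes H: "H < 1" and m: "has_filter_order p a m" "1 \<le> m"
  shows "\<exists>C\<ge>0. \<forall>k::nat. p < k \<longrightarrow> \<bar>filter_cov H p a k\<bar> \<le> C * (real k - real p) powr (2 * H - 2 * m)"
proof -
  define N where "N = 2 * m"
  define D where "D n = (\<Prod>i<n. 2 * H - real i)" for n :: nat
  define C where "C = \<bar>D N\<bar> / fact N * real p ^ N"
  have C: "C \<ge> 0" by (simp add: C_def)
  have N: "N > 0" using m by (simp add: N_def)
  have est: "\<bar>filter_cov H p a k\<bar> \<le> ((\<Sum>i\<le>p. \<Sum>l\<le>p. \<bar>a i * a l\<bar>) * C / 2) * (real k - real p) powr (2 * H - 2 * m)"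
    if k: "p < k" for k :: nat
  proof -
    define diff where "diff n t = D n * (real k + t) powr (2 * H - real n)" for n t
    define R where "R x = (real k + x) powr (2 * H) - (\<Sum>n<N. diff n 0 / fact n * x ^ n)" for x
    have R: "\<bar>R x\<bar> \<le> C * (real k - real p) powr (2 * H - 2 * m)" if x: "\<bar>x\<bar> \<le> real p" for x
    \<comment> \<open>Taylor's theorem excludes the point of expansion; there the remainder is
      0.\<close>
    proof (cases "x = 0")
      case True
      have "(\<Sum>n<N. diff n 0 / fact n * 0 ^ n) = diff 0 0"
        using N by (subst sum.remove[of _ 0]) (auto intro!: sum.neutral)
      then show ?thesis using True C by (simp add: R_def diff_def D_def)
    next
      case False
      have "\<exists>t. (if x < 0 then x < t \<and> t < 0 else 0 < t \<and> t < x) \<and>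
        (real k + x) powr (2 * H) = (\<Sum>n<N. (diff n 0 / fact n) * (x - 0) ^ n) + (diff N t / fact N) * (x - 0) ^ N"
      proof (rule Taylor[where a = "- real p" and b = "real p"])
        show "diff 0 = (\<lambda>x. (real k + x) powr (2 * H))" by (simp add: diff_def D_def fun_eq_iff)
        show "\<forall>n t. n < N \<and> - real p \<le> t \<and> t \<le> real p \<longrightarrow> DERIV (diff n) t :> diff (Suc n) t"
        proof (intro allI impI)
          fix n t assume "n < N \<and> - real p \<le> t \<and> t \<le> real p"
          then have pos: "real k + t > 0" using k by auto
          have "DERIV (\<lambda>t. D n * (real k + t) powr (2 * H - real n)) t :>
              D n * ((2 * H - real n) * (real k + t) powr (2 * H - real n - 1))"
            using pos by (auto intro!: derivative_eq_intros)
          then show "DERIV (diff n) t :> diff (Suc n) t"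
            by (simp add: diff_def[abs_def] D_def mult_ac) (simp add: diff_diff_eq add.commute)
        qed
      qed (use x False N in auto)
      then obtain t where t: "if x < 0 then x < t \<and> t < 0 else 0 < t \<and> t < x"
        and e: "R x = diff N t / fact N * x ^ N" by (auto simp: R_def)
      have tp: "\<bar>t\<bar> \<le> real p" using t x by (auto split: if_splits)
      have "(real k + t) powr (2 * H - real N) \<le> (real k - real p) powr (2 * H - real N)"
        using H m k tp by (intro powr_mono2') (auto simp: N_def)
      then have "\<bar>diff N t\<bar> \<le> \<bar>D N\<bar> * (real k - real p) powr (2 * H - real N)"
        by (simp add: diff_def abs_mult mult_left_mono)
      moreover have "\<bar>x ^ N\<bar> \<le> real p ^ N" unfolding power_abs using x by (intro power_mono) auto
      ultimately have "\<bar>diff N t\<bar> * \<bar>x ^ N\<bar> \<le> (\<bar>D N\<bar> * (real k - real p) powr (2 * H - real N)) * real p ^ N"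
        by (intro mult_mono) auto
      then have "\<bar>diff N t\<bar> * \<bar>x ^ N\<bar> / fact N \<le> (\<bar>D N\<bar> * (real k - real p) powr (2 * H - real N)) * real p ^ N / fact N"
        by (rule divide_right_mono) simp
      then show ?thesis unfolding e by (simp add: C_def N_def abs_mult mult_ac)
    qed
    have "(\<Sum>i\<le>p. \<Sum>l\<le>p. a i * a l * \<bar>real k + real i - real l\<bar> powr (2 * H))
      = (\<Sum>i\<le>p. \<Sum>l\<le>p. a i * a l * R (real i - real l) + (\<Sum>n<N. diff n 0 / fact n * (a i * a l * (real i - real l) ^ n)))"
    proof (intro sum.cong refl)
      fix i l assume "i \<in> {..p}" "l \<in> {..p}"
      then have "\<bar>real k + real i - real l\<bar> = real k + (real i - real l)" using k by auto
      then show "a i * a l * \<bar>real k + real i - real l\<bar> powr (2 * H)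
        = a i * a l * R (real i - real l) + (\<Sum>n<N. diff n 0 / fact n * (a i * a l * (real i - real l) ^ n))"
        by (simp add: R_def algebra_simps sum_distrib_left)
    qed
    also have "\<dots> = (\<Sum>i\<le>p. \<Sum>l\<le>p. a i * a l * R (real i - real l))
      + (\<Sum>n<N. diff n 0 / fact n * (\<Sum>i\<le>p. \<Sum>l\<le>p. a i * a l * (real i - real l) ^ n))"
    proof -
      have "(\<Sum>i\<le>p. \<Sum>l\<le>p. \<Sum>n<N. diff n 0 / fact n * (a i * a l * (real i - real l) ^ n))
        = (\<Sum>n<N. \<Sum>i\<le>p. \<Sum>l\<le>p. diff n 0 / fact n * (a i * a l * (real i - real l) ^ n))"
        by (subst sum.swap[of _ "{..<N}"], subst sum.swap[of _ "{..<N}"]) (rule refl)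
      then show ?thesis by (simp add: sum.distrib sum_distrib_left)
    qed
    also have "(\<Sum>n<N. diff n 0 / fact n * (\<Sum>i\<le>p. \<Sum>l\<le>p. a i * a l * (real i - real l) ^ n)) = 0"
      using filter_difference_moments[OF m(1)] by (intro sum.neutral) (auto simp: N_def)
    finally have "\<bar>filter_cov H p a k\<bar> = \<bar>\<Sum>i\<le>p. \<Sum>l\<le>p. a i * a l * R (real i - real l)\<bar> / 2"
      by (simp add: filter_cov_def)
    also have "\<bar>\<Sum>i\<le>p. \<Sum>l\<le>p. a i * a l * R (real i - real l)\<bar> \<le> (\<Sum>i\<le>p. \<Sum>l\<le>p. \<bar>a i * a l * R (real i - real l)\<bar>)"
      by (rule order_trans[OF sum_abs sum_mono[OF sum_abs]])
    also have "\<dots> \<le> (\<Sum>i\<le>p. \<Sum>l\<le>p. \<bar>a i * a l\<bar> * (C * (real k - real p) powr (2 * H - 2 * m)))"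
      unfolding abs_mult[of "a _ * a _"] by (intro sum_mono mult_left_mono R) auto
    finally show ?thesis by (simp add: sum_distrib_right mult.assoc)
  qed
  show ?thesis
  proof (intro exI conjI)
    show "0 \<le> (\<Sum>i\<le>p. \<Sum>l\<le>p. \<bar>a i * a l\<bar>) * C / 2"
      using C by (intro divide_nonneg_nonneg mult_nonneg_nonneg sum_nonneg) auto
  qed (use est in blast)
qed

text \<open>Beyond \<open>2 * p + 1\<close> one has \<open>k - p >= (k + 1) / 4\<close>, which
  removes the shift at the price of the factor in \<open>C1\<close>. The finitely many smaller lags
  go into \<open>C2\<close>, and the extra 1 makes the constant positive.\<close>

lemma filter_cov_decay:
  assumes H: "H < 1" and m: "has_filter_order p a m" "1 \<le> m" and s: "s \<le> 2 * m - 2 * H"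
  shows "\<exists>C>0. \<forall>k::nat. \<bar>filter_cov H p a k\<bar> \<le> C * (real k + 1) powr (- s)"
proof -
  obtain C where C: "C \<ge> 0" "\<And>k::nat. p < k \<Longrightarrow> \<bar>filter_cov H p a k\<bar> \<le> C * (real k - real p) powr (2 * H - 2 * m)"
    using filter_cov_taylor[OF H m] by blast
  define C2 where "C2 = (\<Sum>k\<le>2 * p + 1. \<bar>filter_cov H p a k\<bar> * (real k + 1) powr s)"
  define C1 where "C1 = C * 4 powr (2 * m - 2 * H)"
  have nn: "C1 \<ge> 0" "C2 \<ge> 0"
    unfolding C1_def C2_def using C(1) by (simp, intro sum_nonneg mult_nonneg_nonneg) auto
  have "\<bar>filter_cov H p a k\<bar> \<le> (C1 + C2 + 1) * (real k + 1) powr (- s)" for k :: nat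
  proof (cases "k \<le> 2 * p + 1")
    case True
    have "\<bar>filter_cov H p a k\<bar> = \<bar>filter_cov H p a k\<bar> * (real k + 1) powr s * (real k + 1) powr (- s)"
      by (simp add: mult.assoc flip: powr_add)
    also have "\<dots> \<le> C2 * (real k + 1) powr (- s)"
      unfolding C2_def using True by (intro mult_right_mono member_le_sum) auto
    also have "\<dots> \<le> (C1 + C2 + 1) * (real k + 1) powr (- s)"
      using nn by (intro mult_right_mono) auto
    finally show ?thesis .
  next
    case False
    then have k: "p < k" "(real k + 1) / 4 \<le> real k - real p" by auto
    have "\<bar>filter_cov H p a k\<bar> \<le> C * (real k - real p) powr (2 * H - 2 * m)" by (rule C(2)[OF k(1)])
    also have "\<dots> \<le> C * ((real k + 1) / 4) powr (2 * H - 2 * m)"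
      using C H m k(2) by (intro mult_left_mono powr_mono2') auto
    also have "\<dots> = C1 * (real k + 1) powr (2 * H - 2 * m)"
      by (simp add: C1_def powr_divide divide_powr_uminus)
    also have "\<dots> \<le> C1 * (real k + 1) powr (- s)"
      using s nn by (intro mult_left_mono powr_mono) auto
    also have "\<dots> \<le> (C1 + C2 + 1) * (real k + 1) powr (- s)"
      using nn by (intro mult_right_mono) auto
    finally show ?thesis .
  qed
  then show ?thesis using nn by (intro exI[of _ "C1 + C2 + 1"]) auto
qed

text \<open>Comparison with the integral of \<open>x powr (- s)\<close>, done by telescoping: each
  term is estimated by the mean value theorem for \<open>x powr (1 - s)\<close>. The first step
  starts at the singular point 0 and is checked directly.\<close>

lemma sum_powr_le:
  fixes s :: real
  assumes "0 < s" "s < 1"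
  shows "(\<Sum>k<L. (real k + 1) powr (- s)) \<le> real L powr (1 - s) / (1 - s)"
proof (induction L)
  case (Suc L)
  have step: "(1 - s) * (real L + 1) powr (- s) \<le> (real L + 1) powr (1 - s) - real L powr (1 - s)"
  proof (cases "L = 0")
    case False
    have "\<exists>z. real L < z \<and> z < real L + 1 \<and> (real L + 1) powr (1 - s) - real L powr (1 - s)
        = (real L + 1 - real L) * ((1 - s) * z powr (- s))"
    proof (rule MVT2)
      fix x assume "real L \<le> x" "x \<le> real L + 1"
      then show "((\<lambda>x. x powr (1 - s)) has_real_derivative (1 - s) * x powr (- s)) (at x)"
        using False by (auto intro!: derivative_eq_intros)
    qed simp
    then obtain z where z: "real L < z" "z < real L + 1"
      "(real L + 1) powr (1 - s) - real L powr (1 - s) = (1 - s) * z powr (- s)" by auto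
    have "(real L + 1) powr (- s) \<le> z powr (- s)"
      using z assms by (intro powr_mono2') auto
    then show ?thesis unfolding z(3) using assms by (intro mult_left_mono) auto
  qed (use assms in simp)
  have "(real L + 1) powr (- s) \<le> ((real L + 1) powr (1 - s) - real L powr (1 - s)) / (1 - s)"
    using step assms by (simp add: pos_le_divide_eq mult.commute)
  then show ?case using Suc by (simp add: diff_divide_distrib add.commute)
qed simp

section \<open>Fractional Brownian motion and the central limit theorem\<close>

lemma real_distribution_normal_law: "0 \<le> v \<Longrightarrow> real_distribution (normal_law \<mu> v)"
  unfolding real_distribution_def real_distribution_axioms_def normal_law_def
  by (auto intro: prob_space_return prob_space_normal_density)

lemma char_normal_law:
  assumes v: "0 \<le> v"
  shows "char (normal_law 0 v) t = of_real (exp (- (v * t\<^sup>2) / 2))"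
proof (cases "v = 0")
  case True
  then show ?thesis by (simp add: normal_law_def char_def integral_return)
next
  case False
  with v have v0: "v > 0" by simp
  define c where "c = sqrt v"
  have c: "c > 0" "c * c = v" using v0 by (simp_all add: c_def)
  have "char (normal_law 0 v) t = (CLINT x|lborel. normal_density 0 c x *\<^sub>R iexp (t * x))"
    using False by (simp add: normal_law_def char_def integral_density c_def)
  also have "\<dots> = \<bar>c\<bar> *\<^sub>R (CLINT x|lborel. normal_density 0 c (0 + c * x) *\<^sub>R iexp (t * (0 + c * x)))"
    by (rule lborel_integral_real_affine) (use c in simp)
  also have "\<dots> = (CLINT x|lborel. std_normal_density x *\<^sub>R iexp (t * c * x))"
  proof -
    have "c * normal_density 0 c (c * x) = std_normal_density x" for x
      using c by (simp add: normal_density_def power_mult_distrib real_sqrt_mult)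
    then have "c *\<^sub>R (normal_density 0 c (0 + c * x) *\<^sub>R iexp (t * (0 + c * x))) = std_normal_density x *\<^sub>R iexp (t * c * x)" for x
      by (simp add: mult.assoc)
    then show ?thesis using c by (simp only: integral_scaleR_right[symmetric] abs_of_pos)
  qed
  also have "\<dots> = char std_normal_distribution (t * c)"
    by (simp add: char_def integral_density)
  also have "\<dots> = of_real (exp (- (v * t\<^sup>2) / 2))"
    using c by (simp add: char_std_normal_distribution power_mult_distrib power2_eq_square mult_ac)
  finally show ?thesis .
qed

context prob_space
begin

lemma normal_law_moments:
  assumes Z[measurable]: "Z \<in> borel_measurable M" and law: "distr M borel Z = normal_law \<mu> v" and v: "0 \<le> v"
  shows "expectation Z = \<mu>"
    and "integrable M (\<lambda>x. (Z x - \<mu>) ^ k)"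
    and "expectation (\<lambda>x. (Z x - \<mu>)\<^sup>2) = v"
    and "expectation (\<lambda>x. (Z x - \<mu>) ^ 4) = 3 * v\<^sup>2"
proof -
  have tr: "expectation (\<lambda>x. f (Z x)) = (LINT z|normal_law \<mu> v. f z)" "integrable M (\<lambda>x. f (Z x)) \<longleftrightarrow> integrable (normal_law \<mu> v) f"
    if [measurable]: "f \<in> borel_measurable borel" for f :: "real \<Rightarrow> real"
    using law[symmetric] by (simp_all add: integral_distr integrable_distr_eq)
  have *: "(LINT z|normal_law \<mu> v. z) = \<mu> \<and> integrable (normal_law \<mu> v) (\<lambda>z. (z - \<mu>) ^ k)
    \<and> (LINT z|normal_law \<mu> v. (z - \<mu>)\<^sup>2) = v \<and> (LINT z|normal_law \<mu> v. (z - \<mu>) ^ 4) = 3 * v\<^sup>2"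
  proof (cases "v = 0")
    case True
    interpret R: prob_space "return borel \<mu>" by (rule prob_space_return) simp
    have "integrable (return borel \<mu>) (\<lambda>z. (z - \<mu>) ^ k)"
    proof (rule R.integrable_const_bound[of _ 1])
      show "AE z in return borel \<mu>. norm ((z - \<mu>) ^ k) \<le> 1"
        by (subst AE_return) (auto simp: power_0_left)
    qed simp
    then show ?thesis using True by (simp add: normal_law_def integral_return)
  next
    case False
    with v have s: "0 < sqrt v" "sqrt v ^ 2 = v" by auto
    have d: "normal_law \<mu> v = density lborel (normal_density \<mu> (sqrt v))" using False by (simp add: normal_law_def)
    have "(LINT z|normal_law \<mu> v. z) = \<mu>"
      unfolding d using integral_normal_moment_nz_1[OF s(1), of \<mu>] by (simp add: integral_density)
    moreover have "integrable (normal_law \<mu> v) (\<lambda>z. (z - \<mu>) ^ k)"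
      unfolding d using integrable_normal_moment[OF s(1), of \<mu> k] by (simp add: integrable_density)
    moreover have "(LINT z|normal_law \<mu> v. (z - \<mu>) ^ (2 * j)) = fact (2 * j) / ((2 / (sqrt v)\<^sup>2) ^ j * fact j)" for j
      unfolding d using integral_normal_moment_even[OF s(1), of \<mu> j] by (simp add: integral_density)
    from this[of 1] this[of 2] have "(LINT z|normal_law \<mu> v. (z - \<mu>)\<^sup>2) = v" "(LINT z|normal_law \<mu> v. (z - \<mu>) ^ 4) = 3 * v\<^sup>2"
      using s v False by (simp_all add: fact_numeral power_divide)
    ultimately show ?thesis by blast
  qed
  show "expectation Z = \<mu>" using tr(1)[of "\<lambda>z. z"] * by simp
  show "integrable M (\<lambda>x. (Z x - \<mu>) ^ k)" using tr(2)[of "\<lambda>z. (z - \<mu>) ^ k"] * by simp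
  show "expectation (\<lambda>x. (Z x - \<mu>)\<^sup>2) = v" using tr(1)[of "\<lambda>z. (z - \<mu>)\<^sup>2"] * by simp
  show "expectation (\<lambda>x. (Z x - \<mu>) ^ 4) = 3 * v\<^sup>2" using tr(1)[of "\<lambda>z. (z - \<mu>) ^ 4"] * by simp
qed

end

section \<open>Filtered increments of fractional Brownian motion as a Gaussian vector\<close>

locale fbm = prob_space M for M :: "'a measure" +
  fixes H :: real and B :: "real \<Rightarrow> 'a \<Rightarrow> real"
  assumes H_range: "0 < H" "H < 1"
    and fbm: "fractional_brownian_motion M {0..1} H B"
begin

definition fcov :: "real \<Rightarrow> real \<Rightarrow> real" where
  "fcov t s = (t powr (2 * H) + s powr (2 * H) - \<bar>t - s\<bar> powr (2 * H)) / 2"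

lemma measurable_B[measurable]: "t \<in> {0..1} \<Longrightarrow> B t \<in> borel_measurable M"
  using fbm by (auto simp: fractional_brownian_motion_def gaussian_process_def)

text \<open>The times \<open>\<tau> s\<close> may repeat, whereas the definition of a Gaussian
  process speaks of sets of times; coefficients that belong to the same time are merged.\<close>

lemma linear_combination_law:
  assumes S: "finite S" and \<tau>: "\<And>s. s \<in> S \<Longrightarrow> \<tau> s \<in> {0..1}"
  shows "\<exists>\<mu> v. 0 \<le> v \<and> distr M borel (\<lambda>x. \<Sum>s\<in>S. c s * B (\<tau> s) x) = normal_law \<mu> v"
proof -
  have "(\<Sum>s\<in>S. c s * B (\<tau> s) x) = (\<Sum>t\<in>\<tau> ` S. (\<Sum>s\<in>{s \<in> S. \<tau> s = t}. c s) * B t x)" for x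
    by (subst sum.image_gen[OF S, of _ \<tau>]) (auto intro!: sum.cong simp: sum_distrib_right)
  moreover have "finite (\<tau> ` S) \<and> \<tau> ` S \<subseteq> {0..1}" using S \<tau> by auto
  ultimately show ?thesis
    using fbm by (simp add: fractional_brownian_motion_def gaussian_process_def)
qed

lemma expectation_B_mult_B:
  "t \<in> {0..1} \<Longrightarrow> s \<in> {0..1} \<Longrightarrow> expectation (\<lambda>x. B t x * B s x) = fcov t s"
  using fbm by (simp add: fractional_brownian_motion_def fcov_def)

lemma integrable_B:
  assumes t: "t \<in> {0..1}"
  shows "integrable M (B t)" "integrable M (\<lambda>x. (B t x)\<^sup>2)" "integrable M (\<lambda>x. B t x ^ 4)"
    and "expectation (B t) = 0" "expectation (\<lambda>x. B t x ^ 4) = 3 * (t powr (2 * H))\<^sup>2"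
proof -
  show e0: "expectation (B t) = 0"
    using fbm t by (simp add: fractional_brownian_motion_def)
  obtain \<mu> v where v: "0 \<le> v" "distr M borel (B t) = normal_law \<mu> v"
    using linear_combination_law[of "{()}" "\<lambda>_. t" "\<lambda>_. 1"] t by auto
  note m = normal_law_moments[OF measurable_B[OF t] v(2,1)]
  have \<mu>: "\<mu> = 0" using m(1) e0 by simp
  show "integrable M (B t)" using m(2)[of 1] by (simp add: \<mu>)
  show "integrable M (\<lambda>x. (B t x)\<^sup>2)" using m(2)[of 2] by (simp add: \<mu>)
  show "integrable M (\<lambda>x. B t x ^ 4)" using m(2)[of 4] by (simp add: \<mu>)
  have "v = expectation (\<lambda>x. B t x * B t x)" using m(3) by (simp add: \<mu> power2_eq_square)
  also have "\<dots> = t powr (2 * H)"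
    unfolding expectation_B_mult_B[OF t t] by (simp add: fcov_def)
  finally show "expectation (\<lambda>x. B t x ^ 4) = 3 * (t powr (2 * H))\<^sup>2"
    using m(4) by (simp add: \<mu>)
qed

lemma cov_B:
  assumes "t \<in> {0..1}" "s \<in> {0..1}"
  shows "integrable M (\<lambda>x. B t x * B s x)" "expectation (\<lambda>x. B t x * B s x) = fcov t s"
proof -
  show "integrable M (\<lambda>x. B t x * B s x)"
    using assms by (intro cauchy_schwarz_expectation integrable_B measurable_B)
  show "expectation (\<lambda>x. B t x * B s x) = fcov t s"
    by (rule expectation_B_mult_B[OF assms])
qed

text \<open>The definition grants a normal law with unspecified parameters. The mean and the second
  moment, computed from the covariance of \<open>B\<close>, identify them and thereby the
  characteristic function.\<close>

lemma linear_combination: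
  fixes c \<tau> :: "'s \<Rightarrow> real"
  assumes S: "finite S" and \<tau>: "\<And>s. s \<in> S \<Longrightarrow> \<tau> s \<in> {0..1}"
  defines "L \<equiv> \<lambda>x. \<Sum>s\<in>S. c s * B (\<tau> s) x" and "v \<equiv> \<Sum>s\<in>S. \<Sum>s'\<in>S. c s * c s' * fcov (\<tau> s) (\<tau> s')"
  shows "L \<in> borel_measurable M" "expectation L = 0" "integrable M (\<lambda>x. L x ^ k)" "expectation (\<lambda>x. (L x)\<^sup>2) = v"
    and "(CLINT x|M. iexp (L x)) = of_real (exp (- v / 2))"
proof -
  have [measurable]: "B (\<tau> s) \<in> borel_measurable M" if "s \<in> S" for s using \<tau> that by simp
  show m[measurable]: "L \<in> borel_measurable M" unfolding L_def by measurable
  show e0: "expectation L = 0"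
    unfolding L_def using \<tau> by (simp add: integrable_B)
  obtain \<mu> v' where v': "0 \<le> v'" "distr M borel L = normal_law \<mu> v'"
    unfolding L_def using linear_combination_law[OF S, of \<tau> c] \<tau> by blast
  note mom = normal_law_moments[OF m v'(2,1)]
  have \<mu>: "\<mu> = 0" using mom(1) e0 by simp
  show "integrable M (\<lambda>x. L x ^ k)" using mom(2)[of k] by (simp add: \<mu>)
  have "(L x)\<^sup>2 = (\<Sum>s\<in>S. \<Sum>s'\<in>S. c s * c s' * (B (\<tau> s) x * B (\<tau> s') x))" for x
    unfolding L_def power2_eq_square sum_product by (simp add: mult_ac)
  then show "expectation (\<lambda>x. (L x)\<^sup>2) = v"
    unfolding v_def using \<tau> by (simp add: cov_B)
  then have v_eq: "v' = v" using mom(3) by (simp add: \<mu>)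
  have "(CLINT x|M. iexp (L x)) = char (distr M borel L) 1"
    unfolding char_def by (subst integral_distr) auto
  also have "\<dots> = of_real (exp (- v / 2))"
    unfolding v'(2) \<mu> char_normal_law[OF v'(1)] by (simp add: v_eq)
  finally show "(CLINT x|M. iexp (L x)) = of_real (exp (- v / 2))" .
qed

text \<open>The terms \<open>t powr (2 * H)\<close> and \<open>s powr (2 * H)\<close> depend on one
  filter index each and are annihilated by the sum over the other. In the remaining term the mesh
  factors out by homogeneity and only \<open>j - k\<close> is left.\<close>

lemma increment_cov:
  assumes a: "zero_sum_filter p a" and \<Delta>: "0 \<le> \<Delta>"
  shows "(\<Sum>i\<le>p. \<Sum>l\<le>p. a i * a l * fcov (real (i + j) * \<Delta>) (real (l + k) * \<Delta>))
    = \<Delta> powr (2 * H) * filter_cov H p a (real j - real k)"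
proof -
  have z: "(\<Sum>i\<le>p. a i) = 0" using a by (simp add: zero_sum_filter_def)
  let ?f = "\<lambda>i j. (real (i + j) * \<Delta>) powr (2 * H)"
  have abs: "\<bar>real (i + j) * \<Delta> - real (l + k) * \<Delta>\<bar> powr (2 * H)
      = \<Delta> powr (2 * H) * \<bar>(real j - real k) + real i - real l\<bar> powr (2 * H)" for i l
  proof -
    have "\<bar>real (i + j) * \<Delta> - real (l + k) * \<Delta>\<bar> = \<Delta> * \<bar>(real j - real k) + real i - real l\<bar>"
    proof -
      have "real (i + j) * \<Delta> - real (l + k) * \<Delta> = \<Delta> * ((real j - real k) + real i - real l)"
        by (simp add: algebra_simps)
      then show ?thesis using \<Delta> by (simp only: abs_mult abs_of_nonneg)
    qed
    then show ?thesis using \<Delta> by (simp add: powr_mult)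
  qed
  have "(\<Sum>i\<le>p. \<Sum>l\<le>p. a i * a l * fcov (real (i + j) * \<Delta>) (real (l + k) * \<Delta>))
    = (\<Sum>i\<le>p. \<Sum>l\<le>p. (a i * ?f i j) * a l / 2 + a i * (a l * ?f l k) / 2
        - \<Delta> powr (2 * H) * (a i * a l * \<bar>(real j - real k) + real i - real l\<bar> powr (2 * H)) / 2)"
    unfolding fcov_def abs by (intro sum.cong refl) (simp add: field_simps)
  also have "\<dots> = (\<Sum>i\<le>p. a i * ?f i j) * (\<Sum>l\<le>p. a l) / 2 + (\<Sum>i\<le>p. a i) * (\<Sum>l\<le>p. a l * ?f l k) / 2
     + \<Delta> powr (2 * H) * filter_cov H p a (real j - real k)"
    unfolding sum_product filter_cov_def
    by (simp add: sum_subtractf sum.distrib sum_distrib_left sum_divide_distrib)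
  finally show ?thesis using z by simp
qed

text \<open>Pairs of an increment and a filter index form one finite family of times, possibly with
  repetitions, to which \<open>linear_combination\<close> applies.\<close>

lemma increments_combination:
  fixes c :: "nat \<Rightarrow> real"
  assumes a: "zero_sum_filter p a" and \<Delta>: "0 \<le> \<Delta>" and J: "finite J" "\<And>j. j \<in> J \<Longrightarrow> real (j + p) * \<Delta> \<le> 1"
  defines "L \<equiv> \<lambda>x. \<Sum>j\<in>J. c j * filter_increment p a \<Delta> B j x"
    and "v \<equiv> \<Delta> powr (2 * H) * (\<Sum>j\<in>J. \<Sum>k\<in>J. c j * c k * filter_cov H p a (real j - real k))"
  shows "L \<in> borel_measurable M" "integrable M (\<lambda>x. L x ^ k)" "expectation (\<lambda>x. (L x)\<^sup>2) = v"
    and "(CLINT x|M. iexp (L x)) = of_real (exp (- v / 2))"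
proof -
  define \<tau> :: "nat \<times> nat \<Rightarrow> real" where "\<tau> s = real (snd s + fst s) * \<Delta>" for s
  define d where "d s = c (fst s) * a (snd s)" for s
  have L: "L = (\<lambda>x. \<Sum>s\<in>J \<times> {..p}. d s * B (\<tau> s) x)"
    unfolding L_def filter_increment_def d_def \<tau>_def
    by (simp add: sum.cartesian_product' sum_distrib_left mult.assoc)
  have \<tau>: "\<tau> s \<in> {0..1}" if s: "s \<in> J \<times> {..p}" for s
  proof -
    have "\<tau> s \<le> real (fst s + p) * \<Delta>"
      unfolding \<tau>_def using s \<Delta> by (intro mult_right_mono) auto
    also have "\<dots> \<le> 1" using s J by auto
    finally show ?thesis using \<Delta> by (simp add: \<tau>_def)
  qed
  have "(\<Sum>s\<in>J \<times> {..p}. \<Sum>s'\<in>J \<times> {..p}. d s * d s' * fcov (\<tau> s) (\<tau> s'))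
    = (\<Sum>j\<in>J. \<Sum>i\<le>p. \<Sum>k\<in>J. \<Sum>l\<le>p. c j * c k * (a i * a l * fcov (real (i + j) * \<Delta>) (real (l + k) * \<Delta>)))"
    unfolding d_def \<tau>_def sum.cartesian_product' by (simp add: mult_ac)
  also have "\<dots> = (\<Sum>j\<in>J. \<Sum>k\<in>J. \<Sum>i\<le>p. \<Sum>l\<le>p. c j * c k * (a i * a l * fcov (real (i + j) * \<Delta>) (real (l + k) * \<Delta>)))"
    by (rule sum.cong[OF refl]) (rule sum.swap)
  also have "\<dots> = v"
    unfolding v_def sum_distrib_left[symmetric] increment_cov[OF a \<Delta>] by (simp add: sum_distrib_left mult_ac)
  finally have v: "(\<Sum>s\<in>J \<times> {..p}. \<Sum>s'\<in>J \<times> {..p}. d s * d s' * fcov (\<tau> s) (\<tau> s')) = v" .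
  have S: "finite (J \<times> {..p})" using J by simp
  note lc = linear_combination[where S = "J \<times> {..p}" and \<tau> = \<tau> and c = d, OF S \<tau>, unfolded v]
  show "L \<in> borel_measurable M" unfolding L by (rule lc(1))
  show "integrable M (\<lambda>x. L x ^ k)" unfolding L by (rule lc(3))
  show "expectation (\<lambda>x. (L x)\<^sup>2) = v" unfolding L by (rule lc(4))
  show "(CLINT x|M. iexp (L x)) = of_real (exp (- v / 2))" unfolding L by (rule lc(5))
qed

lemma increments:
  assumes a: "zero_sum_filter p a" and \<Delta>: "0 \<le> \<Delta>" and jk: "real (j + p) * \<Delta> \<le> 1" "real (k + p) * \<Delta> \<le> 1"
  shows "filter_increment p a \<Delta> B j \<in> borel_measurable M"
    and "integrable M (\<lambda>x. filter_increment p a \<Delta> B j x ^ n)"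
    and "integrable M (\<lambda>x. filter_increment p a \<Delta> B j x * filter_increment p a \<Delta> B k x)"
    and "expectation (\<lambda>x. filter_increment p a \<Delta> B j x * filter_increment p a \<Delta> B k x)
      = \<Delta> powr (2 * H) * filter_cov H p a (real j - real k)"
proof -
  have 1: "filter_increment p a \<Delta> B j \<in> borel_measurable M" "integrable M (\<lambda>x. filter_increment p a \<Delta> B j x ^ n)"
    if "real (j + p) * \<Delta> \<le> 1" for j n
    using increments_combination(1,2)[OF a \<Delta>, of "{j}" "\<lambda>_. 1"] that by simp_all
  show "filter_increment p a \<Delta> B j \<in> borel_measurable M" "integrable M (\<lambda>x. filter_increment p a \<Delta> B j x ^ n)"
    by (rule 1[OF jk(1)])+
  show "integrable M (\<lambda>x. filter_increment p a \<Delta> B j x * filter_increment p a \<Delta> B k x)"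
    using 1 jk by (intro cauchy_schwarz_expectation) auto
  have fi: "filter_increment p a \<Delta> B j x = (\<Sum>i\<le>p. a i * B (real (i + j) * \<Delta>) x)" for j x
    by (simp add: filter_increment_def)
  have t: "real (i + j) * \<Delta> \<in> {0..1}" if "real (j + p) * \<Delta> \<le> 1" "i \<le> p" for i j
  proof -
    have "real (i + j) * \<Delta> \<le> real (j + p) * \<Delta>" using that \<Delta> by (intro mult_right_mono) auto
    then show ?thesis using that \<Delta> by simp
  qed
  have c: "integrable M (\<lambda>x. B (real (i + j) * \<Delta>) x * B (real (l + k) * \<Delta>) x)"
      "expectation (\<lambda>x. B (real (i + j) * \<Delta>) x * B (real (l + k) * \<Delta>) x) = fcov (real (i + j) * \<Delta>) (real (l + k) * \<Delta>)"
    if "i \<le> p" "l \<le> p" for i l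
    by (rule cov_B[OF t[OF jk(1) that(1)] t[OF jk(2) that(2)]])+
  have "filter_increment p a \<Delta> B j x * filter_increment p a \<Delta> B k x
      = (\<Sum>i\<le>p. \<Sum>l\<le>p. a i * a l * (B (real (i + j) * \<Delta>) x * B (real (l + k) * \<Delta>) x))" for x
    unfolding fi sum_product by (simp add: mult_ac)
  then have "expectation (\<lambda>x. filter_increment p a \<Delta> B j x * filter_increment p a \<Delta> B k x)
      = expectation (\<lambda>x. \<Sum>i\<le>p. \<Sum>l\<le>p. a i * a l * (B (real (i + j) * \<Delta>) x * B (real (l + k) * \<Delta>) x))"
    by (simp only:)
  also have "\<dots> = (\<Sum>i\<le>p. \<Sum>l\<le>p. expectation (\<lambda>x. a i * a l * (B (real (i + j) * \<Delta>) x * B (real (l + k) * \<Delta>) x)))"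
    by (subst Bochner_Integration.integral_sum, intro Bochner_Integration.integrable_sum integrable_mult_right c,
        simp, simp, intro sum.cong refl Bochner_Integration.integral_sum integrable_mult_right c) auto
  also have "\<dots> = (\<Sum>i\<le>p. \<Sum>l\<le>p. a i * a l * fcov (real (i + j) * \<Delta>) (real (l + k) * \<Delta>))"
    by (intro sum.cong refl) (simp add: c del: of_nat_add)
  finally have "expectation (\<lambda>x. filter_increment p a \<Delta> B j x * filter_increment p a \<Delta> B k x)
      = (\<Sum>i\<le>p. \<Sum>l\<le>p. a i * a l * fcov (real (i + j) * \<Delta>) (real (l + k) * \<Delta>))" .
  then show "expectation (\<lambda>x. filter_increment p a \<Delta> B j x * filter_increment p a \<Delta> B k x)
      = \<Delta> powr (2 * H) * filter_cov H p a (real j - real k)"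
    by (simp only: increment_cov[OF a \<Delta>])
qed

text \<open>Dividing by the standard deviation cancels the mesh: the correlations depend on the lag
  only and are the same for every \<open>\<Delta>\<close>.\<close>

lemma gaussian_vector_increments:
  assumes a: "zero_sum_filter p a" and pos: "0 < filter_cov H p a 0"
    and \<Delta>: "0 < \<Delta>" and J: "finite J" "\<And>j. j \<in> J \<Longrightarrow> real (j + p) * \<Delta> \<le> 1"
  shows "gaussian_vector M J (\<lambda>j x. filter_increment p a \<Delta> B j x / sqrt (increment_variance H p a \<Delta>))
    (\<lambda>j k. filter_cov H p a (real j - real k) / filter_cov H p a 0)"
proof -
  let ?D = "filter_increment p a \<Delta> B"
  define q where "q = sqrt (increment_variance H p a \<Delta>)"
  have q: "q > 0" "q * q = \<Delta> powr (2 * H) * filter_cov H p a 0"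
    using pos \<Delta> by (simp_all add: q_def increment_variance_eq)
  have \<Delta>': "0 \<le> \<Delta>" using \<Delta> by simp
  show ?thesis
    unfolding q_def[symmetric]
  proof
    fix j assume j: "j \<in> J"
    note inc = increments[OF a \<Delta>' J(2)[OF j]]
    have [measurable]: "?D j \<in> borel_measurable M" by (rule inc(1)[OF J(2)[OF j]])
    show "(\<lambda>x. ?D j x / q) \<in> borel_measurable M" by measurable
    show "integrable M (\<lambda>x. (?D j x / q) ^ 4)"
      using inc(2)[OF J(2)[OF j], of 4] by (simp add: power_divide)
    show "filter_cov H p a (real j - real j) / filter_cov H p a 0 = 1" using pos by simp
    fix k assume k: "k \<in> J"
    have "expectation (\<lambda>x. ?D j x / q * (?D k x / q)) = expectation (\<lambda>x. ?D j x * ?D k x) / (q * q)"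
      by simp
    also have "\<dots> = filter_cov H p a (real j - real k) / filter_cov H p a 0"
      unfolding inc(4)[OF J(2)[OF k]] q(2) using \<Delta> by simp
    finally show "expectation (\<lambda>x. ?D j x / q * (?D k x / q)) = filter_cov H p a (real j - real k) / filter_cov H p a 0" .
  next
    fix c :: "nat \<Rightarrow> real"
    have "(CLINT x|M. iexp (\<Sum>j\<in>J. c j * (?D j x / q))) = (CLINT x|M. iexp (\<Sum>j\<in>J. (c j / q) * ?D j x))"
      by simp
    also have "\<dots> = of_real (exp (- (\<Delta> powr (2 * H) * (\<Sum>j\<in>J. \<Sum>k\<in>J. (c j / q) * (c k / q) * filter_cov H p a (real j - real k))) / 2))"
      by (rule increments_combination(4)[OF a \<Delta>' J])
    also have "\<Delta> powr (2 * H) * (\<Sum>j\<in>J. \<Sum>k\<in>J. (c j / q) * (c k / q) * filter_cov H p a (real j - real k))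
      = (\<Sum>j\<in>J. \<Sum>k\<in>J. c j * c k * (filter_cov H p a (real j - real k) / filter_cov H p a 0))"
      unfolding sum_distrib_left
    proof (intro sum.cong refl)
      fix j k
      have "\<Delta> powr (2 * H) * (c j / q * (c k / q) * filter_cov H p a (real j - real k))
        = c j * c k * (\<Delta> powr (2 * H) * filter_cov H p a (real j - real k) / (q * q))" by simp
      then show "\<Delta> powr (2 * H) * (c j / q * (c k / q) * filter_cov H p a (real j - real k))
        = c j * c k * (filter_cov H p a (real j - real k) / filter_cov H p a 0)"
        unfolding q(2) using \<Delta> by simp
    qed
    finally show "(CLINT x|M. iexp (\<Sum>j\<in>J. c j * (?D j x / q)))
      = of_real (exp (- (\<Sum>j\<in>J. \<Sum>k\<in>J. c j * c k * (filter_cov H p a (real j - real k) / filter_cov H p a 0)) / 2))" .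
  qed (rule J(1))
qed

end

section \<open>Cesaro means and sums over Toeplitz matrices\<close>

lemma cesaro_mean_tendsto:
  fixes A :: "nat \<Rightarrow> real"
  assumes A: "A \<longlonglongrightarrow> L"
  shows "(\<lambda>N. (\<Sum>j=1..N. A j) / real N) \<longlonglongrightarrow> L"
proof (rule LIMSEQ_I)
  fix e :: real assume e: "0 < e"
  obtain m where m: "\<And>j. j \<ge> m \<Longrightarrow> \<bar>A j - L\<bar> < e / 2"
    using LIMSEQ_D[OF A, of "e / 2"] e by auto
  define C where "C = (\<Sum>j=1..m. \<bar>A j - L\<bar>)"
  have C: "C \<ge> 0" unfolding C_def by (rule sum_nonneg) simp
  obtain N0 :: nat where N0: "2 * C / e < real N0" using reals_Archimedean2 by blast
  have "\<bar>(\<Sum>j=1..N. A j) / real N - L\<bar> < e" if N: "N \<ge> N0 + m + 1" for N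
  proof -
    have N_pos: "real N > 0" using N by simp
    have "(\<Sum>j=1..N. A j) / real N - L = (\<Sum>j=1..N. A j - L) / real N"
      using N_pos by (simp add: sum_subtractf field_simps)
    then have "\<bar>(\<Sum>j=1..N. A j) / real N - L\<bar> = \<bar>\<Sum>j=1..N. A j - L\<bar> / real N"
      using N_pos by simp
    also have "\<bar>\<Sum>j=1..N. A j - L\<bar> \<le> (\<Sum>j=1..N. \<bar>A j - L\<bar>)" by (rule sum_abs)
    also have "(\<Sum>j=1..N. \<bar>A j - L\<bar>) = C + (\<Sum>j=m+1..N. \<bar>A j - L\<bar>)"
      unfolding C_def using N sum.ub_add_nat[of 1 m "\<lambda>j. \<bar>A j - L\<bar>" "N - m"] by simp
    also have "(\<Sum>j=m+1..N. \<bar>A j - L\<bar>) \<le> real (card {m+1..N}) * (e / 2)"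
      by (rule sum_bounded_above) (use m in \<open>auto simp: less_imp_le\<close>)
    also have "real (card {m+1..N}) * (e / 2) \<le> real N * (e / 2)"
      using e by (intro mult_right_mono) auto
    finally have "\<bar>(\<Sum>j=1..N. A j) / real N - L\<bar> \<le> (C + real N * (e / 2)) / real N"
      using N_pos by (simp add: divide_right_mono)
    also have "\<dots> = C / real N + e / 2" using N_pos by (simp add: add_divide_distrib)
    also have "C / real N < e / 2"
    proof -
      have "2 * C / e < real N" using N0 N by linarith
      then show ?thesis using e N_pos by (simp add: field_simps)
    qed
    finally show ?thesis by simp
  qed
  then show "\<exists>N0. \<forall>N\<ge>N0. norm ((\<Sum>j=1..N. A j) / real N - L) < e" by auto
qed

text \<open>Subtraction on \<open>nat\<close> truncates, so one of the two summands is 0 and the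
  other is the absolute difference.\<close>

definition nat_dist :: "nat \<Rightarrow> nat \<Rightarrow> nat" where
  "nat_dist j k = (j - k) + (k - j)"

lemma nat_dist_commute: "nat_dist j k = nat_dist k j"
  by (simp add: nat_dist_def)

lemma filter_cov_nat_dist: "filter_cov H p a (real j - real k) = filter_cov H p a (real (nat_dist j k))"
proof (cases "j \<le> k")
  case True
  then show ?thesis using filter_cov_minus[of H p a "real k - real j"] by (simp add: nat_dist_def of_nat_diff)
next
  case False
  then show ?thesis by (simp add: nat_dist_def of_nat_diff)
qed

text \<open>Lags to the left of \<open>j\<close> and lags to the right of it; lag 0 occurs in both
  ranges, hence the correction.\<close>

lemma toeplitz_row_sum:
  fixes f :: "nat \<Rightarrow> real"
  assumes j: "j \<in> {1..N}"
  shows "(\<Sum>k=1..N. f (nat_dist j k)) = (\<Sum>d<j. f d) + (\<Sum>d<N + 1 - j. f d) - f 0"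
proof -
  have "{1..N} = {1..j} \<union> {j+1..N}" "{1..j} \<inter> {j+1..N} = {}" using j by auto
  then have "(\<Sum>k=1..N. f (nat_dist j k)) = (\<Sum>k=1..j. f (nat_dist j k)) + (\<Sum>k=j+1..N. f (nat_dist j k))"
    by (metis finite_atLeastAtMost sum.union_disjoint)
  also have "(\<Sum>k=1..j. f (nat_dist j k)) = (\<Sum>d<j. f d)"
    by (rule sum.reindex_bij_witness[of _ "\<lambda>d. j - d" "\<lambda>k. j - k"]) (auto simp: nat_dist_def)
  also have "(\<Sum>k=j+1..N. f (nat_dist j k)) = (\<Sum>d\<in>{1..<N + 1 - j}. f d)"
    by (rule sum.reindex_bij_witness[of _ "\<lambda>d. j + d" "\<lambda>k. k - j"]) (auto simp: nat_dist_def)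
  also have "\<dots> = (\<Sum>d<N + 1 - j. f d) - f 0"
    using j by (simp add: lessThan_atLeast0 sum.atLeast_Suc_lessThan[of 0])
  finally show ?thesis by simp
qed

lemma toeplitz_row_sum_le:
  fixes f :: "nat \<Rightarrow> real"
  assumes j: "j \<in> {1..N}" and f: "\<And>d. 0 \<le> f d"
  shows "(\<Sum>k=1..N. f (nat_dist j k)) \<le> 2 * (\<Sum>d<N. f d)"
proof -
  have "(\<Sum>d<j. f d) \<le> (\<Sum>d<N. f d)" "(\<Sum>d<N + 1 - j. f d) \<le> (\<Sum>d<N. f d)"
    using j f by (auto intro!: sum_mono2)
  then show ?thesis using toeplitz_row_sum[OF j, of f] f[of 0] by linarith
qed

text \<open>The reflection of \<open>j\<close> to \<open>N + 1 - j\<close> exchanges left and right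
  lags, so both halves have the same total.\<close>

lemma toeplitz_total_sum:
  fixes f :: "nat \<Rightarrow> real"
  shows "(\<Sum>j=1..N. \<Sum>k=1..N. f (nat_dist j k)) = 2 * (\<Sum>j=1..N. \<Sum>d<j. f d) - real N * f 0"
proof -
  have "(\<Sum>j=1..N. \<Sum>k=1..N. f (nat_dist j k)) = (\<Sum>j=1..N. (\<Sum>d<j. f d) + (\<Sum>d<N + 1 - j. f d) - f 0)"
    by (intro sum.cong refl toeplitz_row_sum)
  also have "\<dots> = (\<Sum>j=1..N. \<Sum>d<j. f d) + (\<Sum>j=1..N. \<Sum>d<N + 1 - j. f d) - real N * f 0"
    by (simp add: sum.distrib sum_subtractf)
  also have "(\<Sum>j=1..N. \<Sum>d<N + 1 - j. f d) = (\<Sum>j=1..N. \<Sum>d<j. f d)"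
    by (rule sum.reindex_bij_witness[of _ "\<lambda>j. N + 1 - j" "\<lambda>j. N + 1 - j"]) auto
  finally show ?thesis by simp
qed

text \<open>The entries of the matrix square are at most \<open>2 * A\<close> by square summability;
  the absolute row sums of the matrix square are at most the squared row sums of the original
  matrix, of order \<open>N powr (2 - 2 * s)\<close>. Using the constant bound for one factor of
  each squared entry and the growing bound for the other keeps the total small.\<close>

lemma toeplitz_square_frobenius:
  fixes \<rho> :: "nat \<Rightarrow> real"
  assumes \<rho>: "\<And>d. \<bar>\<rho> d\<bar> \<le> C * (real d + 1) powr (- s)" and s: "0 < s" "s < 1" and C: "0 \<le> C"
    and A: "\<And>n. (\<Sum>d<n. (\<rho> d)\<^sup>2) \<le> A"
  shows "(\<Sum>j=1..N. \<Sum>l=1..N. (\<Sum>k=1..N. \<rho> (nat_dist j k) * \<rho> (nat_dist k l))\<^sup>2)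
    \<le> real N * (2 * A * (2 * C * (real N powr (1 - s) / (1 - s)))\<^sup>2)"
proof -
  define T2 where "T2 j l = (\<Sum>k=1..N. \<rho> (nat_dist j k) * \<rho> (nat_dist k l))" for j l
  define K where "K = 2 * C * (real N powr (1 - s) / (1 - s))"
  have K0: "0 \<le> K" using C s by (simp add: K_def)
  have A0: "0 \<le> A" using A[of 0] by simp
  have row: "(\<Sum>k=1..N. \<bar>\<rho> (nat_dist j k)\<bar>) \<le> K" if j: "j \<in> {1..N}" for j
  proof -
    have "(\<Sum>k=1..N. \<bar>\<rho> (nat_dist j k)\<bar>) \<le> 2 * (\<Sum>d<N. \<bar>\<rho> d\<bar>)"
      by (rule toeplitz_row_sum_le[OF j]) simp
    also have "\<dots> \<le> 2 * (\<Sum>d<N. C * (real d + 1) powr (- s))"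
      by (intro mult_left_mono sum_mono \<rho>) simp
    also have "\<dots> \<le> K"
      using mult_left_mono[OF sum_powr_le[OF s, of N] C] by (simp add: K_def flip: sum_distrib_left)
    finally show ?thesis .
  qed
  have sq: "(\<Sum>k=1..N. (\<rho> (nat_dist j k))\<^sup>2) \<le> 2 * A" if j: "j \<in> {1..N}" for j
    using toeplitz_row_sum_le[OF j, of "\<lambda>d. (\<rho> d)\<^sup>2"] A[of N] by simp
  have T2_le: "\<bar>T2 j l\<bar> \<le> 2 * A" if jl: "j \<in> {1..N}" "l \<in> {1..N}" for j l
  proof -
    have "\<bar>T2 j l\<bar> \<le> (\<Sum>k=1..N. \<bar>\<rho> (nat_dist j k) * \<rho> (nat_dist k l)\<bar>)"
      unfolding T2_def by (rule sum_abs)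
    also have "\<dots> \<le> (\<Sum>k=1..N. ((\<rho> (nat_dist j k))\<^sup>2 + (\<rho> (nat_dist l k))\<^sup>2) / 2)"
    proof (rule sum_mono)
      fix k
      show "\<bar>\<rho> (nat_dist j k) * \<rho> (nat_dist k l)\<bar> \<le> ((\<rho> (nat_dist j k))\<^sup>2 + (\<rho> (nat_dist l k))\<^sup>2) / 2"
        using sum_squares_bound[of "\<bar>\<rho> (nat_dist j k)\<bar>" "\<bar>\<rho> (nat_dist k l)\<bar>"]
        by (simp add: abs_mult nat_dist_commute[of l k])
    qed
    also have "\<dots> = ((\<Sum>k=1..N. (\<rho> (nat_dist j k))\<^sup>2) + (\<Sum>k=1..N. (\<rho> (nat_dist l k))\<^sup>2)) / 2"
      by (simp add: sum.distrib flip: sum_divide_distrib)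
    also have "\<dots> \<le> 2 * A" using sq[OF jl(1)] sq[OF jl(2)] by simp
    finally show ?thesis .
  qed
  have T2_row: "(\<Sum>l=1..N. \<bar>T2 j l\<bar>) \<le> K\<^sup>2" if j: "j \<in> {1..N}" for j
  proof -
    have "(\<Sum>l=1..N. \<bar>T2 j l\<bar>) \<le> (\<Sum>l=1..N. \<Sum>k=1..N. \<bar>\<rho> (nat_dist j k)\<bar> * \<bar>\<rho> (nat_dist k l)\<bar>)"
      unfolding T2_def abs_mult[symmetric] by (intro sum_mono sum_abs)
    also have "\<dots> = (\<Sum>k=1..N. \<bar>\<rho> (nat_dist j k)\<bar> * (\<Sum>l=1..N. \<bar>\<rho> (nat_dist k l)\<bar>))"
      by (subst sum.swap) (simp add: sum_distrib_left)
    also have "\<dots> \<le> (\<Sum>k=1..N. \<bar>\<rho> (nat_dist j k)\<bar> * K)"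
      by (intro sum_mono mult_left_mono row) auto
    also have "\<dots> \<le> K * K"
      unfolding sum_distrib_right[symmetric] using row[OF j] K0 by (rule mult_right_mono)
    finally show ?thesis by (simp add: power2_eq_square)
  qed
  have "(\<Sum>j=1..N. \<Sum>l=1..N. (T2 j l)\<^sup>2) \<le> (\<Sum>j=1..N. \<Sum>l=1..N. 2 * A * \<bar>T2 j l\<bar>)"
  proof (intro sum_mono)
    fix j l assume "j \<in> {1..N}" "l \<in> {1..N}"
    from mult_right_mono[OF T2_le[OF this], of "\<bar>T2 j l\<bar>"]
    show "(T2 j l)\<^sup>2 \<le> 2 * A * \<bar>T2 j l\<bar>" by (simp add: power2_eq_square)
  qed
  also have "\<dots> \<le> (\<Sum>j=1..N. 2 * A * K\<^sup>2)"
    unfolding sum_distrib_left[symmetric] using T2_row A0 by (intro sum_mono mult_left_mono) auto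
  finally show ?thesis by (simp add: T2_def K_def)
qed

text \<open>The condition \<open>m > H + 1/4\<close> puts the first entry above 1/2. The cap keeps
  the exponent below 1, where partial sums of powers grow like \<open>N powr (1 - s)\<close>; any
  number strictly between 1/2 and 1 would serve as the cap.\<close>

definition decay_exponent :: "real \<Rightarrow> nat \<Rightarrow> real" where
  "decay_exponent H m = min (2 * real m - 2 * H) (3 / 4)"

definition correlation :: "real \<Rightarrow> nat \<Rightarrow> (nat \<Rightarrow> real) \<Rightarrow> nat \<Rightarrow> real" where
  "correlation H p a d = filter_cov H p a (real d) / filter_cov H p a 0"

text \<open>Twice the sum of the squared correlations over all integer lags: the correlation is
  even, and the doubled series counts lag 0, where it equals 1, once too often.\<close>

definition clt_variance :: "real \<Rightarrow> nat \<Rightarrow> (nat \<Rightarrow> real) \<Rightarrow> real" where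
  "clt_variance H p a = 2 * (2 * (\<Sum>d. (correlation H p a d)\<^sup>2) - 1)"

locale clt_filter =
  fixes H :: real and p m :: nat and a :: "nat \<Rightarrow> real"
  assumes H01: "0 < H" "H < 1" and a: "zero_sum_filter p a" and m: "has_filter_order p a m" and m_H: "real m > H + 1 / 4"
begin

abbreviation "s \<equiv> decay_exponent H m"
abbreviation "\<rho> \<equiv> correlation H p a"
abbreviation "\<gamma> \<equiv> filter_cov H p a 0"

lemma s: "1 / 2 < s" "s < 1"
  using m_H by (auto simp: decay_exponent_def)

lemma \<gamma>_pos: "0 < \<gamma>"
  by (rule filter_cov_0_pos[OF H01 a m])

lemma \<rho>_0: "\<rho> 0 = 1"
  using \<gamma>_pos by (simp add: correlation_def)

lemma correlation_decay: "\<exists>C>0. \<forall>d. \<bar>\<rho> d\<bar> \<le> C * (real d + 1) powr (- s)"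
proof -
  have "1 \<le> m" using m_H H01 by (cases m) auto
  then obtain C where C: "C > 0" "\<And>d::nat. \<bar>filter_cov H p a d\<bar> \<le> C * (real d + 1) powr (- s)"
    using filter_cov_decay[OF H01(2) m, of s] by (auto simp: decay_exponent_def)
  have "\<bar>\<rho> d\<bar> \<le> (C / \<gamma>) * (real d + 1) powr (- s)" for d
    using divide_right_mono[OF C(2)[of d], of \<gamma>] \<gamma>_pos by (simp add: correlation_def abs_divide)
  then show ?thesis using C(1) \<gamma>_pos by (intro exI[of _ "C / \<gamma>"]) auto
qed

lemma summable_correlation_square: "summable (\<lambda>d. (\<rho> d)\<^sup>2)"
proof -
  obtain C where C: "C > 0" "\<And>d. \<bar>\<rho> d\<bar> \<le> C * (real d + 1) powr (- s)"
    using correlation_decay by blast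
  show ?thesis
  proof (rule summable_comparison_test')
    have "summable (\<lambda>n. real (Suc n) powr (- 2 * s))"
      using s by (subst summable_Suc_iff) (simp add: summable_real_powr_iff)
    then show "summable (\<lambda>d. C\<^sup>2 * (real d + 1) powr (- 2 * s))"
      by (intro summable_mult) (simp add: add.commute)
    fix d
    have "(\<rho> d)\<^sup>2 \<le> (C * (real d + 1) powr (- s))\<^sup>2"
      using C(2)[of d] power2_le_iff_abs_le[of "C * (real d + 1) powr (- s)" "\<rho> d"] C(1) by simp
    also have "\<dots> = C\<^sup>2 * (real d + 1) powr (- 2 * s)"
      by (simp add: power_mult_distrib power2_eq_square flip: powr_add)
    finally show "norm ((\<rho> d)\<^sup>2) \<le> C\<^sup>2 * (real d + 1) powr (- 2 * s)" by simp
  qed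
qed

lemma clt_variance_pos: "0 < clt_variance H p a"
proof -
  have "(\<Sum>d\<in>{0}. (\<rho> d)\<^sup>2) \<le> (\<Sum>d. (\<rho> d)\<^sup>2)"
    by (rule sum_le_suminf[OF summable_correlation_square]) auto
  then show ?thesis using \<rho>_0 by (simp add: clt_variance_def)
qed

text \<open>By \<open>toeplitz_total_sum\<close> the double sum is governed by Cesaro means of the
  partial sums \<open>A j\<close>, which converge to the whole series. Having \<open>n - p\<close>
  instead of \<open>n\<close> terms changes the normalisation by a factor tending to 1.\<close>

lemma variance_tendsto:
  "(\<lambda>n. 2 * (1 / sqrt (real n))\<^sup>2 * (\<Sum>j=1..n - p. \<Sum>k=1..n - p. (\<rho> (nat_dist j k))\<^sup>2)) \<longlonglongrightarrow> clt_variance H p a"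
proof -
  define A where "A j = (\<Sum>d<j. (\<rho> d)\<^sup>2)" for j
  have "A \<longlonglongrightarrow> (\<Sum>d. (\<rho> d)\<^sup>2)"
    unfolding A_def[abs_def] using summable_correlation_square by (rule summable_LIMSEQ)
  from filterlim_compose[OF cesaro_mean_tendsto[OF this] filterlim_minus_const_nat_at_top[of p]]
  have ces: "(\<lambda>n. (\<Sum>j=1..n - p. A j) / real (n - p)) \<longlonglongrightarrow> (\<Sum>d. (\<rho> d)\<^sup>2)" .
  have ratio: "(\<lambda>n. real (n - p) / real n) \<longlonglongrightarrow> 1"
  proof (rule Lim_transform_eventually)
    show "(\<lambda>n. (real n - real p) / real n) \<longlonglongrightarrow> 1" by real_asymp
    show "\<forall>\<^sub>F n in sequentially. (real n - real p) / real n = real (n - p) / real n"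
      using eventually_ge_at_top[of p] by eventually_elim (simp add: of_nat_diff)
  qed
  have "(\<lambda>n. 2 * (real (n - p) / real n) * (2 * ((\<Sum>j=1..n - p. A j) / real (n - p)) - 1)) \<longlonglongrightarrow> 2 * 1 * (2 * (\<Sum>d. (\<rho> d)\<^sup>2) - 1)"
    by (intro tendsto_intros ces ratio)
  then have lim: "(\<lambda>n. 2 * (real (n - p) / real n) * (2 * ((\<Sum>j=1..n - p. A j) / real (n - p)) - 1)) \<longlonglongrightarrow> clt_variance H p a"
    by (simp add: clt_variance_def)
  show ?thesis
  proof (rule Lim_transform_eventually[OF lim])
    show "\<forall>\<^sub>F n in sequentially. 2 * (real (n - p) / real n) * (2 * ((\<Sum>j=1..n - p. A j) / real (n - p)) - 1)
      = 2 * (1 / sqrt (real n))\<^sup>2 * (\<Sum>j=1..n - p. \<Sum>k=1..n - p. (\<rho> (nat_dist j k))\<^sup>2)"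
      using eventually_gt_at_top[of p]
    proof eventually_elim
      case (elim n)
      then have pos: "0 < real (n - p)" "0 < real n" by auto
      have "(\<Sum>j=1..n - p. \<Sum>k=1..n - p. (\<rho> (nat_dist j k))\<^sup>2) = 2 * (\<Sum>j=1..n - p. A j) - real (n - p)"
        using toeplitz_total_sum[of "\<lambda>d. (\<rho> d)\<^sup>2" "n - p"] by (simp add: A_def \<rho>_0)
      moreover have "(1 / sqrt (real n))\<^sup>2 = 1 / real n" by (simp add: power_divide)
      moreover have "2 * (x / y) * (2 * (S / x) - 1) = 2 * (1 / y) * (2 * S - x)" if "0 < x" "0 < y" for x y S :: real
        using that by (simp add: field_simps)
      ultimately show ?case using pos by (simp only:)
    qed
  qed
qed

text \<open>Powers of \<open>n\<close> in the bound: \<open>- 2\<close> from the fourth power of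
  \<open>1 / sqrt n\<close>, \<open>1\<close> from the number of rows, and \<open>2 - 2 * s\<close>
  from the squared row sums. The total \<open>1 - 2 * s\<close> is negative because
  \<open>s > 1/2\<close>.\<close>

lemma remainder_tendsto:
  "(\<lambda>n. 2 * (1 / sqrt (real n)) ^ 4 * (\<Sum>j=1..n - p. \<Sum>l=1..n - p. (\<Sum>k=1..n - p. \<rho> (nat_dist j k) * \<rho> (nat_dist k l))\<^sup>2)) \<longlonglongrightarrow> 0"
proof -
  obtain C where C: "C > 0" "\<And>d. \<bar>\<rho> d\<bar> \<le> C * (real d + 1) powr (- s)"
    using correlation_decay by blast
  define A where "A = (\<Sum>d. (\<rho> d)\<^sup>2)"
  have A: "(\<Sum>d<n. (\<rho> d)\<^sup>2) \<le> A" for n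
    unfolding A_def by (rule sum_le_suminf[OF summable_correlation_square]) auto
  have A0: "0 \<le> A" using A[of 0] by simp
  define E where "E = 16 * A * (C / (1 - s))\<^sup>2"
  have lim: "(\<lambda>n. E * real n powr (1 - 2 * s)) \<longlonglongrightarrow> 0"
    using s by real_asymp
  show ?thesis
  proof (rule tendsto_sandwich[OF _ _ tendsto_const lim])
    show "\<forall>\<^sub>F n in sequentially. 0 \<le> 2 * (1 / sqrt (real n)) ^ 4 * (\<Sum>j=1..n - p. \<Sum>l=1..n - p. (\<Sum>k=1..n - p. \<rho> (nat_dist j k) * \<rho> (nat_dist k l))\<^sup>2)"
      by (auto intro!: always_eventually mult_nonneg_nonneg sum_nonneg)
    show "\<forall>\<^sub>F n in sequentially. 2 * (1 / sqrt (real n)) ^ 4 * (\<Sum>j=1..n - p. \<Sum>l=1..n - p. (\<Sum>k=1..n - p. \<rho> (nat_dist j k) * \<rho> (nat_dist k l))\<^sup>2)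
        \<le> E * real n powr (1 - 2 * s)"
      using eventually_gt_at_top[of p]
    proof eventually_elim
      case (elim n)
      let ?N = "n - p"
      have n: "real n > 0" "real ?N \<le> real n" using elim by auto
      have "(\<Sum>j=1..?N. \<Sum>l=1..?N. (\<Sum>k=1..?N. \<rho> (nat_dist j k) * \<rho> (nat_dist k l))\<^sup>2)
          \<le> real ?N * (2 * A * (2 * C * (real ?N powr (1 - s) / (1 - s)))\<^sup>2)"
        by (rule toeplitz_square_frobenius[OF C(2)]) (use s C A in auto)
      also have "\<dots> \<le> real n * (2 * A * (2 * C * (real n powr (1 - s) / (1 - s)))\<^sup>2)"
        using n s C A0 by (intro mult_mono power_mono divide_right_mono powr_mono2 mult_left_mono) auto
      finally have "2 * (1 / sqrt (real n)) ^ 4 * (\<Sum>j=1..?N. \<Sum>l=1..?N. (\<Sum>k=1..?N. \<rho> (nat_dist j k) * \<rho> (nat_dist k l))\<^sup>2)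
          \<le> 2 * (1 / sqrt (real n)) ^ 4 * (real n * (2 * A * (2 * C * (real n powr (1 - s) / (1 - s)))\<^sup>2))"
        by (rule mult_left_mono) simp
      also have "\<dots> = E * ((1 / sqrt (real n)) ^ 4 * real n * (real n powr (1 - s))\<^sup>2)"
        by (simp add: E_def power_mult_distrib power_divide mult_ac)
      also have "(1 / sqrt (real n)) ^ 4 * real n * (real n powr (1 - s))\<^sup>2 = real n powr (1 - 2 * s)"
      proof -
        have "(1 / sqrt (real n)) ^ 4 = real n powr (- 2)"
        proof -
          have "sqrt (real n) ^ 4 = (sqrt (real n) ^ 2)\<^sup>2" using power_mult[of "sqrt (real n)" 2 2] by simp
          also have "\<dots> = real n powr 2" using n by (simp add: powr_numeral)
          finally show ?thesis using n by (simp add: power_divide powr_minus_divide)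
        qed
        moreover have "(real n powr (1 - s))\<^sup>2 = real n powr (2 - 2 * s)"
          by (simp add: power2_eq_square flip: powr_add)
        moreover have "real n powr (- 2) * real n powr 1 * real n powr (2 - 2 * s) = real n powr (1 - 2 * s)"
          by (simp only: powr_add[symmetric]) simp
        ultimately show ?thesis using n by simp
      qed
      finally show ?case .
    qed
  qed
qed

end

section \<open>The central limit theorem for fractional Brownian motion and its variance\<close>

lemma sampling_time_le_1:
  assumes \<alpha>: "1 \<le> \<alpha>" and j: "j \<le> n"
  shows "real j * real n powr (- \<alpha>) \<le> 1"
proof (cases "n = 0")
  case False
  then have n: "1 \<le> real n" by simp
  have "real j * real n powr (- \<alpha>) \<le> real n powr 1 * real n powr (- 1)"
    using \<alpha> j n by (intro mult_mono powr_mono) auto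
  also have "\<dots> = 1" unfolding powr_add[symmetric] using n by simp
  finally show ?thesis .
qed (use j in simp)

lemma measurable_quadratic_variation:
  assumes Z: "\<And>t. t \<in> {0..1} \<Longrightarrow> Z t \<in> borel_measurable M" and \<alpha>: "1 \<le> \<alpha>"
  shows "quadratic_variation H p a n (real n powr (- \<alpha>)) Z \<in> borel_measurable M"
proof -
  have inc: "filter_increment p a (real n powr (- \<alpha>)) Z j \<in> borel_measurable M" if j: "j \<in> {1..n - p}" for j
  proof -
    have "Z (real (i + j) * real n powr (- \<alpha>)) \<in> borel_measurable M" if "i \<in> {..p}" for i
      using that j by (intro Z) (auto intro!: sampling_time_le_1[OF \<alpha>] simp del: of_nat_add)
    then show ?thesis
      unfolding filter_increment_def[abs_def] by (intro borel_measurable_sum borel_measurable_times) auto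
  qed
  then show ?thesis
    unfolding quadratic_variation_def[abs_def]
    by (intro borel_measurable_times borel_measurable_sum borel_measurable_diff borel_measurable_divide borel_measurable_power) auto
qed

text \<open>Levy's continuity theorem in both directions: one direction proves the limit theorems,
  the other makes the limit variance unique.\<close>

lemma quadratic_variation_clt_iff:
  assumes M: "prob_space M" and Z: "\<And>t. t \<in> {0..1} \<Longrightarrow> Z t \<in> borel_measurable M" and \<alpha>: "1 \<le> \<alpha>" and v: "0 \<le> v"
  shows "quadratic_variation_clt M H p a \<alpha> Z v \<longleftrightarrow>
    (\<forall>t. (\<lambda>n. CLINT x|M. iexp (t * (sqrt (real n) * quadratic_variation H p a n (real n powr (- \<alpha>)) Z x)))
      \<longlonglongrightarrow> of_real (exp (- (v * t\<^sup>2) / 2)))"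
proof -
  interpret prob_space M by fact
  define D where "D n = distr M borel (\<lambda>x. sqrt (real n) * quadratic_variation H p a n (real n powr (- \<alpha>)) Z x)" for n
  have [measurable]: "quadratic_variation H p a n (real n powr (- \<alpha>)) Z \<in> borel_measurable M" for n
    by (rule measurable_quadratic_variation[OF Z \<alpha>])
  have rd: "real_distribution (D n)" for n
    unfolding D_def by (rule real_distribution_distr) measurable
  have ch: "char (D n) t = (CLINT x|M. iexp (t * (sqrt (real n) * quadratic_variation H p a n (real n powr (- \<alpha>)) Z x)))" for n t
    unfolding char_def D_def by (subst integral_distr) auto
  note nl = real_distribution_normal_law[OF v, of 0]
  have "quadratic_variation_clt M H p a \<alpha> Z v \<longleftrightarrow> weak_conv_m D (normal_law 0 v)"
    unfolding quadratic_variation_clt_def D_def by simp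
  also have "\<dots> \<longleftrightarrow> (\<forall>t. (\<lambda>n. char (D n) t) \<longlonglongrightarrow> char (normal_law 0 v) t)"
    using levy_continuity1[of D, OF rd nl] levy_continuity[of D, OF rd nl] by blast
  finally show ?thesis by (simp only: ch char_normal_law[OF v])
qed

context fbm
begin

text \<open>The scaled quadratic variation is \<open>chaos (1 / sqrt n)\<close> of the normalised
  increments, so the quantitative bound holds at every \<open>n >= 1\<close>; its variance
  \<open>S n\<close> converges and its error, governed by \<open>R n\<close>, vanishes.\<close>

lemma fbm_characteristic_function_tendsto:
  assumes "clt_filter H p m a" and \<alpha>: "1 \<le> \<alpha>"
  shows "(\<lambda>n. CLINT x|M. iexp (t * (sqrt (real n) * quadratic_variation H p a n (real n powr (- \<alpha>)) B x)))
      \<longlonglongrightarrow> of_real (exp (- (clt_variance H p a * t\<^sup>2) / 2))"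
proof -
  interpret clt_filter H p m a by fact
  define S where "S n = 2 * (1 / sqrt (real n))\<^sup>2 * (\<Sum>j=1..n - p. \<Sum>k=1..n - p. (\<rho> (nat_dist j k))\<^sup>2)" for n
  define R where "R n = 2 * (1 / sqrt (real n)) ^ 4 * (\<Sum>j=1..n - p. \<Sum>l=1..n - p. (\<Sum>k=1..n - p. \<rho> (nat_dist j k) * \<rho> (nat_dist k l))\<^sup>2)" for n
  define \<phi> where "\<phi> n = (CLINT x|M. iexp (t * (sqrt (real n) * quadratic_variation H p a n (real n powr (- \<alpha>)) B x)))" for n
  have est: "norm (\<phi> n - of_real (exp (- (S n * t\<^sup>2) / 2))) \<le> t\<^sup>2 * (2 * sqrt (R n))" if n: "n \<ge> 1" for n
  proof -
    define \<Delta> where "\<Delta> = real n powr (- \<alpha>)"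
    have \<Delta>: "0 < \<Delta>" using n by (simp add: \<Delta>_def)
    have J: "real (j + p) * \<Delta> \<le> 1" if "j \<in> {1..n - p}" for j
      unfolding \<Delta>_def by (rule sampling_time_le_1[OF \<alpha>]) (use that in auto)
    define G where "G j x = filter_increment p a \<Delta> B j x / sqrt (increment_variance H p a \<Delta>)" for j x
    interpret gv: gaussian_vector M "{1..n - p}" G "\<lambda>j k. filter_cov H p a (real j - real k) / filter_cov H p a 0"
      unfolding G_def[abs_def] by (rule gaussian_vector_increments[OF a \<gamma>_pos \<Delta>]) (use J in auto)
    have T: "filter_cov H p a (real j - real k) / filter_cov H p a 0 = \<rho> (nat_dist j k)" for j k
      by (simp add: filter_cov_nat_dist correlation_def)
    have iv: "0 \<le> increment_variance H p a \<Delta>"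
      unfolding increment_variance_eq using \<gamma>_pos by simp
    have "sqrt (real n) * (1 / real n) = 1 / sqrt (real n)"
      using n by (simp add: field_simps)
    moreover have "(G j x)\<^sup>2 = (filter_increment p a \<Delta> B j x)\<^sup>2 / increment_variance H p a \<Delta>" for j x
      unfolding G_def power_divide using iv by simp
    ultimately have "sqrt (real n) * quadratic_variation H p a n \<Delta> B x = gv.chaos (1 / sqrt (real n)) (gv.vec x)" for x
      by (simp only: gv.chaos_vec quadratic_variation_def mult.assoc[symmetric])
    then have "\<phi> n = (CLINT x|M. iexp (t * gv.chaos (1 / sqrt (real n)) (gv.vec x)))"
      by (simp add: \<phi>_def \<Delta>_def)
    moreover have "gv.T2 j l = (\<Sum>k=1..n - p. \<rho> (nat_dist j k) * \<rho> (nat_dist k l))" for j l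
      unfolding gv.T2_def unfolding T ..
    ultimately show ?thesis
      using gv.chaos_characteristic_function[of t "1 / sqrt (real n)"]
      by (simp only: S_def R_def T)
  qed
  have "(\<lambda>n. t\<^sup>2 * (2 * sqrt (R n))) \<longlonglongrightarrow> t\<^sup>2 * (2 * sqrt 0)"
    unfolding R_def by (intro tendsto_intros remainder_tendsto)
  then have R0: "(\<lambda>n. t\<^sup>2 * (2 * sqrt (R n))) \<longlonglongrightarrow> 0" by simp
  have "(\<lambda>n. \<phi> n - of_real (exp (- (S n * t\<^sup>2) / 2))) \<longlonglongrightarrow> 0"
    by (rule Lim_null_comparison[OF _ R0]) (rule eventually_mono[OF eventually_ge_at_top[of 1] est])
  moreover have "(\<lambda>n. complex_of_real (exp (- (S n * t\<^sup>2) / 2))) \<longlonglongrightarrow> of_real (exp (- (clt_variance H p a * t\<^sup>2) / 2))"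
    unfolding S_def by (intro tendsto_intros variance_tendsto) simp
  ultimately have "(\<lambda>n. (\<phi> n - of_real (exp (- (S n * t\<^sup>2) / 2))) + of_real (exp (- (S n * t\<^sup>2) / 2)))
     \<longlonglongrightarrow> 0 + of_real (exp (- (clt_variance H p a * t\<^sup>2) / 2))"
    by (rule tendsto_add)
  then show ?thesis by (simp add: \<phi>_def)
qed

text \<open>Nothing is known of \<open>B\<close> outside the time interval, not even measurability.
  The value 0 there makes the whole path a measurable map into the product space.\<close>

definition path :: "'a \<Rightarrow> real \<Rightarrow> real" where
  "path x = (\<lambda>t. if t \<in> {0..1} then B t x else 0)"

text \<open>Supplies a motion whose sample points have type \<open>real \<Rightarrow> real\<close>.
  \<open>is_fbm_clt_variance\<close> quantifies over such motions; if there were none, it would hold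
  for every positive \<open>v\<close> and \<open>THE\<close> would not pick a value.\<close>

lemma fbm_path_space: "fbm (distr M (PiM UNIV (\<lambda>_. borel)) path) H (\<lambda>t w. w t)"
proof -
  have [measurable]: "path \<in> measurable M (PiM UNIV (\<lambda>_. borel))"
    unfolding path_def[abs_def]
  proof (rule measurable_PiM_single')
    show "(\<lambda>x. if t \<in> {0..1} then B t x else 0) \<in> borel_measurable M" for t
      using measurable_B[of t]
      by (cases "t \<in> {0..1}") (simp_all only: if_True if_False simp_thms borel_measurable_const)
  qed (simp add: space_PiM)
  let ?P = "distr M (PiM UNIV (\<lambda>_. borel)) path"
  interpret P: prob_space ?P by (rule prob_space_distr) measurable
  have ev: "(LINT w|?P. f w) = (LINT x|M. f (path x))" if "f \<in> borel_measurable (PiM UNIV (\<lambda>_. borel))" for f :: "(real \<Rightarrow> real) \<Rightarrow> real"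
    using that by (simp add: integral_distr)
  have p: "path x t = B t x" if "t \<in> {0..1}" for x t using that by (simp add: path_def)
  show ?thesis
  proof
    show "0 < H" "H < 1" by (rule H_range)+
    show "fractional_brownian_motion ?P {0..1} H (\<lambda>t w. w t)"
      unfolding fractional_brownian_motion_def gaussian_process_def
    proof (intro conjI ballI allI impI)
      show "(\<lambda>w. w t) \<in> borel_measurable ?P" for t :: real by simp
      show "P.expectation (\<lambda>w. w t) = 0" if "t \<in> {0..1}" for t
        using that integrable_B(4)[OF that] by (subst ev) (auto simp: p)
      show "P.expectation (\<lambda>w. w t * w s) = (t powr (2 * H) + s powr (2 * H) - \<bar>t - s\<bar> powr (2 * H)) / 2"
        if "t \<in> {0..1}" "s \<in> {0..1}" for t s
      proof -
        have "P.expectation (\<lambda>w. w t * w s) = expectation (\<lambda>x. path x t * path x s)"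
          by (rule ev) measurable
        then show ?thesis
          by (simp only: p[OF that(1)] p[OF that(2)] expectation_B_mult_B[OF that] fcov_def)
      qed
      fix I :: "real set" and c :: "real \<Rightarrow> real" assume I: "finite I \<and> I \<subseteq> {0..1}"
      have "distr ?P borel (\<lambda>w. \<Sum>t\<in>I. c t * w t) = distr M borel ((\<lambda>w. \<Sum>t\<in>I. c t * w t) \<circ> path)"
        by (rule distr_distr) measurable
      also have "(\<lambda>w. \<Sum>t\<in>I. c t * w t) \<circ> path = (\<lambda>x. \<Sum>t\<in>I. c t * B t x)"
        using I by (auto simp: p fun_eq_iff intro!: sum.cong)
      finally show "\<exists>\<mu> v. 0 \<le> v \<and> distr ?P borel (\<lambda>w. \<Sum>t\<in>I. c t * w t) = normal_law \<mu> v"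
        using linear_combination_law[of I "\<lambda>t. t" c] I by (simp add: subset_iff)
    qed
  qed
qed

text \<open>Existence is the limit theorem. For uniqueness, the characteristic function at 1 of the
  coordinate process with \<open>\<alpha> = 1\<close> would have two limits, and \<open>exp\<close>
  separates different variances.\<close>

theorem fbm_clt_variance_eq:
  assumes F: "clt_filter H p m a"
  shows "fbm_clt_variance H p a = clt_variance H p a"
proof -
  interpret clt_filter H p m a by (rule F)
  note v = clt_variance_pos
  have clt: "quadratic_variation_clt N H p a \<alpha> W (clt_variance H p a)"
    if "prob_space N" "fractional_brownian_motion N {0..1} H W" "1 \<le> \<alpha>" for N :: "(real \<Rightarrow> real) measure" and W \<alpha>
  proof -
    interpret N: fbm N H W using that H_range by (simp add: fbm_def fbm_axioms_def)
    show ?thesis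
      using N.fbm_characteristic_function_tendsto[OF F that(3)] v
      by (subst quadratic_variation_clt_iff[OF that(1) N.measurable_B that(3)]) auto
  qed
  have unique: "v = clt_variance H p a" if v': "is_fbm_clt_variance H p a v" for v
  proof -
    interpret P: fbm "distr M (PiM UNIV (\<lambda>_. borel)) path" H "\<lambda>t w. w t" by (rule fbm_path_space)
    have v0: "0 \<le> v" using v' by (simp add: is_fbm_clt_variance_def)
    have "quadratic_variation_clt (distr M (PiM UNIV (\<lambda>_. borel)) path) H p a 1 (\<lambda>t w. w t) v"
      using v' P.fbm P.prob_space_axioms by (simp add: is_fbm_clt_variance_def)
    then have "\<forall>t. (\<lambda>n. CLINT w|distr M (PiM UNIV (\<lambda>_. borel)) path.
        iexp (t * (sqrt (real n) * quadratic_variation H p a n (real n powr (- 1)) (\<lambda>t w. w t) w)))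
      \<longlonglongrightarrow> of_real (exp (- (v * t\<^sup>2) / 2))"
      by (rule quadratic_variation_clt_iff[OF P.prob_space_axioms P.measurable_B order_refl v0, THEN iffD1, rotated])
    then have "(\<lambda>n. CLINT w|distr M (PiM UNIV (\<lambda>_. borel)) path.
        iexp (1 * (sqrt (real n) * quadratic_variation H p a n (real n powr (- 1)) (\<lambda>t w. w t) w)))
      \<longlonglongrightarrow> of_real (exp (- (v * 1\<^sup>2) / 2))" by (rule spec)
    from LIMSEQ_unique[OF this P.fbm_characteristic_function_tendsto[OF F order_refl, of 1]]
    have "exp (- v / 2) = exp (- clt_variance H p a / 2)" by (simp del: of_real_exp)
    then show ?thesis by simp
  qed
  show ?thesis
    unfolding fbm_clt_variance_def
    by (rule the_equality) (use unique clt v in \<open>auto simp: is_fbm_clt_variance_def\<close>)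
qed

end

section \<open>Sums of increments weighted by smooth functions of a process\<close>

lemma integrable_cauchy_density:
  "integrable lborel (\<lambda>z::real. inverse (1 + z\<^sup>2))" "(LINT z|lborel. inverse (1 + z\<^sup>2)) = pi"
  using integrable_inverse_1_plus_square LBINT_inverse_1_plus_square
  by (simp_all add: set_integrable_def interval_lebesgue_integral_def set_lebesgue_integral_def)

text \<open>Inner product for the Cauchy weight. The weight is integrable, so bounded functions have
  finite entries; its inverse grows only quadratically, which fourth moments of the solution can pay
  for.\<close>

definition gram :: "('j \<Rightarrow> real \<Rightarrow> real) \<Rightarrow> 'j \<Rightarrow> 'j \<Rightarrow> real" where
  "gram g j k = (LINT z|lborel. g j z * g k z * inverse (1 + z\<^sup>2))"

lemma integrable_gram:
  assumes "continuous_on UNIV (g j)" "continuous_on UNIV (g k)" "\<And>z. \<bar>g j z\<bar> \<le> K" "\<And>z. \<bar>g k z\<bar> \<le> K"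
  shows "integrable lborel (\<lambda>z. g j z * g k z * inverse (1 + z\<^sup>2))" "\<bar>gram g j k\<bar> \<le> K\<^sup>2 * pi"
proof -
  have [measurable]: "g j \<in> borel_measurable borel" "g k \<in> borel_measurable borel"
    using assms by (auto intro: borel_measurable_continuous_onI)
  have bd: "\<bar>g j z * g k z * inverse (1 + z\<^sup>2)\<bar> \<le> K\<^sup>2 * inverse (1 + z\<^sup>2)" for z
    unfolding abs_mult power2_eq_square[of K] using assms(3,4)[of z] order_trans[OF abs_ge_zero assms(3)]
    by (intro mult_mono) auto
  show i: "integrable lborel (\<lambda>z. g j z * g k z * inverse (1 + z\<^sup>2))"
    by (rule Bochner_Integration.integrable_bound[OF integrable_mult_right[OF integrable_cauchy_density(1), of "K\<^sup>2"]])
       (use bd in \<open>auto simp: abs_mult\<close>)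
  have "\<bar>gram g j k\<bar> \<le> (LINT z|lborel. \<bar>g j z * g k z * inverse (1 + z\<^sup>2)\<bar>)"
    unfolding gram_def by (rule integral_abs_bound)
  also have "\<dots> \<le> (LINT z|lborel. K\<^sup>2 * inverse (1 + z\<^sup>2))"
    using i by (intro integral_mono bd integrable_mult_right integrable_cauchy_density) auto
  finally show "\<bar>gram g j k\<bar> \<le> K\<^sup>2 * pi"
    by (simp add: integrable_cauchy_density(2))
qed

text \<open>A Sobolev bound in the space variable. It allows the sum to be evaluated at a point that depends on
  the weights \<open>d\<close>, at the price of only half of the regularity of the map from \<open>u\<close>, \<open>v\<close>.\<close>

lemma sobolev_increment_bound:
  fixes g g' :: "'j \<Rightarrow> real \<Rightarrow> real"
  assumes A: "finite A"
    and deriv: "\<And>j z. j \<in> A \<Longrightarrow> (g j has_real_derivative g' j z) (at z)"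
    and cont: "\<And>j. j \<in> A \<Longrightarrow> continuous_on UNIV (g' j)"
    and bd: "\<And>j z. j \<in> A \<Longrightarrow> \<bar>g' j z\<bar> \<le> K" and l: "l > 0"
  shows "\<bar>(\<Sum>j\<in>A. d j * g j u) - (\<Sum>j\<in>A. d j * g j v)\<bar>
    \<le> l / 2 * (\<Sum>j\<in>A. \<Sum>k\<in>A. gram g' j k * (d j * d k)) + \<bar>u - v\<bar> * (1 + u\<^sup>2 + v\<^sup>2) / (2 * l)"
proof -
  define W where "W z = (\<Sum>j\<in>A. d j * g j z)" for z
  define W' where "W' z = (\<Sum>j\<in>A. d j * g' j z)" for z
  have dW: "(W has_real_derivative W' z) (at z)" for z
    unfolding W_def[abs_def] W'_def using deriv by (auto intro!: derivative_eq_intros simp: mult.commute)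
  have cW': "continuous_on UNIV W'" unfolding W'_def[abs_def] by (intro continuous_intros cont)
  have [measurable]: "W' \<in> borel_measurable borel" using cW' by (rule borel_measurable_continuous_onI)
  define E where "E = (LINT z|lborel. (W' z)\<^sup>2 * inverse (1 + z\<^sup>2))"
  have sq: "(W' z)\<^sup>2 * inverse (1 + z\<^sup>2) = (\<Sum>j\<in>A. \<Sum>k\<in>A. d j * d k * (g' j z * g' k z * inverse (1 + z\<^sup>2)))" for z
    by (simp only: W'_def power2_eq_square sum_product) (simp only: sum_distrib_right, simp only: mult_ac)
  have ig: "integrable lborel (\<lambda>z. d j * d k * (g' j z * g' k z * inverse (1 + z\<^sup>2)))" if "j \<in> A" "k \<in> A" for j k
    using that by (intro integrable_mult_right integrable_gram(1)[where K = K] cont bd)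
  have iE: "integrable lborel (\<lambda>z. (W' z)\<^sup>2 * inverse (1 + z\<^sup>2))"
    unfolding sq by (intro Bochner_Integration.integrable_sum ig)
  have E: "E = (\<Sum>j\<in>A. \<Sum>k\<in>A. gram g' j k * (d j * d k))"
  proof -
    have "E = (\<Sum>j\<in>A. LINT z|lborel. (\<Sum>k\<in>A. d j * d k * (g' j z * g' k z * inverse (1 + z\<^sup>2))))"
      unfolding E_def sq by (rule Bochner_Integration.integral_sum) (intro Bochner_Integration.integrable_sum ig)
    also have "\<dots> = (\<Sum>j\<in>A. \<Sum>k\<in>A. LINT z|lborel. d j * d k * (g' j z * g' k z * inverse (1 + z\<^sup>2)))"
      by (intro sum.cong refl Bochner_Integration.integral_sum ig)
    finally show ?thesis by (simp add: gram_def mult.commute)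
  qed
  have main: "\<bar>W u - W v\<bar> \<le> l / 2 * E + (u - v) * (1 + u\<^sup>2 + v\<^sup>2) / (2 * l)" if uv: "v \<le> u" for u v
  proof -
    have cont': "continuous_on {v..u} W'" using cW' continuous_on_subset by blast
    have ftc: "(LINT z|lborel. indicator {v..u} z *\<^sub>R W' z) = W u - W v"
      using uv by (rule integral_FTC_atLeastAtMost)
        (use dW cont' in \<open>auto simp: has_real_derivative_iff_has_vector_derivative intro: has_vector_derivative_at_within\<close>)
    have iW': "integrable lborel (\<lambda>z. indicator {v..u} z *\<^sub>R W' z)"
      using cont' borel_integrable_compact[of "{v..u}" W'] by (simp add: set_integrable_def)
    let ?c = "(1 + u\<^sup>2 + v\<^sup>2) / (2 * l)"
    \<comment> \<open>Weighted inequality of arithmetic and geometric means for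
      \<open>\<bar>W' z\<bar>\<close>, with the parameter \<open>l\<close> left free. The inverse
      weight \<open>w\<close> is at most \<open>1 + u^2 + v^2\<close> on the interval.\<close>
    have pt: "\<bar>indicator {v..u} z *\<^sub>R W' z\<bar> \<le> l / 2 * ((W' z)\<^sup>2 * inverse (1 + z\<^sup>2)) + ?c * indicator {v..u} z" for z
    proof (cases "z \<in> {v..u}")
      case True
      then have z2: "z\<^sup>2 \<le> u\<^sup>2 + v\<^sup>2"
      proof -
        have "\<bar>z\<bar> \<le> \<bar>u\<bar> \<or> \<bar>z\<bar> \<le> \<bar>v\<bar>" using True by auto
        then have "z\<^sup>2 \<le> u\<^sup>2 \<or> z\<^sup>2 \<le> v\<^sup>2" by (simp add: abs_le_square_iff)
        then show ?thesis using zero_le_power2[of u] zero_le_power2[of v] by linarith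
      qed
      define w where "w = 1 + z\<^sup>2"
      have w: "w > 0" "w \<le> 1 + u\<^sup>2 + v\<^sup>2" using z2 by (simp_all add: w_def add_pos_nonneg)
      have "0 \<le> (l * \<bar>W' z\<bar> - w)\<^sup>2 / (2 * l * w)" using l w by (intro divide_nonneg_nonneg) auto
      also have "\<dots> = l / 2 * ((W' z)\<^sup>2 * inverse w) + w / (2 * l) - \<bar>W' z\<bar>"
        using l w by (simp add: power2_diff power_mult_distrib divide_simps) (simp add: power2_eq_square algebra_simps)
      finally have "\<bar>W' z\<bar> \<le> l / 2 * ((W' z)\<^sup>2 * inverse w) + w / (2 * l)" by simp
      also have "w / (2 * l) \<le> ?c" using w l by (intro divide_right_mono) auto
      finally show ?thesis using True by (simp add: w_def)
    qed (use l in \<open>simp add: add_pos_nonneg\<close>)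
    have iR: "integrable lborel (\<lambda>z. l / 2 * ((W' z)\<^sup>2 * inverse (1 + z\<^sup>2)) + ?c * indicator {v..u} z)"
      by (intro Bochner_Integration.integrable_add integrable_mult_right iE integrable_real_indicator) (use uv in auto)
    have "\<bar>W u - W v\<bar> \<le> (LINT z|lborel. \<bar>indicator {v..u} z *\<^sub>R W' z\<bar>)"
      unfolding ftc[symmetric] by (rule integral_abs_bound)
    also have "\<dots> \<le> (LINT z|lborel. l / 2 * ((W' z)\<^sup>2 * inverse (1 + z\<^sup>2)) + ?c * indicator {v..u} z)"
      by (rule integral_mono[OF _ iR pt]) (use iW' in simp)
    also have "\<dots> = l / 2 * E + ?c * (u - v)"
      using iE uv by (subst Bochner_Integration.integral_add)
        (auto simp: E_def intro!: integrable_mult_right integrable_real_indicator)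
    finally show ?thesis by (simp add: mult.commute)
  qed
  show ?thesis
  proof (cases "v \<le> u")
    case True
    then show ?thesis using main[OF True] by (simp add: E W_def)
  next
    case False
    then have "u \<le> v" by simp
    from main[OF this] show ?thesis using False by (simp add: E W_def abs_minus_commute add_ac)
  qed
qed

context prob_space
begin

text \<open>The coefficients \<open>gram g' j k\<close> in the Sobolev bound are deterministic, so
  its expectation involves the \<open>D j\<close> through their covariances only, however
  \<open>U\<close> and \<open>V\<close> depend on them.\<close>

lemma expected_increment_bound:
  fixes g g' :: "'j \<Rightarrow> real \<Rightarrow> real" and D :: "'j \<Rightarrow> 'a \<Rightarrow> real" and U V :: "'a \<Rightarrow> real"
  assumes A: "finite A"
    and deriv: "\<And>j z. j \<in> A \<Longrightarrow> (g j has_real_derivative g' j z) (at z)"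
    and cont: "\<And>j. j \<in> A \<Longrightarrow> continuous_on UNIV (g' j)"
    and bd: "\<And>j z. j \<in> A \<Longrightarrow> \<bar>g' j z\<bar> \<le> K" and K: "K > 0"
    and D: "\<And>j. j \<in> A \<Longrightarrow> D j \<in> borel_measurable M" "\<And>j. j \<in> A \<Longrightarrow> integrable M (\<lambda>x. (D j x)\<^sup>2)"
    and UV[measurable]: "U \<in> borel_measurable M" "V \<in> borel_measurable M"
    and iUV: "integrable M (\<lambda>x. \<bar>U x - V x\<bar> * (1 + (U x)\<^sup>2 + (V x)\<^sup>2))"
    and P: "(\<Sum>j\<in>A. \<Sum>k\<in>A. \<bar>expectation (\<lambda>x. D j x * D k x)\<bar>) \<le> P" "P > 0"
    and Q: "expectation (\<lambda>x. \<bar>U x - V x\<bar> * (1 + (U x)\<^sup>2 + (V x)\<^sup>2)) \<le> Q" "Q > 0"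
  shows "integrable M (\<lambda>x. (\<Sum>j\<in>A. D j x * g j (U x)) - (\<Sum>j\<in>A. D j x * g j (V x)))"
    and "expectation (\<lambda>x. \<bar>(\<Sum>j\<in>A. D j x * g j (U x)) - (\<Sum>j\<in>A. D j x * g j (V x))\<bar>) \<le> K * sqrt (pi * (P * Q))"
proof -
  \<comment> \<open>Minimises \<open>l / 2 * (K^2 * pi * P) + Q / (2 * l)\<close>; at this value
    both terms agree.\<close>
  define l where "l = sqrt (Q / (K\<^sup>2 * pi * P))"
  have l: "l > 0" "l\<^sup>2 = Q / (K\<^sup>2 * pi * P)" using K P Q by (auto simp: l_def)
  define F where "F x = (\<Sum>j\<in>A. D j x * g j (U x)) - (\<Sum>j\<in>A. D j x * g j (V x))" for x
  define Rh where "Rh x = l / 2 * (\<Sum>j\<in>A. \<Sum>k\<in>A. gram g' j k * (D j x * D k x)) + \<bar>U x - V x\<bar> * (1 + (U x)\<^sup>2 + (V x)\<^sup>2) / (2 * l)" for x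
  have FR: "\<bar>F x\<bar> \<le> Rh x" for x
    unfolding F_def Rh_def by (rule sobolev_increment_bound) (use assms l in auto)
  have [measurable]: "(\<lambda>x. D j x) \<in> borel_measurable M" if "j \<in> A" for j using D that by simp
  have [measurable]: "g j \<in> borel_measurable borel" if "j \<in> A" for j
    using deriv[OF that] by (intro borel_measurable_continuous_onI continuous_at_imp_continuous_on) (auto intro: DERIV_isCont)
  have [measurable]: "F \<in> borel_measurable M" unfolding F_def[abs_def] by measurable
  have iD: "integrable M (\<lambda>x. D j x * D k x)" if "j \<in> A" "k \<in> A" for j k
    using that D by (intro cauchy_schwarz_expectation) auto
  have iS: "integrable M (\<lambda>x. \<Sum>j\<in>A. \<Sum>k\<in>A. gram g' j k * (D j x * D k x))"
    by (intro Bochner_Integration.integrable_sum integrable_mult_right iD)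
  have iR: "integrable M Rh"
    unfolding Rh_def[abs_def] using iS iUV by (intro Bochner_Integration.integrable_add integrable_mult_right integrable_divide_zero)
  have "integrable M F"
    by (rule Bochner_Integration.integrable_bound[OF iR]) (use FR order_trans[OF FR abs_ge_self] in auto)
  then show iF: "integrable M (\<lambda>x. (\<Sum>j\<in>A. D j x * g j (U x)) - (\<Sum>j\<in>A. D j x * g j (V x)))"
    by (simp only: F_def[abs_def])
  have S: "expectation (\<lambda>x. \<Sum>j\<in>A. \<Sum>k\<in>A. gram g' j k * (D j x * D k x)) \<le> K\<^sup>2 * pi * P"
  proof -
    have "expectation (\<lambda>x. \<Sum>j\<in>A. \<Sum>k\<in>A. gram g' j k * (D j x * D k x)) = (\<Sum>j\<in>A. \<Sum>k\<in>A. gram g' j k * expectation (\<lambda>x. D j x * D k x))"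
      by (simp add: iD Bochner_Integration.integral_sum Bochner_Integration.integrable_sum)
    also have "\<dots> \<le> (\<Sum>j\<in>A. \<Sum>k\<in>A. (K\<^sup>2 * pi) * \<bar>expectation (\<lambda>x. D j x * D k x)\<bar>)"
    proof (intro sum_mono)
      fix j k assume "j \<in> A" "k \<in> A"
      then have "\<bar>gram g' j k\<bar> \<le> K\<^sup>2 * pi" by (intro integrable_gram(2) cont bd)
      then have "\<bar>gram g' j k * expectation (\<lambda>x. D j x * D k x)\<bar> \<le> (K\<^sup>2 * pi) * \<bar>expectation (\<lambda>x. D j x * D k x)\<bar>"
        unfolding abs_mult by (intro mult_right_mono) auto
      then show "gram g' j k * expectation (\<lambda>x. D j x * D k x) \<le> (K\<^sup>2 * pi) * \<bar>expectation (\<lambda>x. D j x * D k x)\<bar>"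
        by linarith
    qed
    also have "\<dots> \<le> K\<^sup>2 * pi * P"
      unfolding sum_distrib_left[symmetric] using P K by (intro mult_left_mono) auto
    finally show ?thesis .
  qed
  have "expectation (\<lambda>x. \<bar>F x\<bar>) \<le> expectation Rh"
    using iF iR FR by (intro integral_mono) (auto simp: F_def[abs_def])
  also have "\<dots> = l / 2 * expectation (\<lambda>x. \<Sum>j\<in>A. \<Sum>k\<in>A. gram g' j k * (D j x * D k x))
      + expectation (\<lambda>x. \<bar>U x - V x\<bar> * (1 + (U x)\<^sup>2 + (V x)\<^sup>2)) / (2 * l)"
    unfolding Rh_def
    using iS iUV by (simp only: Bochner_Integration.integral_add[OF integrable_mult_right[OF iS] integrable_divide_zero[OF iUV]]
        integral_mult_right_zero integral_divide_zero)
  also have "\<dots> \<le> l / 2 * (K\<^sup>2 * pi * P) + Q / (2 * l)"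
    using S Q l by (intro add_mono mult_left_mono divide_right_mono) auto
  also have "\<dots> = K * sqrt (pi * (P * Q))"
  proof -
    define c where "c = K\<^sup>2 * pi * P"
    have c: "c > 0" using K P by (simp add: c_def)
    have Q_eq: "Q = l\<^sup>2 * c" unfolding l(2) c_def[symmetric] using c by simp
    have "(K * sqrt (pi * (P * Q)))\<^sup>2 = c * Q"
      using P Q by (simp only: power_mult_distrib) (simp add: c_def)
    also have "\<dots> = (l * c)\<^sup>2"
      unfolding Q_eq by (simp add: power2_eq_square)
    finally have "K * sqrt (pi * (P * Q)) = l * c"
      by (rule power2_eq_imp_eq) (use K P Q l(1) c in auto)
    moreover have "Q / (2 * l) = l * c / 2"
      unfolding Q_eq using l(1) by (simp add: power2_eq_square)
    ultimately show ?thesis unfolding c_def[symmetric] by simp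
  qed
  finally show "expectation (\<lambda>x. \<bar>(\<Sum>j\<in>A. D j x * g j (U x)) - (\<Sum>j\<in>A. D j x * g j (V x))\<bar>) \<le> K * sqrt (pi * (P * Q))"
    by (simp only: F_def)
qed

text \<open>Freezing \<open>U\<close> at the beginning of dyadic blocks: halving a block of length \<open>2 ^ (r + 1)\<close> costs one application
  of the bound above on its second half.\<close>

lemma dyadic_chaining:
  fixes g g' :: "nat \<Rightarrow> real \<Rightarrow> real" and D U :: "nat \<Rightarrow> 'a \<Rightarrow> real" and P Q :: "nat \<Rightarrow> real"
  assumes deriv: "\<And>j z. (g j has_real_derivative g' j z) (at z)"
    and cont: "\<And>j. continuous_on UNIV (g' j)"
    and bd: "\<And>j z. \<bar>g' j z\<bar> \<le> K" and K: "K > 0"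
    and D: "\<And>j. D j \<in> borel_measurable M" "\<And>j. integrable M (\<lambda>x. (D j x)\<^sup>2)"
    and U: "\<And>j. U j \<in> borel_measurable M"
    and iU: "\<And>j k. integrable M (\<lambda>x. \<bar>U j x - U k x\<bar> * (1 + (U j x)\<^sup>2 + (U k x)\<^sup>2))"
    and P: "\<And>r i. (\<Sum>j\<in>{i..<i + 2 ^ r}. \<Sum>k\<in>{i..<i + 2 ^ r}. \<bar>expectation (\<lambda>x. D j x * D k x)\<bar>) \<le> P r" "\<And>r. P r > 0"
    and Q: "\<And>r i. expectation (\<lambda>x. \<bar>U (i + 2 ^ r) x - U i x\<bar> * (1 + (U (i + 2 ^ r) x)\<^sup>2 + (U i x)\<^sup>2)) \<le> Q r" "\<And>r. Q r > 0"
    and \<beta>: "\<And>r. K * sqrt (pi * (P r * Q r)) \<le> \<beta> * (2 ^ r) powr \<kappa>" and \<kappa>: "\<kappa> \<ge> 1"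
  shows "integrable M (\<lambda>x. \<Sum>j\<in>{i..<i + 2 ^ r}. D j x * (g j (U j x) - g j (U i x))) \<and>
    expectation (\<lambda>x. \<bar>\<Sum>j\<in>{i..<i + 2 ^ r}. D j x * (g j (U j x) - g j (U i x))\<bar>) \<le> \<beta> * real r * (2 ^ r) powr \<kappa>"
proof (induction r arbitrary: i)
  case 0
  then show ?case by simp
next
  case (Suc r)
  define i' where "i' = i + 2 ^ r"
  have blocks: "{i..<i + 2 ^ Suc r} = {i..<i + 2 ^ r} \<union> {i'..<i' + 2 ^ r}" "{i..<i + 2 ^ r} \<inter> {i'..<i' + 2 ^ r} = {}"
    by (auto simp: i'_def)
  define R where "R i x = (\<Sum>j\<in>{i..<i + 2 ^ r}. D j x * (g j (U j x) - g j (U i x)))" for i x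
  define W where "W x = (\<Sum>j\<in>{i'..<i' + 2 ^ r}. D j x * g j (U i' x)) - (\<Sum>j\<in>{i'..<i' + 2 ^ r}. D j x * g j (U i x))" for x
  have split: "(\<Sum>j\<in>{i..<i + 2 ^ Suc r}. D j x * (g j (U j x) - g j (U i x))) = R i x + R i' x + W x" for x
  proof -
    have "(\<Sum>j\<in>{i'..<i' + 2 ^ r}. D j x * (g j (U j x) - g j (U i x))) = R i' x + W x"
      unfolding R_def W_def sum_subtractf[symmetric] sum.distrib[symmetric]
      by (intro sum.cong refl) (simp add: algebra_simps)
    then show ?thesis
      unfolding blocks(1) by (subst sum.union_disjoint[OF _ _ blocks(2)]) (simp_all add: R_def)
  qed
  have W: "integrable M W" "expectation (\<lambda>x. \<bar>W x\<bar>) \<le> K * sqrt (pi * (P r * Q r))"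
    unfolding W_def[abs_def]
    by (rule expected_increment_bound[OF finite_atLeastLessThan deriv cont bd K D U U iU P Q(1)[of i r, folded i'_def] Q(2)])+
  have iR: "integrable M (R i)" "integrable M (R i')"
    using Suc.IH by (simp_all add: R_def[abs_def])
  have eR: "expectation (\<lambda>x. \<bar>R i x\<bar>) \<le> \<beta> * real r * (2 ^ r) powr \<kappa>" "expectation (\<lambda>x. \<bar>R i' x\<bar>) \<le> \<beta> * real r * (2 ^ r) powr \<kappa>"
    using Suc.IH by (simp_all add: R_def)
  have \<beta>0: "0 \<le> \<beta>"
  proof -
    have "0 \<le> K * sqrt (pi * (P 0 * Q 0))" using K P(2)[of 0] Q(2)[of 0] by simp
    then show ?thesis using \<beta>[of 0] by simp
  qed
  have "expectation (\<lambda>x. \<bar>R i x + R i' x + W x\<bar>) \<le> expectation (\<lambda>x. \<bar>R i x\<bar> + \<bar>R i' x\<bar> + \<bar>W x\<bar>)"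
    using iR W(1) by (intro integral_mono) auto
  also have "\<dots> = expectation (\<lambda>x. \<bar>R i x\<bar>) + expectation (\<lambda>x. \<bar>R i' x\<bar>) + expectation (\<lambda>x. \<bar>W x\<bar>)"
    using iR W(1) by simp
  also have "\<dots> \<le> \<beta> * real r * (2 ^ r) powr \<kappa> + \<beta> * real r * (2 ^ r) powr \<kappa> + \<beta> * (2 ^ r) powr \<kappa>"
    using eR W(2) \<beta>[of r] by linarith
  also have "\<dots> = \<beta> * (2 * real r + 1) * (2 ^ r) powr \<kappa>" by (simp add: algebra_simps)
  also have "\<dots> \<le> \<beta> * (2 * real (Suc r)) * (2 ^ r) powr \<kappa>"
    using \<beta>0 by (intro mult_right_mono mult_left_mono) auto
  also have "\<dots> \<le> \<beta> * (2 powr \<kappa> * real (Suc r)) * (2 ^ r) powr \<kappa>"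
    using \<beta>0 powr_mono[OF \<kappa>, of 2] by (intro mult_right_mono mult_left_mono) auto
  also have "\<dots> = \<beta> * real (Suc r) * (2 ^ Suc r) powr \<kappa>" by (simp add: powr_mult)
  finally show ?case
    unfolding split using iR W(1) by simp
qed

end

section \<open>Solutions of the stochastic differential equation\<close>

lemma C1_differentiable_on_UNIV_deriv:
  fixes g :: "real \<Rightarrow> real"
  assumes "g C1_differentiable_on UNIV"
  shows "(g has_real_derivative deriv g z) (at z)" "continuous_on UNIV (deriv g)"
proof -
  obtain D where D: "\<And>z. (g has_real_derivative D z) (at z)" "continuous_on UNIV D"
    using assms by (auto simp: C1_differentiable_on_def has_real_derivative_iff_has_vector_derivative)
  then have "deriv g = D" by (auto simp: fun_eq_iff intro: DERIV_imp_deriv)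
  then show "(g has_real_derivative deriv g z) (at z)" "continuous_on UNIV (deriv g)" using D by auto
qed

text \<open>Projection to the time interval. It extends \<open>f\<close> and the measurable version
  of \<open>X\<close> to all times, so that bounds and joint measurability hold on the whole
  line.\<close>

definition clip :: "real \<Rightarrow> real" where
  "clip t = max 0 (min 1 t)"

lemma clip: "clip t \<in> {0..1}" "t \<in> {0..1} \<Longrightarrow> clip t = t" "continuous_on UNIV clip"
  by (auto simp: clip_def[abs_def] intro!: continuous_intros)

locale sde_fbm = fbm M H B for M :: "'a measure" and H B +
  fixes x0 :: real and f :: "real \<Rightarrow> real \<Rightarrow> real" and X :: "real \<Rightarrow> 'a \<Rightarrow> real"
  assumes f: "C01b {0..1} f" and sde: "sde_solution M x0 f B X"
begin

definition K :: real where
  "K = (SOME K. K > 0 \<and> (\<forall>s\<in>{0..1}. \<forall>r\<in>{0..1}. \<forall>y z. \<bar>f s y\<bar> + \<bar>deriv (f r) z\<bar> \<le> K))"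

lemma K: "K > 0" "s \<in> {0..1} \<Longrightarrow> \<bar>f s y\<bar> \<le> K" "s \<in> {0..1} \<Longrightarrow> \<bar>deriv (f s) y\<bar> \<le> K"
proof -
  have "\<exists>K. K > 0 \<and> (\<forall>s\<in>{0..1}. \<forall>r\<in>{0..1}. \<forall>y z. \<bar>f s y\<bar> + \<bar>deriv (f r) z\<bar> \<le> K)"
    using f unfolding C01b_def by blast
  then have *: "K > 0 \<and> (\<forall>s\<in>{0..1}. \<forall>r\<in>{0..1}. \<forall>y z. \<bar>f s y\<bar> + \<bar>deriv (f r) z\<bar> \<le> K)"
    unfolding K_def by (rule someI_ex)
  then show "K > 0" by blast
  assume s: "s \<in> {0..1}"
  with * have "\<bar>f s y\<bar> + \<bar>deriv (f s) y\<bar> \<le> K" by blast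
  then show "\<bar>f s y\<bar> \<le> K" "\<bar>deriv (f s) y\<bar> \<le> K" by linarith+
qed

lemma f_deriv:
  assumes "s \<in> {0..1}"
  shows "(f s has_real_derivative deriv (f s) z) (at z)" "continuous_on UNIV (deriv (f s))"
  using C1_differentiable_on_UNIV_deriv[of "f s"] f assms by (auto simp: C01b_def)

lemma f_lipschitz: "s \<in> {0..1} \<Longrightarrow> \<bar>f s y - f s z\<bar> \<le> K * \<bar>y - z\<bar>"
  using field_differentiable_bound[of UNIV "f s" "deriv (f s)" K y z] f_deriv(1) K(3) by auto

text \<open>Continuity in time for each fixed point and a Lipschitz constant in space that is
  uniform in time give joint continuity.\<close>

lemma measurable_f: "(\<lambda>z. f (clip (fst z)) (snd z)) \<in> borel_measurable borel"
proof (rule borel_measurable_continuous_onI, rule continuous_at_imp_continuous_on, intro ballI)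
  fix z0 :: "real \<times> real"
  have ct: "continuous_on UNIV (\<lambda>s. f (clip s) y)" for y
    by (rule continuous_on_compose2[OF _ clip(3)]) (use f clip(1) in \<open>auto simp: C01b_def\<close>)
  have "((\<lambda>z. f (clip (fst z)) (snd z0)) \<longlongrightarrow> f (clip (fst z0)) (snd z0)) (at z0)"
    using ct[of "snd z0"] by (intro isCont_tendsto_compose[where g = "\<lambda>s. f (clip s) (snd z0)"] tendsto_intros)
      (auto simp: continuous_on_eq_continuous_at)
  then have 1: "((\<lambda>z. \<bar>f (clip (fst z)) (snd z0) - f (clip (fst z0)) (snd z0)\<bar>) \<longlongrightarrow> 0) (at z0)"
    using tendsto_rabs_zero LIM_zero by blast
  have "((\<lambda>z. K * \<bar>snd z - snd z0\<bar>) \<longlongrightarrow> K * \<bar>snd z0 - snd z0\<bar>) (at z0)"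
    by (intro tendsto_intros)
  then have 2: "((\<lambda>z. K * \<bar>snd z - snd z0\<bar> + \<bar>f (clip (fst z)) (snd z0) - f (clip (fst z0)) (snd z0)\<bar>) \<longlongrightarrow> 0) (at z0)"
    using tendsto_add[OF _ 1] by fastforce
  have "((\<lambda>z. f (clip (fst z)) (snd z) - f (clip (fst z0)) (snd z0)) \<longlongrightarrow> 0) (at z0)"
  proof (rule Lim_null_comparison[OF always_eventually 2], intro allI)
    fix z
    show "norm (f (clip (fst z)) (snd z) - f (clip (fst z0)) (snd z0))
      \<le> K * \<bar>snd z - snd z0\<bar> + \<bar>f (clip (fst z)) (snd z0) - f (clip (fst z0)) (snd z0)\<bar>"
      using f_lipschitz[OF clip(1), of "fst z" "snd z" "snd z0"] by simp
  qed
  then show "isCont (\<lambda>z. f (clip (fst z)) (snd z)) z0"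
    unfolding isCont_def by (rule LIM_zero_cancel)
qed

text \<open>\<open>X\<close> is only indistinguishable from a jointly measurable process. Building
  the drift from that version makes Fubini applicable and the bound \<open>K\<close> valid
  everywhere, while the link to \<open>X\<close> holds for all times at once outside one null
  set.\<close>

lemma drift_exists:
  "\<exists>F. (\<lambda>z. F (fst z) (snd z)) \<in> borel_measurable (lborel \<Otimes>\<^sub>M M) \<and> (\<forall>t \<omega>. \<bar>F t \<omega>\<bar> \<le> K) \<and>
    (AE \<omega> in M. \<forall>t\<in>{0..1}. F t \<omega> = f t (X t \<omega>) \<and> X t \<omega> = x0 + (LBINT s:{0..t}. F s \<omega>) + B t \<omega>)"
proof -
  obtain Z where Z: "(\<lambda>(t, \<omega>). Z t \<omega>) \<in> borel_measurable (restrict_space borel {0..1} \<Otimes>\<^sub>M M)"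
    "AE \<omega> in M. \<forall>t\<in>{0..1}. X t \<omega> = Z t \<omega>"
    using sde by (auto simp: sde_solution_def measurable_process_def)
  have [measurable]: "clip \<in> borel_measurable borel"
    using clip(3) by (rule borel_measurable_continuous_onI)
  have [measurable]: "clip \<in> measurable borel (restrict_space borel {0..1})"
    by (rule measurable_restrict_space2) (use clip(1) in auto)
  have "(\<lambda>z. (\<lambda>(t, \<omega>). Z t \<omega>) (clip (fst z), snd z)) \<in> borel_measurable (lborel \<Otimes>\<^sub>M M)"
    by (rule measurable_compose[OF _ Z(1)]) measurable
  then have [measurable]: "(\<lambda>z. Z (clip (fst z)) (snd z)) \<in> borel_measurable (lborel \<Otimes>\<^sub>M M)" by simp
  define F where "F t \<omega> = f (clip t) (Z (clip t) \<omega>)" for t \<omega>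
  have "(\<lambda>z. (\<lambda>w. f (clip (fst w)) (snd w)) (fst z, Z (clip (fst z)) (snd z))) \<in> borel_measurable (lborel \<Otimes>\<^sub>M M)"
    by (rule measurable_compose[OF _ measurable_f]) (simp flip: borel_prod, measurable)
  then have m: "(\<lambda>z. F (fst z) (snd z)) \<in> borel_measurable (lborel \<Otimes>\<^sub>M M)" by (simp add: F_def)
  have b: "\<bar>F t \<omega>\<bar> \<le> K" for t \<omega> unfolding F_def by (rule K(2)[OF clip(1)])
  have "AE \<omega> in M. \<forall>t\<in>{0..1}. X t \<omega> = x0 + (LBINT s:{0..t}. f s (X s \<omega>)) + B t \<omega>"
    using sde by (auto simp: sde_solution_def)
  with Z(2) have "AE \<omega> in M. \<forall>t\<in>{0..1}. F t \<omega> = f t (X t \<omega>) \<and> X t \<omega> = x0 + (LBINT s:{0..t}. F s \<omega>) + B t \<omega>"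
  proof eventually_elim
    case (elim \<omega>)
    have F: "F t \<omega> = f t (X t \<omega>)" if "t \<in> {0..1}" for t
      using elim(1) that clip(2)[OF that] by (simp add: F_def)
    have "(LBINT s:{0..t}. F s \<omega>) = (LBINT s:{0..t}. f s (X s \<omega>))" if "t \<in> {0..1}" for t
      using that by (intro set_lebesgue_integral_cong) (auto simp: F)
    then show ?case using F elim(2) by simp
  qed
  with m b show ?thesis by blast
qed

definition drift :: "real \<Rightarrow> 'a \<Rightarrow> real" where
  "drift = (SOME F. (\<lambda>z. F (fst z) (snd z)) \<in> borel_measurable (lborel \<Otimes>\<^sub>M M) \<and> (\<forall>t \<omega>. \<bar>F t \<omega>\<bar> \<le> K) \<and>
    (AE \<omega> in M. \<forall>t\<in>{0..1}. F t \<omega> = f t (X t \<omega>) \<and> X t \<omega> = x0 + (LBINT s:{0..t}. F s \<omega>) + B t \<omega>))"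

lemma drift:
  shows measurable_drift[measurable]: "(\<lambda>z. drift (fst z) (snd z)) \<in> borel_measurable (lborel \<Otimes>\<^sub>M M)"
    and drift_le: "\<bar>drift t \<omega>\<bar> \<le> K"
    and AE_drift: "AE \<omega> in M. \<forall>t\<in>{0..1}. drift t \<omega> = f t (X t \<omega>) \<and> X t \<omega> = x0 + (LBINT s:{0..t}. drift s \<omega>) + B t \<omega>"
  using someI_ex[OF drift_exists, folded drift_def] by blast+

lemma measurable_drift_section: "\<omega> \<in> space M \<Longrightarrow> (\<lambda>t. drift t \<omega>) \<in> borel_measurable lborel"
  using measurable_compose[OF measurable_Pair2'[of \<omega> M lborel] measurable_drift] by simp

text \<open>Written in the increment \<open>u\<close>, the range of integration depends on
  \<open>t - s\<close> only, so that drifts from different base points can be summed under one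
  integral.\<close>

lemma drift_increment:
  assumes \<omega>: "\<omega> \<in> space M" and st: "0 \<le> s" "s \<le> t"
  shows "(LBINT v:{0..t}. drift v \<omega>) - (LBINT v:{0..s}. drift v \<omega>) = (LINT u|lborel. indicator {0<..t - s} u * drift (s + u) \<omega>)"
    and "\<bar>(LBINT v:{0..t}. drift v \<omega>) - (LBINT v:{0..s}. drift v \<omega>)\<bar> \<le> K * (t - s)"
proof -
  have [measurable]: "(\<lambda>t. drift t \<omega>) \<in> borel_measurable borel"
    using measurable_drift_section[OF \<omega>] by simp
  have i: "integrable lborel (\<lambda>u. indicator A u * drift u \<omega>)" if [measurable]: "A \<in> sets borel" and A: "emeasure lborel A < \<infinity>" for A :: "real set"
  proof (rule Bochner_Integration.integrable_bound)
    show "integrable lborel (\<lambda>u. K * indicator A u)"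
      by (intro integrable_mult_right integrable_real_indicator) (use A in auto)
    show "AE u in lborel. norm (indicator A u * drift u \<omega>) \<le> norm (K * indicator A u)"
      using drift_le K(1) by (auto simp: indicator_def)
  qed measurable
  have "indicator {0..t} v * drift v \<omega> = indicator {0..s} v * drift v \<omega> + indicator {s<..t} v * drift v \<omega>" for v
    using st by (auto simp: indicator_def)
  then have "(LBINT v:{0..t}. drift v \<omega>) = (LBINT v:{0..s}. drift v \<omega>) + (LINT v|lborel. indicator {s<..t} v * drift v \<omega>)"
    unfolding set_lebesgue_integral_def using st by (simp add: i)
  then have "(LBINT v:{0..t}. drift v \<omega>) - (LBINT v:{0..s}. drift v \<omega>) = (LINT v|lborel. indicator {s<..t} v * drift v \<omega>)"
    by simp
  also have "\<dots> = (LINT u|lborel. indicator {s<..t} (s + 1 * u) * drift (s + 1 * u) \<omega>)"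
    using lborel_integral_real_affine[of 1 "\<lambda>v. indicator {s<..t} v * drift v \<omega>" s] by simp
  also have "\<dots> = (LINT u|lborel. indicator {0<..t - s} u * drift (s + u) \<omega>)"
    by (intro Bochner_Integration.integral_cong refl) (auto simp: indicator_def)
  finally show eq: "(LBINT v:{0..t}. drift v \<omega>) - (LBINT v:{0..s}. drift v \<omega>) = (LINT u|lborel. indicator {0<..t - s} u * drift (s + u) \<omega>)" .
  have "\<bar>LINT v|lborel. indicator {s<..t} v * drift v \<omega>\<bar> \<le> (LINT v|lborel. \<bar>indicator {s<..t} v * drift v \<omega>\<bar>)"
    by (rule integral_abs_bound)
  also have "\<dots> \<le> (LINT v|lborel. K * indicator {s<..t} v)"
    using st K(1) drift_le by (intro integral_mono integrable_mult_right integrable_real_indicator integrable_abs i) (auto simp: indicator_def)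
  also have "\<dots> = K * (t - s)" using st by simp
  finally show "\<bar>(LBINT v:{0..t}. drift v \<omega>) - (LBINT v:{0..s}. drift v \<omega>)\<bar> \<le> K * (t - s)"
    using \<open>(LBINT v:{0..t}. drift v \<omega>) - (LBINT v:{0..s}. drift v \<omega>) = (LINT v|lborel. indicator {s<..t} v * drift v \<omega>)\<close> by simp
qed

lemma measurable_X[measurable]: "t \<in> {0..1} \<Longrightarrow> X t \<in> borel_measurable M"
  using sde by (auto simp: sde_solution_def measurable_process_def)

text \<open>Apart from \<open>B t\<close>, the solution is almost surely bounded by
  \<open>\<bar>x0\<bar> + K\<close>.\<close>

lemma X_fourth_moment:
  assumes t: "t \<in> {0..1}"
  shows "integrable M (\<lambda>\<omega>. X t \<omega> ^ 4)" "expectation (\<lambda>\<omega>. X t \<omega> ^ 4) \<le> 8 * ((\<bar>x0\<bar> + K) ^ 4 + 3)"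
proof -
  have [measurable]: "X t \<in> borel_measurable M" using t by simp
  have AE: "AE \<omega> in M. X t \<omega> ^ 4 \<le> 8 * ((\<bar>x0\<bar> + K) ^ 4 + B t \<omega> ^ 4)"
    using AE_drift AE_space
  proof eventually_elim
    case (elim \<omega>)
    have "\<bar>LBINT s:{0..t}. drift s \<omega>\<bar> \<le> K * t"
    proof -
      have "AE v in lborel. indicator {0..0} v *\<^sub>R drift v \<omega> = 0"
        using AE_lborel_singleton[of 0] by eventually_elim auto
      then have "(LBINT v:{0..0}. drift v \<omega>) = 0"
        unfolding set_lebesgue_integral_def by (rule integral_eq_zero_AE)
      then show ?thesis using drift_increment(2)[OF elim(2), of 0 t] t by simp
    qed
    also have "K * t \<le> K" using t K(1) by simp
    finally have "\<bar>X t \<omega>\<bar> \<le> (\<bar>x0\<bar> + K) + \<bar>B t \<omega>\<bar>" using elim(1) t by fastforce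
    then have "\<bar>X t \<omega>\<bar> ^ 4 \<le> ((\<bar>x0\<bar> + K) + \<bar>B t \<omega>\<bar>) ^ 4" by (rule power_mono) simp
    also have "\<dots> \<le> 8 * ((\<bar>x0\<bar> + K) ^ 4 + \<bar>B t \<omega>\<bar> ^ 4)" by (rule power4_add_le)
    finally show ?case by simp
  qed
  have i: "integrable M (\<lambda>\<omega>. 8 * ((\<bar>x0\<bar> + K) ^ 4 + B t \<omega> ^ 4))"
    using integrable_B[OF t] by simp
  show iX: "integrable M (\<lambda>\<omega>. X t \<omega> ^ 4)"
    by (rule Bochner_Integration.integrable_bound[OF i]) (use AE in \<open>auto elim!: eventually_mono\<close>)
  have "expectation (\<lambda>\<omega>. X t \<omega> ^ 4) \<le> expectation (\<lambda>\<omega>. 8 * ((\<bar>x0\<bar> + K) ^ 4 + B t \<omega> ^ 4))"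
    by (rule integral_mono_AE[OF iX i AE])
  also have "\<dots> = 8 * ((\<bar>x0\<bar> + K) ^ 4 + 3 * (t powr (2 * H))\<^sup>2)"
    using integrable_B[OF t] by (simp add: prob_space)
  also have "\<dots> \<le> 8 * ((\<bar>x0\<bar> + K) ^ 4 + 3)"
  proof -
    have "t powr (2 * H) \<le> 1 powr (2 * H)" using t H_range by (intro powr_mono2) auto
    then have "(t powr (2 * H))\<^sup>2 \<le> 1\<^sup>2" by (intro power_mono) auto
    then show ?thesis by simp
  qed
  finally show "expectation (\<lambda>\<omega>. X t \<omega> ^ 4) \<le> 8 * ((\<bar>x0\<bar> + K) ^ 4 + 3)" .
qed

text \<open>The integrated drift moves by at most \<open>K * \<bar>t - s\<bar>\<close>. On the unit
  interval this is dominated by the \<open>\<bar>t - s\<bar> powr H\<close> of the noise, since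
  \<open>H < 1\<close>.\<close>

lemma X_increment_second_moment:
  assumes st: "s \<in> {0..1}" "t \<in> {0..1}"
  shows "integrable M (\<lambda>\<omega>. (X t \<omega> - X s \<omega>)\<^sup>2)"
    and "expectation (\<lambda>\<omega>. (X t \<omega> - X s \<omega>)\<^sup>2) \<le> 2 * (K\<^sup>2 + 1) * \<bar>t - s\<bar> powr (2 * H)"
proof -
  have [measurable]: "X t \<in> borel_measurable M" "X s \<in> borel_measurable M" using st by auto
  have AE: "AE \<omega> in M. (X t \<omega> - X s \<omega>)\<^sup>2 \<le> 2 * ((K * \<bar>t - s\<bar>)\<^sup>2 + (B t \<omega> - B s \<omega>)\<^sup>2)"
    using AE_drift AE_space
  proof eventually_elim
    case (elim \<omega>)
    define d where "d = (LBINT v:{0..t}. drift v \<omega>) - (LBINT v:{0..s}. drift v \<omega>)"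
    have "\<bar>d\<bar> \<le> K * \<bar>t - s\<bar>"
      using drift_increment(2)[OF elim(2), of s t] drift_increment(2)[OF elim(2), of t s] st
      by (cases "s \<le> t") (auto simp: d_def abs_minus_commute)
    then have "d\<^sup>2 \<le> (K * \<bar>t - s\<bar>)\<^sup>2" using K(1) by (simp add: power2_le_iff_abs_le)
    moreover have "X t \<omega> - X s \<omega> = d + (B t \<omega> - B s \<omega>)" using elim(1) st by (simp add: d_def)
    moreover have "(d + b)\<^sup>2 \<le> 2 * (d\<^sup>2 + b\<^sup>2)" for b :: real
      using sum_squares_bound[of d b] by (simp add: power2_sum)
    ultimately show ?case by (smt (verit))
  qed
  have iBB: "integrable M (\<lambda>\<omega>. (B t \<omega> - B s \<omega>)\<^sup>2)"
    using integrable_B(2) cov_B(1) st by (simp add: power2_diff mult.assoc)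
  have eBB: "expectation (\<lambda>\<omega>. (B t \<omega> - B s \<omega>)\<^sup>2) = \<bar>t - s\<bar> powr (2 * H)"
  proof -
    have "expectation (\<lambda>\<omega>. (B t \<omega> - B s \<omega>)\<^sup>2) = expectation (\<lambda>\<omega>. B t \<omega> * B t \<omega> + B s \<omega> * B s \<omega> - 2 * (B t \<omega> * B s \<omega>))"
      by (intro Bochner_Integration.integral_cong refl) (simp add: power2_eq_square algebra_simps)
    also have "\<dots> = fcov t t + fcov s s - 2 * fcov t s"
      using cov_B st by simp
    finally show ?thesis by (simp add: fcov_def field_simps)
  qed
  have i: "integrable M (\<lambda>\<omega>. 2 * ((K * \<bar>t - s\<bar>)\<^sup>2 + (B t \<omega> - B s \<omega>)\<^sup>2))" using iBB by simp
  show iX: "integrable M (\<lambda>\<omega>. (X t \<omega> - X s \<omega>)\<^sup>2)"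
    by (rule Bochner_Integration.integrable_bound[OF i]) (use AE in \<open>auto elim!: eventually_mono\<close>)
  have "expectation (\<lambda>\<omega>. (X t \<omega> - X s \<omega>)\<^sup>2) \<le> expectation (\<lambda>\<omega>. 2 * ((K * \<bar>t - s\<bar>)\<^sup>2 + (B t \<omega> - B s \<omega>)\<^sup>2))"
    by (rule integral_mono_AE[OF iX i AE])
  also have "\<dots> = 2 * (K\<^sup>2 * \<bar>t - s\<bar>\<^sup>2 + \<bar>t - s\<bar> powr (2 * H))"
    using iBB eBB by (simp add: prob_space power_mult_distrib)
  also have "\<bar>t - s\<bar>\<^sup>2 \<le> \<bar>t - s\<bar> powr (2 * H)"
  proof (cases "t = s")
    case False
    then have pos: "0 < \<bar>t - s\<bar>" "\<bar>t - s\<bar> \<le> 1" using st by auto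
    then have "\<bar>t - s\<bar>\<^sup>2 = \<bar>t - s\<bar> powr 2" by (simp add: powr_numeral)
    also have "\<dots> \<le> \<bar>t - s\<bar> powr (2 * H)" using pos H_range by (intro powr_mono') auto
    finally show ?thesis .
  qed simp
  finally show "expectation (\<lambda>\<omega>. (X t \<omega> - X s \<omega>)\<^sup>2) \<le> 2 * (K\<^sup>2 + 1) * \<bar>t - s\<bar> powr (2 * H)"
    using K(1) by (simp add: algebra_simps)
qed

text \<open>The two Cauchy-Schwarz factors of a weighted increment: the constant of the
  second-moment bound, and a bound for the second moment of \<open>1 + (X t)^2 + (X s)^2\<close>, in
  which 16 is the 8 of the fourth-moment bound counted for both times.\<close>

definition CQ :: real where
  "CQ = sqrt (2 * (K\<^sup>2 + 1)) * sqrt (3 * (1 + 16 * ((\<bar>x0\<bar> + K) ^ 4 + 3)))"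

lemma CQ_pos: "CQ > 0"
proof -
  have "0 \<le> (\<bar>x0\<bar> + K) ^ 4" using K(1) by simp
  then have "0 < 3 * (1 + 16 * ((\<bar>x0\<bar> + K) ^ 4 + 3))"
    by (intro mult_pos_pos add_pos_nonneg mult_nonneg_nonneg add_nonneg_nonneg) auto
  moreover have "0 < 2 * (K\<^sup>2 + 1)" by (simp add: add_nonneg_pos)
  ultimately show ?thesis
    unfolding CQ_def by (rule mult_pos_pos[OF real_sqrt_gt_zero real_sqrt_gt_zero, rotated])
qed

text \<open>Cauchy-Schwarz. This provides the quantity \<open>Q\<close> of the chaining; its
  exponent is \<open>H\<close>, not \<open>2 * H\<close>, because the increment enters to the first
  power.\<close>

lemma X_weighted_increment:
  assumes st: "s \<in> {0..1}" "t \<in> {0..1}"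
  shows "integrable M (\<lambda>\<omega>. \<bar>X t \<omega> - X s \<omega>\<bar> * (1 + (X t \<omega>)\<^sup>2 + (X s \<omega>)\<^sup>2))"
    and "expectation (\<lambda>\<omega>. \<bar>X t \<omega> - X s \<omega>\<bar> * (1 + (X t \<omega>)\<^sup>2 + (X s \<omega>)\<^sup>2)) \<le> CQ * \<bar>t - s\<bar> powr H"
proof -
  have [measurable]: "X t \<in> borel_measurable M" "X s \<in> borel_measurable M" using st by auto
  have sq: "(1 + a\<^sup>2 + b\<^sup>2)\<^sup>2 \<le> 3 * (1 + (a ^ 4 + b ^ 4))" for a b :: real
    using sum_squares_bound[of 1 "a\<^sup>2"] sum_squares_bound[of 1 "b\<^sup>2"] sum_squares_bound[of "a\<^sup>2" "b\<^sup>2"]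
    by (simp add: power2_eq_square power4_eq_xxxx algebra_simps)
  have i4: "integrable M (\<lambda>\<omega>. 3 * (1 + (X t \<omega> ^ 4 + X s \<omega> ^ 4)))"
    using X_fourth_moment st by simp
  have iw: "integrable M (\<lambda>\<omega>. (1 + (X t \<omega>)\<^sup>2 + (X s \<omega>)\<^sup>2)\<^sup>2)"
    by (rule Bochner_Integration.integrable_bound[OF i4]) (use sq in \<open>auto intro!: AE_I2 order_trans[OF sq abs_ge_self]\<close>)
  have "expectation (\<lambda>\<omega>. (1 + (X t \<omega>)\<^sup>2 + (X s \<omega>)\<^sup>2)\<^sup>2) \<le> expectation (\<lambda>\<omega>. 3 * (1 + (X t \<omega> ^ 4 + X s \<omega> ^ 4)))"
    by (intro integral_mono iw i4 sq)
  also have "\<dots> = 3 * (1 + (expectation (\<lambda>\<omega>. X t \<omega> ^ 4) + expectation (\<lambda>\<omega>. X s \<omega> ^ 4)))"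
    using X_fourth_moment st by (simp add: prob_space)
  also have "\<dots> \<le> 3 * (1 + 16 * ((\<bar>x0\<bar> + K) ^ 4 + 3))"
  proof -
    have "3 * (1 + (u + v)) \<le> 3 * (1 + 16 * (q + 3))" if "u \<le> 8 * (q + 3)" "v \<le> 8 * (q + 3)" for u v q :: real
      using that by simp
    then show ?thesis using X_fourth_moment(2)[OF st(2)] X_fourth_moment(2)[OF st(1)] .
  qed
  finally have ew: "expectation (\<lambda>\<omega>. (1 + (X t \<omega>)\<^sup>2 + (X s \<omega>)\<^sup>2)\<^sup>2) \<le> 3 * (1 + 16 * ((\<bar>x0\<bar> + K) ^ 4 + 3))" .
  have sqr: "integrable M (\<lambda>\<omega>. \<bar>X t \<omega> - X s \<omega>\<bar>\<^sup>2)" using X_increment_second_moment(1)[OF st] by simp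
  have mw: "(\<lambda>\<omega>. 1 + (X t \<omega>)\<^sup>2 + (X s \<omega>)\<^sup>2) \<in> borel_measurable M" "(\<lambda>\<omega>. \<bar>X t \<omega> - X s \<omega>\<bar>) \<in> borel_measurable M" by measurable
  note cs = cauchy_schwarz_expectation[OF mw(2,1) sqr iw]
  show "integrable M (\<lambda>\<omega>. \<bar>X t \<omega> - X s \<omega>\<bar> * (1 + (X t \<omega>)\<^sup>2 + (X s \<omega>)\<^sup>2))" by (rule cs(1))
  have nn: "\<bar>\<bar>u\<bar> * (1 + a\<^sup>2 + b\<^sup>2)\<bar> = \<bar>u\<bar> * (1 + a\<^sup>2 + b\<^sup>2)" for u a b :: real
    by (simp add: abs_mult abs_of_nonneg)
  have "expectation (\<lambda>\<omega>. \<bar>X t \<omega> - X s \<omega>\<bar> * (1 + (X t \<omega>)\<^sup>2 + (X s \<omega>)\<^sup>2))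
     \<le> sqrt (expectation (\<lambda>\<omega>. \<bar>X t \<omega> - X s \<omega>\<bar>\<^sup>2)) * sqrt (expectation (\<lambda>\<omega>. (1 + (X t \<omega>)\<^sup>2 + (X s \<omega>)\<^sup>2)\<^sup>2))"
    using cs(2) by (simp only: nn)
  also have "\<dots> \<le> sqrt (2 * (K\<^sup>2 + 1) * \<bar>t - s\<bar> powr (2 * H)) * sqrt (3 * (1 + 16 * ((\<bar>x0\<bar> + K) ^ 4 + 3)))"
    using X_increment_second_moment(2)[OF st] ew by (intro mult_mono real_sqrt_le_mono) auto
  also have "\<dots> = CQ * sqrt (\<bar>t - s\<bar> powr (2 * H))"
    by (simp add: CQ_def real_sqrt_mult mult_ac)
  also have "sqrt (\<bar>t - s\<bar> powr (2 * H)) = \<bar>t - s\<bar> powr H"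
    by (rule real_sqrt_unique) (simp_all add: power2_eq_square flip: powr_add)
  finally show "expectation (\<lambda>\<omega>. \<bar>X t \<omega> - X s \<omega>\<bar> * (1 + (X t \<omega>)\<^sup>2 + (X s \<omega>)\<^sup>2)) \<le> CQ * \<bar>t - s\<bar> powr H" .
qed

end

section \<open>The bound for the cross term\<close>

lemma ex_dyadic_between: "1 \<le> n \<Longrightarrow> \<exists>r. n \<le> 2 ^ r \<and> 2 ^ r \<le> 2 * n" for n :: nat
proof (induction n rule: nat_induct_at_least)
  case (Suc n)
  then obtain r where r: "n \<le> 2 ^ r" "2 ^ r \<le> 2 * n" by blast
  show ?case
  proof (cases "Suc n \<le> 2 ^ r")
    case True
    then show ?thesis using r by (intro exI[of _ r]) simp
  next
    case False
    then show ?thesis using r Suc.hyps by (intro exI[of _ "Suc r"]) simp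
  qed
qed (rule exI[of _ 0], simp)

lemma toeplitz_block_sum_le:
  fixes h :: "nat \<Rightarrow> real"
  assumes h: "\<And>d. 0 \<le> h d"
  shows "(\<Sum>j\<in>{i..<i + L}. \<Sum>k\<in>{i..<i + L}. h (nat_dist j k)) \<le> real L * (2 * (\<Sum>d<L. h d))"
proof -
  have "(\<Sum>k\<in>{i..<i + L}. h (nat_dist j k)) \<le> 2 * (\<Sum>d<L. h d)" if j: "j \<in> {i..<i + L}" for j
  proof -
    have "(\<Sum>k\<in>{i..<i + L}. h (nat_dist j k)) = (\<Sum>k=1..L. h (nat_dist (j + 1 - i) k))"
      by (rule sum.reindex_bij_witness[of _ "\<lambda>k. k + i - 1" "\<lambda>k. k + 1 - i"]) (use j in \<open>auto simp: nat_dist_def\<close>)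
    also have "\<dots> \<le> 2 * (\<Sum>d<L. h d)"
      by (rule toeplitz_row_sum_le) (use j h in auto)
    finally show ?thesis .
  qed
  then have "(\<Sum>j\<in>{i..<i + L}. \<Sum>k\<in>{i..<i + L}. h (nat_dist j k)) \<le> (\<Sum>j\<in>{i..<i + L}. 2 * (\<Sum>d<L. h d))"
    by (rule sum_mono)
  then show ?thesis by simp
qed

text \<open>With deterministic weights the second moment of the sum is a quadratic form in the
  covariances, so the first moment follows without any Sobolev estimate.\<close>

lemma (in prob_space) expectation_abs_combination_le:
  fixes D :: "'j \<Rightarrow> 'a \<Rightarrow> real"
  assumes A: "finite A" and D: "\<And>j. j \<in> A \<Longrightarrow> D j \<in> borel_measurable M" "\<And>j. j \<in> A \<Longrightarrow> integrable M (\<lambda>x. (D j x)\<^sup>2)"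
    and c: "\<And>j. j \<in> A \<Longrightarrow> \<bar>c j\<bar> \<le> C"
  shows "integrable M (\<lambda>x. \<Sum>j\<in>A. D j x * c j)"
    and "expectation (\<lambda>x. \<bar>\<Sum>j\<in>A. D j x * c j\<bar>) \<le> \<bar>C\<bar> * sqrt (\<Sum>j\<in>A. \<Sum>k\<in>A. \<bar>expectation (\<lambda>x. D j x * D k x)\<bar>)"
proof -
  have [measurable]: "(\<lambda>x. D j x) \<in> borel_measurable M" if "j \<in> A" for j using D that by simp
  have m: "(\<lambda>x. \<Sum>j\<in>A. D j x * c j) \<in> borel_measurable M" by measurable
  have iD: "integrable M (\<lambda>x. D j x * D k x)" if "j \<in> A" "k \<in> A" for j k
    using that D by (intro cauchy_schwarz_expectation) auto
  have sq: "(\<Sum>j\<in>A. D j x * c j)\<^sup>2 = (\<Sum>j\<in>A. \<Sum>k\<in>A. c j * c k * (D j x * D k x))" for x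
    unfolding power2_eq_square sum_product by (simp add: mult_ac)
  have i2: "integrable M (\<lambda>x. (\<Sum>j\<in>A. D j x * c j)\<^sup>2)"
    unfolding sq by (intro Bochner_Integration.integrable_sum integrable_mult_right iD)
  show "integrable M (\<lambda>x. \<Sum>j\<in>A. D j x * c j)" by (rule integrable_of_square[OF m i2])
  have "expectation (\<lambda>x. (\<Sum>j\<in>A. D j x * c j)\<^sup>2) = (\<Sum>j\<in>A. \<Sum>k\<in>A. c j * c k * expectation (\<lambda>x. D j x * D k x))"
    unfolding sq by (simp add: iD Bochner_Integration.integral_sum Bochner_Integration.integrable_sum)
  also have "\<dots> \<le> (\<Sum>j\<in>A. \<Sum>k\<in>A. C\<^sup>2 * \<bar>expectation (\<lambda>x. D j x * D k x)\<bar>)"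
  proof (intro sum_mono)
    fix j k assume jk: "j \<in> A" "k \<in> A"
    have "\<bar>c j * c k\<bar> \<le> C\<^sup>2"
      unfolding abs_mult power2_eq_square using c[OF jk(1)] c[OF jk(2)] order_trans[OF abs_ge_zero c[OF jk(1)]]
      by (intro mult_mono) auto
    then have "\<bar>c j * c k * expectation (\<lambda>x. D j x * D k x)\<bar> \<le> C\<^sup>2 * \<bar>expectation (\<lambda>x. D j x * D k x)\<bar>"
      unfolding abs_mult[of "c j * c k"] by (rule mult_right_mono) simp
    then show "c j * c k * expectation (\<lambda>x. D j x * D k x) \<le> C\<^sup>2 * \<bar>expectation (\<lambda>x. D j x * D k x)\<bar>" by linarith
  qed
  also have "\<dots> = C\<^sup>2 * (\<Sum>j\<in>A. \<Sum>k\<in>A. \<bar>expectation (\<lambda>x. D j x * D k x)\<bar>)"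
    by (simp add: sum_distrib_left)
  finally have "sqrt (expectation (\<lambda>x. (\<Sum>j\<in>A. D j x * c j)\<^sup>2)) \<le> sqrt (C\<^sup>2 * (\<Sum>j\<in>A. \<Sum>k\<in>A. \<bar>expectation (\<lambda>x. D j x * D k x)\<bar>))"
    by (rule real_sqrt_le_mono)
  also have "\<dots> = \<bar>C\<bar> * sqrt (\<Sum>j\<in>A. \<Sum>k\<in>A. \<bar>expectation (\<lambda>x. D j x * D k x)\<bar>)"
    by (simp add: real_sqrt_mult)
  finally show "expectation (\<lambda>x. \<bar>\<Sum>j\<in>A. D j x * c j\<bar>) \<le> \<bar>C\<bar> * sqrt (\<Sum>j\<in>A. \<Sum>k\<in>A. \<bar>expectation (\<lambda>x. D j x * D k x)\<bar>)"
    using expectation_abs_le_sqrt[OF m i2] by linarith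
qed

context sde_fbm
begin

text \<open>The random argument is removed in two stages: it is frozen at the first point by
  chaining (\<open>R\<close>, with a logarithm for the number of levels) and then replaced by 0
  (\<open>W\<close>); what remains (\<open>W0\<close>) has deterministic weights. Over a block of
  length \<open>L\<close> the covariances sum to order
  \<open>\<Delta> powr (2 * H) * L powr (2 - s)\<close> and the weighted increments have order
  \<open>(L * \<Delta>) powr H\<close>. The square root of the product has the exponents
  \<open>3 * H / 2\<close> and \<open>(2 - s + H) / 2\<close>; \<open>\<kappa>\<close> is the
  latter, raised to 1 where chaining demands it.\<close>

lemma weighted_sum_bound:
  assumes "clt_filter H p m a"
  defines "\<kappa> \<equiv> max 1 ((2 - decay_exponent H m + H) / 2)"
  shows "\<exists>C\<ge>0. \<forall>n \<Delta> u. p < n \<and> 0 < \<Delta> \<and> real n * \<Delta> \<le> 1 \<and> 0 \<le> u \<and> u \<le> real p * \<Delta> \<longrightarrow>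
    expectation (\<lambda>\<omega>. \<bar>\<Sum>j=1..n - p. filter_increment p a \<Delta> B j \<omega> * f (real j * \<Delta> + u) (X (real j * \<Delta> + u) \<omega>)\<bar>)
    \<le> C * (\<Delta> powr (3 * H / 2) * log 2 (2 * real n) * (2 * real n) powr \<kappa>
        + \<Delta> powr H * (2 * real n) powr (1 - decay_exponent H m / 2))"
proof -
  interpret clt_filter H p m a by fact
  obtain C where C: "C > 0" "\<And>d. \<bar>\<rho> d\<bar> \<le> C * (real d + 1) powr (- s)"
    using correlation_decay by blast
  define cP where "cP = 2 * C / (1 - s)"
  have cP: "cP > 0" using C s by (simp add: cP_def)
  \<comment> \<open>Comes from \<open>\<bar>b\<bar> * (1 + b^2) <= 2 + 2 * b^4\<close> and the bound
    for the fourth moment of the solution.\<close>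
  define Q0 where "Q0 = 2 + 16 * ((\<bar>x0\<bar> + K) ^ 4 + 3)"
  have "0 \<le> (\<bar>x0\<bar> + K) ^ 4" using K(1) by (intro zero_le_power) auto
  then have Q0: "Q0 > 0" unfolding Q0_def by (intro add_pos_nonneg mult_nonneg_nonneg add_nonneg_nonneg) auto
  define C1 where "C1 = K * sqrt (pi * (cP * \<gamma> * CQ))"
  define C2 where "C2 = K * (sqrt (pi * Q0) + 1) * sqrt (cP * \<gamma>)"
  have C12: "0 \<le> C1" "0 \<le> C2" using K(1) cP \<gamma>_pos CQ_pos Q0 by (simp_all add: C1_def C2_def)
  have \<kappa>: "1 \<le> \<kappa>" "(2 - s + H) / 2 \<le> \<kappa>" by (simp_all add: \<kappa>_def)
  have main: "expectation (\<lambda>\<omega>. \<bar>\<Sum>j=1..n - p. filter_increment p a \<Delta> B j \<omega> * f (real j * \<Delta> + u) (X (real j * \<Delta> + u) \<omega>)\<bar>)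
    \<le> (C1 + C2) * (\<Delta> powr (3 * H / 2) * log 2 (2 * real n) * (2 * real n) powr \<kappa>
        + \<Delta> powr H * (2 * real n) powr (1 - s / 2))"
    if n: "p < n" and \<Delta>: "0 < \<Delta>" "real n * \<Delta> \<le> 1" and u: "0 \<le> u" "u \<le> real p * \<Delta>" for n \<Delta> u
  proof -
    have sqr: "(x powr e)\<^sup>2 = x powr (2 * e)" for x e :: real
      by (simp add: power2_eq_square flip: powr_add)
    define N where "N = n - p"
    have N: "real N + real p = real n" using n by (simp add: N_def of_nat_diff)
    \<comment> \<open>Chaining works with sequences over all indices. Outside \<open>1..N\<close>
      the increments are set to 0, and beyond \<open>N\<close> the times \<open>\<tau> j\<close>
      stop; this keeps all times in the unit interval and adds nothing to the sum.\<close>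
    define D where "D j = (if j \<in> {1..N} then filter_increment p a \<Delta> B j else (\<lambda>_. 0))" for j
    define \<tau> where "\<tau> j = real (min j N) * \<Delta> + u" for j
    have \<tau>: "\<tau> j \<in> {0..1}" for j
    proof -
      have "real (min j N) * \<Delta> + u \<le> real N * \<Delta> + real p * \<Delta>"
        using \<Delta> u by (intro add_mono mult_right_mono) auto
      also have "\<dots> \<le> 1" using \<Delta>(2) N by (simp flip: distrib_right)
      finally show ?thesis using \<Delta> u by (simp add: \<tau>_def)
    qed
    define U where "U j = X (\<tau> j)" for j
    define \<sigma> where "\<sigma> = \<Delta> powr (2 * H) * \<gamma>"
    have \<sigma>: "\<sigma> > 0" using \<Delta> \<gamma>_pos by (simp add: \<sigma>_def)
    have jp: "real (j + p) * \<Delta> \<le> 1" if "j \<in> {1..N}" for j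
    proof -
      have "real (j + p) * \<Delta> \<le> real n * \<Delta>" using that n \<Delta> by (intro mult_right_mono) (auto simp: N_def)
      then show ?thesis using \<Delta>(2) by (rule order_trans)
    qed
    have \<Delta>0: "0 \<le> \<Delta>" using \<Delta> by simp
    have D: "D j \<in> borel_measurable M" "integrable M (\<lambda>x. (D j x)\<^sup>2)" for j
      using increments(1,2)[OF a \<Delta>0 jp jp, of j j] by (simp_all add: D_def)
    have covD: "\<bar>expectation (\<lambda>x. D j x * D k x)\<bar> \<le> \<sigma> * \<bar>\<rho> (nat_dist j k)\<bar>" for j k
    proof (cases "j \<in> {1..N} \<and> k \<in> {1..N}")
      case True
      then have "expectation (\<lambda>x. D j x * D k x) = \<Delta> powr (2 * H) * filter_cov H p a (real j - real k)"
        using increments(4)[OF a \<Delta>0 jp jp, of j k] by (simp add: D_def)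
      also have "\<dots> = \<sigma> * \<rho> (nat_dist j k)"
        using \<gamma>_pos by (simp add: \<sigma>_def correlation_def filter_cov_nat_dist)
      finally show ?thesis using \<sigma> by (simp add: abs_mult)
    next
      case False
      then show ?thesis using \<sigma> by (auto simp: D_def)
    qed
    define P where "P r = \<sigma> * (cP * (2 ^ r) powr (2 - s))" for r :: nat
    have P_pos: "P r > 0" for r using \<sigma> cP by (simp add: P_def)
    have P: "(\<Sum>j\<in>{i..<i + 2 ^ r}. \<Sum>k\<in>{i..<i + 2 ^ r}. \<bar>expectation (\<lambda>x. D j x * D k x)\<bar>) \<le> P r" for r i
    proof -
      let ?L = "2 ^ r :: nat"
      have "(\<Sum>j\<in>{i..<i + ?L}. \<Sum>k\<in>{i..<i + ?L}. \<bar>expectation (\<lambda>x. D j x * D k x)\<bar>)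
          \<le> (\<Sum>j\<in>{i..<i + ?L}. \<Sum>k\<in>{i..<i + ?L}. \<sigma> * \<bar>\<rho> (nat_dist j k)\<bar>)"
        by (intro sum_mono covD)
      also have "\<dots> = \<sigma> * (\<Sum>j\<in>{i..<i + ?L}. \<Sum>k\<in>{i..<i + ?L}. \<bar>\<rho> (nat_dist j k)\<bar>)"
        by (simp add: sum_distrib_left)
      also have "\<dots> \<le> \<sigma> * (real ?L * (2 * (\<Sum>d<?L. \<bar>\<rho> d\<bar>)))"
        using \<sigma> by (intro mult_left_mono toeplitz_block_sum_le) auto
      also have "\<dots> \<le> \<sigma> * (real ?L * (2 * (C * (real ?L powr (1 - s) / (1 - s)))))"
      proof -
        have "(\<Sum>d<?L. \<bar>\<rho> d\<bar>) \<le> C * (\<Sum>d<?L. (real d + 1) powr (- s))"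
          unfolding sum_distrib_left by (intro sum_mono C(2))
        also have "\<dots> \<le> C * (real ?L powr (1 - s) / (1 - s))"
          using s C(1) by (intro mult_left_mono sum_powr_le) auto
        finally show ?thesis using \<sigma> by (intro mult_left_mono) auto
      qed
      also have "real ?L * (2 * (C * (real ?L powr (1 - s) / (1 - s)))) = cP * (real ?L powr 1 * real ?L powr (1 - s))"
        by (simp add: cP_def)
      also have "real ?L powr 1 * real ?L powr (1 - s) = (2 ^ r) powr (2 - s)"
        unfolding powr_add[symmetric] by simp
      finally show ?thesis by (simp add: P_def)
    qed
    define Q where "Q r = CQ * (2 ^ r * \<Delta>) powr H" for r :: nat
    have Q_pos: "Q r > 0" for r using CQ_pos \<Delta> by (simp add: Q_def)
    have Q: "expectation (\<lambda>x. \<bar>U (i + 2 ^ r) x - U i x\<bar> * (1 + (U (i + 2 ^ r) x)\<^sup>2 + (U i x)\<^sup>2)) \<le> Q r" for r i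
    proof -
      have "expectation (\<lambda>x. \<bar>U (i + 2 ^ r) x - U i x\<bar> * (1 + (U (i + 2 ^ r) x)\<^sup>2 + (U i x)\<^sup>2)) \<le> CQ * \<bar>\<tau> (i + 2 ^ r) - \<tau> i\<bar> powr H"
        unfolding U_def by (rule X_weighted_increment(2)[OF \<tau> \<tau>])
      also have "\<dots> \<le> Q r"
      proof -
        have "\<tau> (i + 2 ^ r) - \<tau> i = (real (min (i + 2 ^ r) N) - real (min i N)) * \<Delta>"
          by (simp add: \<tau>_def left_diff_distrib)
        moreover have "\<bar>real (min (i + 2 ^ r) N) - real (min i N)\<bar> \<le> 2 ^ r"
        proof -
          have "min i N \<le> min (i + 2 ^ r) N" "min (i + 2 ^ r) N \<le> min i N + 2 ^ r" by auto
          then have "real (min i N) \<le> real (min (i + 2 ^ r) N)" "real (min (i + 2 ^ r) N) \<le> real (min i N + 2 ^ r)"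
            by (simp_all only: of_nat_le_iff)
          then show ?thesis by simp
        qed
        ultimately have "\<bar>\<tau> (i + 2 ^ r) - \<tau> i\<bar> \<le> 2 ^ r * \<Delta>"
          using \<Delta> by (simp add: abs_mult mult_right_mono)
        then show ?thesis unfolding Q_def using H_range CQ_pos by (intro mult_left_mono powr_mono2) auto
      qed
      finally show ?thesis .
    qed
    have \<beta>: "K * sqrt (pi * (P r * Q r)) \<le> (C1 * \<Delta> powr (3 * H / 2)) * (2 ^ r) powr \<kappa>" for r
    proof -
      have "\<Delta> powr (2 * H) * (2 ^ r * \<Delta>) powr H * (2 ^ r) powr (2 - s)
          = (\<Delta> powr (2 * H) * \<Delta> powr H) * ((2 ^ r) powr (2 - s) * (2 ^ r) powr H)"
        using \<Delta> by (simp add: powr_mult mult_ac)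
      also have "\<dots> = (\<Delta> powr (3 * H / 2) * (2 ^ r) powr ((2 - s + H) / 2))\<^sup>2"
        unfolding power_mult_distrib sqr powr_add[symmetric]
        by (intro arg_cong2[where f = "(*)"] arg_cong2[where f = "(powr)"]) (simp_all add: field_simps)
      finally have e: "\<Delta> powr (2 * H) * (2 ^ r * \<Delta>) powr H * (2 ^ r) powr (2 - s)
          = (\<Delta> powr (3 * H / 2) * (2 ^ r) powr ((2 - s + H) / 2))\<^sup>2" .
      have "pi * (P r * Q r) = pi * (cP * \<gamma> * CQ) * (\<Delta> powr (2 * H) * (2 ^ r * \<Delta>) powr H * (2 ^ r) powr (2 - s))"
        by (simp add: P_def Q_def \<sigma>_def mult_ac)
      then have "K * sqrt (pi * (P r * Q r)) = C1 * (\<Delta> powr (3 * H / 2) * (2 ^ r) powr ((2 - s + H) / 2))"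
        unfolding e C1_def by (simp only: real_sqrt_mult real_sqrt_abs) simp
      also have "\<dots> \<le> C1 * (\<Delta> powr (3 * H / 2) * (2 ^ r) powr \<kappa>)"
        using C12 \<kappa> by (intro mult_left_mono powr_mono) auto
      finally show ?thesis by (simp add: mult.assoc)
    qed
    \<comment> \<open>A single block of this length contains all indices of the sum, and the upper
      bound lets \<open>2 * n\<close> replace the block length.\<close>
    obtain r where r: "n \<le> 2 ^ r" "2 ^ r \<le> 2 * n" using ex_dyadic_between[of n] n by auto
    define L where "L = (2 ^ r :: real)"
    have L: "0 < L" "L \<le> 2 * real n"
      using r(2) by (simp_all add: L_def) (metis of_nat_le_iff of_nat_mult of_nat_numeral of_nat_power)
    have r_log: "real r \<le> log 2 (2 * real n)"
    proof -
      have "real r = log 2 L" by (simp add: L_def)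
      also have "\<dots> \<le> log 2 (2 * real n)" using L by (intro log_mono) auto
      finally show ?thesis .
    qed
    have U_meas: "U j \<in> borel_measurable M" for j unfolding U_def using \<tau> by (rule measurable_X)
    have iU: "integrable M (\<lambda>x. \<bar>U j x - U k x\<bar> * (1 + (U j x)\<^sup>2 + (U k x)\<^sup>2))" for j k
      unfolding U_def by (rule X_weighted_increment(1)[OF \<tau> \<tau>])
    define A where "A = {1..<1 + 2 ^ r :: nat}"
    define R where "R x = (\<Sum>j\<in>A. D j x * (f (\<tau> j) (U j x) - f (\<tau> j) (U 1 x)))" for x
    define W where "W x = (\<Sum>j\<in>A. D j x * f (\<tau> j) (U 1 x)) - (\<Sum>j\<in>A. D j x * f (\<tau> j) 0)" for x
    define W0 where "W0 x = (\<Sum>j\<in>A. D j x * f (\<tau> j) 0)" for x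
    have chain: "integrable M R \<and> expectation (\<lambda>x. \<bar>R x\<bar>) \<le> (C1 * \<Delta> powr (3 * H / 2)) * real r * (2 ^ r) powr \<kappa>"
      unfolding R_def[abs_def] A_def
      by (rule dyadic_chaining[where g' = "\<lambda>j. deriv (f (\<tau> j))" and K = K and P = P and Q = Q])
         (use f_deriv[OF \<tau>] K(1) K(3)[OF \<tau>] D U_meas iU P P_pos Q Q_pos \<beta> \<kappa>(1) in auto)
    have Q0_int: "integrable M (\<lambda>x. \<bar>U 1 x - 0\<bar> * (1 + (U 1 x)\<^sup>2 + 0\<^sup>2))"
      and Q0_le: "expectation (\<lambda>x. \<bar>U 1 x - 0\<bar> * (1 + (U 1 x)\<^sup>2 + 0\<^sup>2)) \<le> Q0"
    proof -
      have ineq: "\<bar>b - 0\<bar> * (1 + b\<^sup>2 + 0\<^sup>2) \<le> 2 + 2 * b ^ 4" for b :: real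
      proof -
        have 1: "\<bar>b\<bar> * 1 \<le> 1 + b ^ 4"
        proof -
          have "2 * \<bar>b\<bar> \<le> 1 + b\<^sup>2" using sum_squares_bound[of 1 "\<bar>b\<bar>"] by simp
          moreover have "2 * b\<^sup>2 \<le> 1 + b ^ 4" using sum_squares_bound[of 1 "b\<^sup>2"] by simp
          moreover have "0 \<le> b ^ 4" by simp
          ultimately show ?thesis by linarith
        qed
        have 2: "\<bar>b\<bar> * b\<^sup>2 \<le> 1 + b ^ 4"
        proof -
          have "2 * (\<bar>b\<bar> * b\<^sup>2) \<le> b\<^sup>2 + b ^ 4"
            using sum_squares_bound[of "\<bar>b\<bar>" "b\<^sup>2"] by (simp add: mult.assoc)
          moreover have "2 * b\<^sup>2 \<le> 1 + b ^ 4" using sum_squares_bound[of 1 "b\<^sup>2"] by simp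
          moreover have "0 \<le> b ^ 4" by simp
          ultimately show ?thesis by linarith
        qed
        show ?thesis using 1 2 by (simp add: distrib_left)
      qed
      have i4: "integrable M (\<lambda>x. 2 + 2 * U 1 x ^ 4)"
        unfolding U_def using X_fourth_moment(1)[OF \<tau>] by simp
      have [measurable]: "U j \<in> borel_measurable M" for j by (rule U_meas)
      show int: "integrable M (\<lambda>x. \<bar>U 1 x - 0\<bar> * (1 + (U 1 x)\<^sup>2 + 0\<^sup>2))"
        by (rule Bochner_Integration.integrable_bound[OF i4])
           (use ineq in \<open>auto simp: abs_mult abs_of_nonneg intro!: AE_I2 order_trans[OF ineq[simplified] abs_ge_self]\<close>)
      have "expectation (\<lambda>x. \<bar>U 1 x - 0\<bar> * (1 + (U 1 x)\<^sup>2 + 0\<^sup>2)) \<le> expectation (\<lambda>x. 2 + 2 * U 1 x ^ 4)"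
        by (intro integral_mono int i4 ineq)
      also have "\<dots> = 2 + 2 * expectation (\<lambda>x. U 1 x ^ 4)"
        unfolding U_def using X_fourth_moment(1)[OF \<tau>] by (simp add: prob_space)
      also have "\<dots> \<le> Q0"
        unfolding U_def Q0_def using X_fourth_moment(2)[OF \<tau>, of 1] by simp
      finally show "expectation (\<lambda>x. \<bar>U 1 x - 0\<bar> * (1 + (U 1 x)\<^sup>2 + 0\<^sup>2)) \<le> Q0" .
    qed
    have PA: "(\<Sum>j\<in>A. \<Sum>k\<in>A. \<bar>expectation (\<lambda>x. D j x * D k x)\<bar>) \<le> P r" unfolding A_def by (rule P)
    have finA: "finite A" by (simp add: A_def)
    have "integrable M W \<and> expectation (\<lambda>x. \<bar>W x\<bar>) \<le> K * sqrt (pi * (P r * Q0))"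
      unfolding W_def[abs_def]
      by (intro conjI expected_increment_bound[where A = A and D = D and K = K and P = "P r" and Q = Q0 and U = "U 1" and V = "\<lambda>_. 0"
            and g = "\<lambda>j. f (\<tau> j)" and g' = "\<lambda>j. deriv (f (\<tau> j))"])
         (use f_deriv[OF \<tau>] K(1) K(3)[OF \<tau>] D U_meas PA P_pos Q0 Q0_int Q0_le finA in auto)
    then have W: "integrable M W" "expectation (\<lambda>x. \<bar>W x\<bar>) \<le> K * sqrt (pi * (P r * Q0))" by auto
    have "integrable M W0 \<and> expectation (\<lambda>x. \<bar>W0 x\<bar>) \<le> \<bar>K\<bar> * sqrt (\<Sum>j\<in>A. \<Sum>k\<in>A. \<bar>expectation (\<lambda>x. D j x * D k x)\<bar>)"
      unfolding W0_def[abs_def] by (intro conjI expectation_abs_combination_le[OF finA D]) (rule K(2)[OF \<tau>])+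
    moreover have "\<bar>K\<bar> * sqrt (\<Sum>j\<in>A. \<Sum>k\<in>A. \<bar>expectation (\<lambda>x. D j x * D k x)\<bar>) \<le> K * sqrt (P r)"
      using PA K(1) by (simp add: mult_left_mono)
    ultimately have W0: "integrable M W0" "expectation (\<lambda>x. \<bar>W0 x\<bar>) \<le> K * sqrt (P r)" by auto
    have sqrtP: "sqrt (P r) \<le> sqrt (cP * \<gamma>) * (\<Delta> powr H * (2 * real n) powr (1 - s / 2))"
    proof -
      have "\<Delta> powr (2 * H) * L powr (2 - s) = (\<Delta> powr H * L powr (1 - s / 2))\<^sup>2"
        unfolding power_mult_distrib sqr by (simp add: right_diff_distrib)
      moreover have "P r = cP * \<gamma> * (\<Delta> powr (2 * H) * L powr (2 - s))"
        by (simp add: P_def \<sigma>_def L_def mult_ac)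
      ultimately have "P r = cP * \<gamma> * (\<Delta> powr H * L powr (1 - s / 2))\<^sup>2" by simp
      then have "sqrt (P r) = sqrt (cP * \<gamma>) * (\<Delta> powr H * L powr (1 - s / 2))"
        by (simp only: real_sqrt_mult real_sqrt_abs) simp
      also have "\<dots> \<le> sqrt (cP * \<gamma>) * (\<Delta> powr H * (2 * real n) powr (1 - s / 2))"
        using L s cP \<gamma>_pos by (intro mult_left_mono powr_mono2) auto
      finally show ?thesis .
    qed
    have decomp: "(\<Sum>j=1..n - p. filter_increment p a \<Delta> B j x * f (real j * \<Delta> + u) (X (real j * \<Delta> + u) x)) = R x + W x + W0 x" for x
    proof -
      have "R x + W x + W0 x = (\<Sum>j\<in>A. D j x * f (\<tau> j) (U j x))"
        unfolding R_def W_def W0_def by (simp add: right_diff_distrib sum_subtractf)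
      also have "\<dots> = (\<Sum>j=1..N. D j x * f (\<tau> j) (U j x))"
        using r(1) by (intro sum.mono_neutral_right) (auto simp: A_def D_def N_def)
      also have "\<dots> = (\<Sum>j=1..n - p. filter_increment p a \<Delta> B j x * f (real j * \<Delta> + u) (X (real j * \<Delta> + u) x))"
        unfolding N_def[symmetric] by (intro sum.cong refl) (simp add: D_def U_def \<tau>_def)
      finally show ?thesis by simp
    qed
    have "expectation (\<lambda>x. \<bar>R x + W x + W0 x\<bar>) \<le> expectation (\<lambda>x. \<bar>R x\<bar> + \<bar>W x\<bar> + \<bar>W0 x\<bar>)"
      using chain W(1) W0(1) by (intro integral_mono) auto
    also have "\<dots> = expectation (\<lambda>x. \<bar>R x\<bar>) + expectation (\<lambda>x. \<bar>W x\<bar>) + expectation (\<lambda>x. \<bar>W0 x\<bar>)"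
      using chain W(1) W0(1) by simp
    also have "\<dots> \<le> C1 * \<Delta> powr (3 * H / 2) * real r * L powr \<kappa> + (K * sqrt (pi * (P r * Q0)) + K * sqrt (P r))"
      using chain W(2) W0(2) by (simp add: L_def)
    also have "K * sqrt (pi * (P r * Q0)) + K * sqrt (P r) = K * (sqrt (pi * Q0) + 1) * sqrt (P r)"
      by (simp add: real_sqrt_mult algebra_simps)
    also have "K * (sqrt (pi * Q0) + 1) * sqrt (P r) \<le> K * (sqrt (pi * Q0) + 1) * (sqrt (cP * \<gamma>) * (\<Delta> powr H * (2 * real n) powr (1 - s / 2)))"
      using K(1) Q0 by (intro mult_left_mono sqrtP) auto
    also have "\<dots> = C2 * (\<Delta> powr H * (2 * real n) powr (1 - s / 2))" by (simp add: C2_def mult.assoc)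
    also have "C1 * \<Delta> powr (3 * H / 2) * real r * L powr \<kappa> \<le> C1 * \<Delta> powr (3 * H / 2) * log 2 (2 * real n) * (2 * real n) powr \<kappa>"
    proof (rule mult_mono)
      show "C1 * \<Delta> powr (3 * H / 2) * real r \<le> C1 * \<Delta> powr (3 * H / 2) * log 2 (2 * real n)"
        using C12 by (intro mult_left_mono r_log) auto
      show "L powr \<kappa> \<le> (2 * real n) powr \<kappa>" using L \<kappa>(1) by (intro powr_mono2) auto
      have "0 \<le> log 2 (2 * real n)" using r_log by (rule order_trans[rotated]) simp
      then show "0 \<le> C1 * \<Delta> powr (3 * H / 2) * log 2 (2 * real n)" using C12 by simp
    qed simp
    finally have "expectation (\<lambda>x. \<bar>R x + W x + W0 x\<bar>) \<le> C1 * (\<Delta> powr (3 * H / 2) * log 2 (2 * real n) * (2 * real n) powr \<kappa>)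
        + C2 * (\<Delta> powr H * (2 * real n) powr (1 - s / 2))" by (simp add: mult.assoc)
    also have "\<dots> \<le> (C1 + C2) * (\<Delta> powr (3 * H / 2) * log 2 (2 * real n) * (2 * real n) powr \<kappa>)
        + (C1 + C2) * (\<Delta> powr H * (2 * real n) powr (1 - s / 2))"
      using C12 n by (intro add_mono mult_right_mono mult_nonneg_nonneg zero_le_log_cancel_iff[THEN iffD2]) auto
    finally show ?thesis unfolding decomp by (simp add: distrib_left)
  qed
  show ?thesis
    by (rule exI[of _ "C1 + C2"]) (use C12 main in auto)
qed

end

section \<open>Comparison of the quadratic variations of the solution and of the noise\<close>

lemma (in prob_space) norm_iexp_expectation_diff_le:
  fixes Y Z :: "'a \<Rightarrow> real"
  assumes [measurable]: "Y \<in> borel_measurable M" "Z \<in> borel_measurable M" and d: "integrable M (\<lambda>x. Y x - Z x)"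
  shows "norm ((CLINT x|M. iexp (t * Y x)) - (CLINT x|M. iexp (t * Z x))) \<le> \<bar>t\<bar> * expectation (\<lambda>x. \<bar>Y x - Z x\<bar>)"
proof -
  have i: "integrable M (\<lambda>x. iexp (t * V x))" if [measurable]: "V \<in> borel_measurable M" for V
    by (rule integrable_bounded_complex[OF prob_space_axioms, of _ 1]) auto
  have pt: "norm (iexp (t * y) - iexp (t * z)) \<le> \<bar>t\<bar> * \<bar>y - z\<bar>" for y z
  proof -
    have "iexp (t * y) = iexp (t * z) * iexp (t * (y - z))"
      unfolding exp_add[symmetric] by (simp add: algebra_simps)
    then have "norm (iexp (t * y) - iexp (t * z)) = norm (iexp (t * z) * (iexp (t * (y - z)) - 1))"
      by (simp add: right_diff_distrib)
    also have "\<dots> = norm (iexp (t * (y - z)) - 1)" by (rule norm_iexp_times)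
    also have "\<dots> \<le> \<bar>t * (y - z)\<bar>" using iexp_approx1[of "t * (y - z)" 0] by simp
    finally show ?thesis by (simp add: abs_mult)
  qed
  have "(CLINT x|M. iexp (t * Y x)) - (CLINT x|M. iexp (t * Z x)) = (CLINT x|M. iexp (t * Y x) - iexp (t * Z x))"
    by (rule Bochner_Integration.integral_diff[symmetric]) (rule i, simp)+
  also have "norm \<dots> \<le> (LINT x|M. norm (iexp (t * Y x) - iexp (t * Z x)))"
    by (rule integral_norm_bound)
  also have "\<dots> \<le> (LINT x|M. \<bar>t\<bar> * \<bar>Y x - Z x\<bar>)"
  proof (rule integral_mono)
    show "integrable M (\<lambda>x. norm (iexp (t * Y x) - iexp (t * Z x)))"
      by (intro integrable_norm Bochner_Integration.integrable_diff i) auto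
    show "integrable M (\<lambda>x. \<bar>t\<bar> * \<bar>Y x - Z x\<bar>)" using d by simp
  qed (rule pt)
  finally show ?thesis by simp
qed

context sde_fbm
begin

text \<open>Fubini moves the expectation under the integral over \<open>u\<close>, whose range has
  length at most \<open>p * \<Delta>\<close>. At each fixed \<open>u\<close> the drift can almost
  surely be replaced by \<open>f\<close> of the solution, and \<open>b\<close> applies.\<close>

lemma integrated_sum_bound:
  assumes a: "zero_sum_filter p a" and n: "p < n" and \<Delta>: "0 < \<Delta>" "real n * \<Delta> \<le> 1" and i: "i \<le> p"
    and b: "\<And>u. 0 \<le> u \<Longrightarrow> u \<le> real p * \<Delta> \<Longrightarrow>
      expectation (\<lambda>\<omega>. \<bar>\<Sum>j=1..n - p. filter_increment p a \<Delta> B j \<omega> * f (real j * \<Delta> + u) (X (real j * \<Delta> + u) \<omega>)\<bar>) \<le> b"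
  defines "Y \<equiv> \<lambda>\<omega>. LINT u|lborel. indicator {0<..real i * \<Delta>} u * (\<Sum>j=1..n - p. filter_increment p a \<Delta> B j \<omega> * drift (real j * \<Delta> + u) \<omega>)"
  shows "integrable M Y" "expectation (\<lambda>\<omega>. \<bar>Y \<omega>\<bar>) \<le> real p * \<Delta> * b"
proof -
  interpret P: pair_sigma_finite lborel M ..
  define D where "D j = filter_increment p a \<Delta> B j" for j
  have \<Delta>0: "0 \<le> \<Delta>" using \<Delta> by simp
  have ip: "real i * \<Delta> \<le> real p * \<Delta>" using i \<Delta> by (intro mult_right_mono) auto
  have jp: "real (j + p) * \<Delta> \<le> 1" if "j \<in> {1..n - p}" for j
  proof -
    have "real (j + p) * \<Delta> \<le> real n * \<Delta>" using that n \<Delta> by (intro mult_right_mono) auto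
    then show ?thesis using \<Delta>(2) by (rule order_trans)
  qed
  have D_meas[measurable]: "D j \<in> borel_measurable M" if "j \<in> {1..n - p}" for j
    unfolding D_def by (rule increments(1)[OF a \<Delta>0 jp[OF that] jp[OF that]])
  have D_int: "integrable M (D j)" if "j \<in> {1..n - p}" for j
    using increments(2)[OF a \<Delta>0 jp[OF that] jp[OF that], of 1] by (simp add: D_def)
  define S where "S u \<omega> = (\<Sum>j=1..n - p. D j \<omega> * drift (real j * \<Delta> + u) \<omega>)" for u \<omega>
  have [measurable]: "(\<lambda>z. drift (c + fst z) (snd z)) \<in> borel_measurable (lborel \<Otimes>\<^sub>M M)" for c
  proof -
    have "(\<lambda>z. (c + fst z, snd z)) \<in> measurable (lborel \<Otimes>\<^sub>M M) (lborel \<Otimes>\<^sub>M M)" by measurable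
    from measurable_compose[OF this measurable_drift] show ?thesis by simp
  qed
  define F where "F z = indicator {0<..real i * \<Delta>} (fst z) * S (fst z) (snd z)" for z :: "real \<times> 'a"
  have F_meas[measurable]: "F \<in> borel_measurable (lborel \<Otimes>\<^sub>M M)"
    unfolding F_def[abs_def] S_def by measurable
  have S_meas: "(\<lambda>\<omega>. S u \<omega>) \<in> borel_measurable M" for u
  proof -
    have "(\<lambda>z. S (fst z) (snd z)) \<in> borel_measurable (lborel \<Otimes>\<^sub>M M)" unfolding S_def by measurable
    from measurable_compose[OF measurable_Pair1'[of u lborel M] this] show ?thesis by simp
  qed
  have iS: "integrable M (S u)" for u
  proof (rule Bochner_Integration.integrable_bound)
    show "integrable M (\<lambda>\<omega>. \<Sum>j=1..n - p. \<bar>D j \<omega>\<bar> * K)"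
      by (intro Bochner_Integration.integrable_sum integrable_mult_left integrable_abs D_int) auto
    show "AE \<omega> in M. norm (S u \<omega>) \<le> norm (\<Sum>j=1..n - p. \<bar>D j \<omega>\<bar> * K)"
    proof (rule AE_I2)
      fix \<omega>
      have "\<bar>S u \<omega>\<bar> \<le> (\<Sum>j=1..n - p. \<bar>D j \<omega> * drift (real j * \<Delta> + u) \<omega>\<bar>)" unfolding S_def by (rule sum_abs)
      also have "\<dots> \<le> (\<Sum>j=1..n - p. \<bar>D j \<omega>\<bar> * K)"
        unfolding abs_mult by (intro sum_mono mult_left_mono drift_le) auto
      finally show "norm (S u \<omega>) \<le> norm (\<Sum>j=1..n - p. \<bar>D j \<omega>\<bar> * K)" by simp
    qed
  qed (rule S_meas)
  have eS: "expectation (\<lambda>\<omega>. \<bar>S u \<omega>\<bar>) \<le> b" if u: "0 \<le> u" "u \<le> real p * \<Delta>" for u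
  proof -
    have t: "real j * \<Delta> + u \<in> {0..1}" if "j \<in> {1..n - p}" for j
    proof -
      have "real j * \<Delta> + u \<le> real (j + p) * \<Delta>" using u by (simp add: distrib_right)
      also have "\<dots> \<le> 1" by (rule jp[OF that])
      finally show ?thesis using u \<Delta> by simp
    qed
    have "AE \<omega> in M. S u \<omega> = (\<Sum>j=1..n - p. filter_increment p a \<Delta> B j \<omega> * f (real j * \<Delta> + u) (X (real j * \<Delta> + u) \<omega>))"
      using AE_drift
    proof eventually_elim
      case (elim \<omega>)
      show ?case unfolding S_def D_def using elim t by (intro sum.cong refl) auto
    qed
    then have ae: "AE \<omega> in M. \<bar>S u \<omega>\<bar> = \<bar>\<Sum>j=1..n - p. filter_increment p a \<Delta> B j \<omega> * f (real j * \<Delta> + u) (X (real j * \<Delta> + u) \<omega>)\<bar>"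
      by eventually_elim simp
    have "(\<lambda>\<omega>. \<Sum>j=1..n - p. filter_increment p a \<Delta> B j \<omega> * f (real j * \<Delta> + u) (X (real j * \<Delta> + u) \<omega>)) \<in> borel_measurable M"
    proof (intro borel_measurable_sum borel_measurable_times)
      fix j assume j: "j \<in> {1..n - p}"
      show "filter_increment p a \<Delta> B j \<in> borel_measurable M" using D_meas[OF j] by (simp add: D_def)
      have "continuous_on UNIV (f (real j * \<Delta> + u))"
        using f_deriv(1)[OF t[OF j]] by (intro continuous_at_imp_continuous_on) (auto intro: DERIV_isCont)
      from measurable_compose[OF measurable_X[OF t[OF j]] borel_measurable_continuous_onI[OF this]]
      show "(\<lambda>\<omega>. f (real j * \<Delta> + u) (X (real j * \<Delta> + u) \<omega>)) \<in> borel_measurable M" .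
    qed
    then have "expectation (\<lambda>\<omega>. \<bar>S u \<omega>\<bar>) = expectation (\<lambda>\<omega>. \<bar>\<Sum>j=1..n - p. filter_increment p a \<Delta> B j \<omega> * f (real j * \<Delta> + u) (X (real j * \<Delta> + u) \<omega>)\<bar>)"
      using S_meas by (intro integral_cong_AE ae borel_measurable_abs)
    also have "\<dots> \<le> b" by (rule b[OF u])
    finally show ?thesis .
  qed
  have "0 \<le> expectation (\<lambda>\<omega>. \<bar>S 0 \<omega>\<bar>)" by (rule integral_nonneg_AE) simp
  then have b0: "0 \<le> b" by (rule order_trans) (rule eS, use \<Delta> in auto)
  have iind: "integrable lborel (\<lambda>u. b * indicator {0<..real i * \<Delta>} u)"
    by (intro integrable_mult_right integrable_real_indicator) (use \<Delta> in auto)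
  have inner_le: "(\<integral>\<omega>. norm (F (u, \<omega>)) \<partial>M) \<le> b * indicator {0<..real i * \<Delta>} u" for u
  proof (cases "u \<in> {0<..real i * \<Delta>}")
    case True
    then show ?thesis using eS[of u] ip by (simp add: F_def)
  next
    case False
    then show ?thesis by (simp add: F_def)
  qed
  have int_norm: "integrable lborel (\<lambda>u. \<integral>\<omega>. norm (F (u, \<omega>)) \<partial>M)"
  proof (rule Bochner_Integration.integrable_bound[OF iind])
    show "AE u in lborel. norm (\<integral>\<omega>. norm (F (u, \<omega>)) \<partial>M) \<le> norm (b * indicator {0<..real i * \<Delta>} u)"
    proof (rule AE_I2)
      fix u
      have "0 \<le> (\<integral>\<omega>. norm (F (u, \<omega>)) \<partial>M)" by (rule integral_nonneg_AE) simp
      then show "norm (\<integral>\<omega>. norm (F (u, \<omega>)) \<partial>M) \<le> norm (b * indicator {0<..real i * \<Delta>} u)"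
        using inner_le[of u] by simp
    qed
  qed measurable
  have iF: "integrable (lborel \<Otimes>\<^sub>M M) F"
    by (rule P.Fubini_integrable[OF F_meas int_norm]) (simp add: F_def iS)
  have iF': "integrable (lborel \<Otimes>\<^sub>M M) (case_prod (\<lambda>u \<omega>. F (u, \<omega>)))" using iF by simp
  have Y: "Y \<omega> = (\<integral>u. F (u, \<omega>) \<partial>lborel)" for \<omega>
    by (simp add: Y_def F_def S_def D_def)
  show iY: "integrable M Y"
    using P.integrable_snd[OF iF'] by (simp add: Y[abs_def])
  have inF: "integrable (lborel \<Otimes>\<^sub>M M) (case_prod (\<lambda>u \<omega>. norm (F (u, \<omega>))))"
    using integrable_norm[OF iF] by (simp add: case_prod_beta')
  have "expectation (\<lambda>\<omega>. \<bar>Y \<omega>\<bar>) \<le> expectation (\<lambda>\<omega>. \<integral>u. norm (F (u, \<omega>)) \<partial>lborel)"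
  proof (rule integral_mono[OF integrable_abs[OF iY] P.integrable_snd[OF inF]])
    show "\<bar>Y \<omega>\<bar> \<le> (\<integral>u. norm (F (u, \<omega>)) \<partial>lborel)" for \<omega>
      unfolding Y real_norm_def[symmetric] by (rule integral_norm_bound)
  qed
  also have "\<dots> = (\<integral>u. (\<integral>\<omega>. norm (F (u, \<omega>)) \<partial>M) \<partial>lborel)"
    by (rule P.Fubini_integral[OF inF])
  also have "\<dots> \<le> (LINT u|lborel. b * indicator {0<..real i * \<Delta>} u)"
    by (intro integral_mono int_norm iind inner_le)
  also have "\<dots> = b * (real i * \<Delta>)" using \<Delta> by simp
  also have "\<dots> \<le> real p * \<Delta> * b" using mult_left_mono[OF ip b0] by (simp add: mult.commute)
  finally show "expectation (\<lambda>\<omega>. \<bar>Y \<omega>\<bar>) \<le> real p * \<Delta> * b" .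
qed

text \<open>A filtered increment of \<open>X\<close> is \<open>D j + E j\<close> with
  \<open>E j\<close> coming from the drift, so the squares differ by
  \<open>2 * D j * E j + (E j)^2\<close>. The second term is bounded pathwise; the first is
  estimated only after summation over \<open>j\<close>, where the weak correlation of the
  \<open>D j\<close> can be exploited.\<close>

lemma quadratic_variation_difference:
  assumes a: "zero_sum_filter p a" and pos: "0 < filter_cov H p a 0" and n: "p < n" and \<Delta>: "0 < \<Delta>" "real n * \<Delta> \<le> 1"
    and b: "\<And>u. 0 \<le> u \<Longrightarrow> u \<le> real p * \<Delta> \<Longrightarrow>
      expectation (\<lambda>\<omega>. \<bar>\<Sum>j=1..n - p. filter_increment p a \<Delta> B j \<omega> * f (real j * \<Delta> + u) (X (real j * \<Delta> + u) \<omega>)\<bar>) \<le> b"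
  defines "d \<equiv> \<lambda>\<omega>. sqrt (real n) * quadratic_variation H p a n \<Delta> X \<omega> - sqrt (real n) * quadratic_variation H p a n \<Delta> B \<omega>"
    and "a1 \<equiv> \<Sum>i\<le>p. \<bar>a i\<bar>"
  assumes d_meas: "d \<in> borel_measurable M"
  shows "integrable M d"
    and "expectation (\<lambda>\<omega>. \<bar>d \<omega>\<bar>) \<le> (2 * (a1 * (real p * \<Delta> * b)) + real n * (a1 * (K * (real p * \<Delta>)))\<^sup>2) / (sqrt (real n) * increment_variance H p a \<Delta>)"
proof -
  define D where "D j = filter_increment p a \<Delta> B j" for j
  define A where "A t \<omega> = (LBINT s:{0..t}. drift s \<omega>)" for t \<omega>
  \<comment> \<open>Subtracting the value at the base point changes nothing in the filtered sum, as
    the coefficients sum to zero, and shows that \<open>E j\<close> is of order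
    \<open>\<Delta>\<close>.\<close>
  define E where "E j \<omega> = (\<Sum>i\<le>p. a i * (A (real (i + j) * \<Delta>) \<omega> - A (real j * \<Delta>) \<omega>))" for j \<omega>
  define Y where "Y i \<omega> = (LINT u|lborel. indicator {0<..real i * \<Delta>} u * (\<Sum>j=1..n - p. D j \<omega> * drift (real j * \<Delta> + u) \<omega>))" for i \<omega>
  define V where "V = increment_variance H p a \<Delta>"
  define q where "q = sqrt (real n) * V"
  have V: "V > 0" using pos \<Delta> by (simp add: V_def increment_variance_eq)
  have q: "q > 0" using V n by (simp add: q_def)
  have a1: "a1 \<ge> 0" unfolding a1_def by (rule sum_nonneg) simp
  note Y_bound = integrated_sum_bound[OF a n \<Delta> _ b, folded D_def, folded Y_def]
  have t: "real (i + j) * \<Delta> \<in> {0..1}" if "i \<le> p" "j \<in> {1..n - p}" for i j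
  proof -
    have "real (i + j) * \<Delta> \<le> real n * \<Delta>" using that n \<Delta> by (intro mult_right_mono) auto
    then have "real (i + j) * \<Delta> \<le> 1" using \<Delta>(2) by (rule order_trans)
    then show ?thesis using \<Delta> by simp
  qed
  have z: "(\<Sum>i\<le>p. a i) = 0" using a by (simp add: zero_sum_filter_def)
  have E_le: "\<bar>E j \<omega>\<bar> \<le> a1 * (K * (real p * \<Delta>))" if \<omega>: "\<omega> \<in> space M" for j \<omega>
  proof -
    have "\<bar>A (real (i + j) * \<Delta>) \<omega> - A (real j * \<Delta>) \<omega>\<bar> \<le> K * (real p * \<Delta>)" if "i \<le> p" for i
    proof -
      have "\<bar>A (real (i + j) * \<Delta>) \<omega> - A (real j * \<Delta>) \<omega>\<bar> \<le> K * (real (i + j) * \<Delta> - real j * \<Delta>)"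
        unfolding A_def using \<Delta> by (intro drift_increment(2)[OF \<omega>] mult_right_mono) auto
      also have "real (i + j) * \<Delta> - real j * \<Delta> = real i * \<Delta>" by (simp add: distrib_right)
      also have "K * (real i * \<Delta>) \<le> K * (real p * \<Delta>)"
        using that \<Delta> K(1) by (intro mult_left_mono mult_right_mono) auto
      finally show ?thesis .
    qed
    then have "(\<Sum>i\<le>p. \<bar>a i * (A (real (i + j) * \<Delta>) \<omega> - A (real j * \<Delta>) \<omega>)\<bar>) \<le> (\<Sum>i\<le>p. \<bar>a i\<bar> * (K * (real p * \<Delta>)))"
      unfolding abs_mult by (intro sum_mono mult_left_mono) auto
    then show ?thesis unfolding E_def a1_def sum_distrib_right using sum_abs order_trans by fast
  qed
  \<comment> \<open>Exchanging the sum over \<open>j\<close> with the filter sum and with the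
    integral over \<open>u\<close> produces integrals of exactly the weighted sums that
    \<open>b\<close> controls.\<close>
  have cross: "(\<Sum>j=1..n - p. D j \<omega> * E j \<omega>) = (\<Sum>i\<le>p. a i * Y i \<omega>)" if \<omega>: "\<omega> \<in> space M" for \<omega>
  proof -
    have [measurable]: "(\<lambda>t. drift t \<omega>) \<in> borel_measurable borel" using measurable_drift_section[OF \<omega>] by simp
    have ii: "integrable lborel (\<lambda>u. indicator {0<..real i * \<Delta>} u * drift (c + u) \<omega>)" for i c
    proof (rule Bochner_Integration.integrable_bound)
      show "integrable lborel (\<lambda>u. K * indicator {0<..real i * \<Delta>} u)"
        by (intro integrable_mult_right integrable_real_indicator) (use \<Delta> in auto)
      show "AE u in lborel. norm (indicator {0<..real i * \<Delta>} u * drift (c + u) \<omega>) \<le> norm (K * indicator {0<..real i * \<Delta>} u)"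
        using drift_le K(1) by (auto simp: indicator_def)
    qed measurable
    have Yi: "Y i \<omega> = (\<Sum>j=1..n - p. D j \<omega> * (A (real (i + j) * \<Delta>) \<omega> - A (real j * \<Delta>) \<omega>))" for i
    proof -
      have "Y i \<omega> = (LINT u|lborel. (\<Sum>j=1..n - p. D j \<omega> * (indicator {0<..real i * \<Delta>} u * drift (real j * \<Delta> + u) \<omega>)))"
        unfolding Y_def by (intro Bochner_Integration.integral_cong refl) (simp add: sum_distrib_left mult_ac)
      also have "\<dots> = (\<Sum>j=1..n - p. D j \<omega> * (LINT u|lborel. indicator {0<..real i * \<Delta>} u * drift (real j * \<Delta> + u) \<omega>))"
        by (simp add: ii Bochner_Integration.integral_sum)
      also have "\<dots> = (\<Sum>j=1..n - p. D j \<omega> * (A (real (i + j) * \<Delta>) \<omega> - A (real j * \<Delta>) \<omega>))"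
      proof (intro sum.cong refl)
        fix j
        have "A (real (i + j) * \<Delta>) \<omega> - A (real j * \<Delta>) \<omega> = (LINT u|lborel. indicator {0<..real (i + j) * \<Delta> - real j * \<Delta>} u * drift (real j * \<Delta> + u) \<omega>)"
          unfolding A_def using \<Delta> by (intro drift_increment(1)[OF \<omega>] mult_right_mono) auto
        also have "real (i + j) * \<Delta> - real j * \<Delta> = real i * \<Delta>" by (simp add: distrib_right)
        finally show "D j \<omega> * (LINT u|lborel. indicator {0<..real i * \<Delta>} u * drift (real j * \<Delta> + u) \<omega>) = D j \<omega> * (A (real (i + j) * \<Delta>) \<omega> - A (real j * \<Delta>) \<omega>)"
          by simp
      qed
      finally show ?thesis .
    qed
    have "(\<Sum>j=1..n - p. D j \<omega> * E j \<omega>) = (\<Sum>j=1..n - p. \<Sum>i\<le>p. a i * (D j \<omega> * (A (real (i + j) * \<Delta>) \<omega> - A (real j * \<Delta>) \<omega>)))"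
      unfolding E_def sum_distrib_left by (intro sum.cong refl) (simp only: mult_ac)
    also have "\<dots> = (\<Sum>i\<le>p. \<Sum>j=1..n - p. a i * (D j \<omega> * (A (real (i + j) * \<Delta>) \<omega> - A (real j * \<Delta>) \<omega>)))"
      by (rule sum.swap)
    finally show ?thesis unfolding Yi sum_distrib_left .
  qed
  define G where "G \<omega> = (2 * (\<Sum>i\<le>p. \<bar>a i\<bar> * \<bar>Y i \<omega>\<bar>) + real n * (a1 * (K * (real p * \<Delta>)))\<^sup>2) / q" for \<omega>
  have AE: "AE \<omega> in M. \<bar>d \<omega>\<bar> \<le> G \<omega>"
    using AE_drift AE_space
  proof eventually_elim
    case (elim \<omega>)
    have XE: "filter_increment p a \<Delta> X j \<omega> = D j \<omega> + E j \<omega>" if j: "j \<in> {1..n - p}" for j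
    proof -
      have "filter_increment p a \<Delta> X j \<omega> = (\<Sum>i\<le>p. a i * (x0 + A (real (i + j) * \<Delta>) \<omega> + B (real (i + j) * \<Delta>) \<omega>))"
        unfolding filter_increment_def A_def
        by (intro sum.cong refl arg_cong2[where f = "(*)"] bspec[OF elim(1), THEN conjunct2] t j) auto
      also have "\<dots> = (\<Sum>i\<le>p. a i) * (x0 + A (real j * \<Delta>) \<omega>) + E j \<omega> + D j \<omega>"
        unfolding E_def D_def filter_increment_def sum_distrib_right sum.distrib[symmetric]
        by (intro sum.cong refl) (simp add: algebra_simps)
      finally show ?thesis using z by simp
    qed
    have "d \<omega> = (1 / q) * (\<Sum>j=1..n - p. (filter_increment p a \<Delta> X j \<omega>)\<^sup>2 - (D j \<omega>)\<^sup>2)"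
    proof -
      have sq: "sqrt (real n) * (1 / real n) = 1 / sqrt (real n)" using n by (simp add: field_simps)
      have "d \<omega> = sqrt (real n) * (1 / real n) * (\<Sum>j=1..n - p. ((filter_increment p a \<Delta> X j \<omega>)\<^sup>2 / V - 1) - ((D j \<omega>)\<^sup>2 / V - 1))"
        unfolding d_def quadratic_variation_def V_def D_def sum_subtractf by (simp only: right_diff_distrib mult.assoc)
      also have "(\<Sum>j=1..n - p. ((filter_increment p a \<Delta> X j \<omega>)\<^sup>2 / V - 1) - ((D j \<omega>)\<^sup>2 / V - 1))
          = (1 / V) * (\<Sum>j=1..n - p. (filter_increment p a \<Delta> X j \<omega>)\<^sup>2 - (D j \<omega>)\<^sup>2)"
        unfolding sum_distrib_left by (intro sum.cong refl) (simp add: diff_divide_distrib)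
      finally show ?thesis unfolding sq q_def by simp
    qed
    also have "(\<Sum>j=1..n - p. (filter_increment p a \<Delta> X j \<omega>)\<^sup>2 - (D j \<omega>)\<^sup>2) = 2 * (\<Sum>j=1..n - p. D j \<omega> * E j \<omega>) + (\<Sum>j=1..n - p. (E j \<omega>)\<^sup>2)"
      unfolding sum_distrib_left sum.distrib[symmetric] by (intro sum.cong refl) (simp add: XE power2_sum)
    finally have "\<bar>d \<omega>\<bar> = \<bar>2 * (\<Sum>i\<le>p. a i * Y i \<omega>) + (\<Sum>j=1..n - p. (E j \<omega>)\<^sup>2)\<bar> / q"
      unfolding cross[OF elim(2)] using q by (simp add: abs_mult)
    also have "\<dots> \<le> G \<omega>"
    proof -
      have "\<bar>\<Sum>i\<le>p. a i * Y i \<omega>\<bar> \<le> (\<Sum>i\<le>p. \<bar>a i\<bar> * \<bar>Y i \<omega>\<bar>)"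
        unfolding abs_mult[symmetric] by (rule sum_abs)
      moreover have "(\<Sum>j=1..n - p. (E j \<omega>)\<^sup>2) \<le> real n * (a1 * (K * (real p * \<Delta>)))\<^sup>2"
      proof -
        have "(E j \<omega>)\<^sup>2 \<le> (a1 * (K * (real p * \<Delta>)))\<^sup>2" for j
          using E_le[OF elim(2), of j] a1 K(1) \<Delta> by (intro power2_le_iff_abs_le[THEN iffD2]) auto
        then have "(\<Sum>j=1..n - p. (E j \<omega>)\<^sup>2) \<le> (\<Sum>j=1..n - p. (a1 * (K * (real p * \<Delta>)))\<^sup>2)" by (rule sum_mono)
        also have "\<dots> = real (n - p) * (a1 * (K * (real p * \<Delta>)))\<^sup>2" by simp
        also have "\<dots> \<le> real n * (a1 * (K * (real p * \<Delta>)))\<^sup>2" by (intro mult_right_mono) auto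
        finally show ?thesis .
      qed
      moreover have "0 \<le> (\<Sum>j=1..n - p. (E j \<omega>)\<^sup>2)" by (rule sum_nonneg) simp
      ultimately show ?thesis unfolding G_def using q by (intro divide_right_mono) linarith+
    qed
    finally show ?case .
  qed
  have iG: "integrable M G"
    unfolding G_def[abs_def] by (intro integrable_divide_zero Bochner_Integration.integrable_add integrable_mult_right
        Bochner_Integration.integrable_sum integrable_abs Y_bound(1)) auto
  show id: "integrable M d"
    by (rule Bochner_Integration.integrable_bound[OF iG d_meas]) (use AE in eventually_elim, auto)
  have "expectation (\<lambda>\<omega>. \<bar>d \<omega>\<bar>) \<le> expectation G"
    by (rule integral_mono_AE[OF integrable_abs[OF id] iG AE])
  also have "\<dots> = (2 * (\<Sum>i\<le>p. \<bar>a i\<bar> * expectation (\<lambda>\<omega>. \<bar>Y i \<omega>\<bar>)) + real n * (a1 * (K * (real p * \<Delta>)))\<^sup>2) / q"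
  proof -
    have i1: "integrable M (\<lambda>\<omega>. \<bar>a i\<bar> * \<bar>Y i \<omega>\<bar>)" if "i \<in> {..p}" for i
      using that by (intro integrable_mult_right integrable_abs Y_bound(1)) simp
    have "expectation (\<lambda>\<omega>. \<Sum>i\<le>p. \<bar>a i\<bar> * \<bar>Y i \<omega>\<bar>) = (\<Sum>i\<le>p. \<bar>a i\<bar> * expectation (\<lambda>\<omega>. \<bar>Y i \<omega>\<bar>))"
      by (subst Bochner_Integration.integral_sum[OF i1]) simp_all
    then show ?thesis
      unfolding G_def
      by (simp only: integral_divide_zero integral_mult_right_zero
          Bochner_Integration.integral_add[OF integrable_mult_right[OF Bochner_Integration.integrable_sum[OF i1]] integrable_const])
        (simp add: prob_space)
  qed
  also have "\<dots> \<le> (2 * (a1 * (real p * \<Delta> * b)) + real n * (a1 * (K * (real p * \<Delta>)))\<^sup>2) / q"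
  proof -
    have "(\<Sum>i\<le>p. \<bar>a i\<bar> * expectation (\<lambda>\<omega>. \<bar>Y i \<omega>\<bar>)) \<le> (\<Sum>i\<le>p. \<bar>a i\<bar> * (real p * \<Delta> * b))"
      by (intro sum_mono mult_left_mono Y_bound(2)) auto
    also have "\<dots> = a1 * (real p * \<Delta> * b)" by (simp add: a1_def sum_distrib_right)
    finally show ?thesis using q by (intro divide_right_mono) auto
  qed
  finally show "expectation (\<lambda>\<omega>. \<bar>d \<omega>\<bar>) \<le> (2 * (a1 * (real p * \<Delta> * b)) + real n * (a1 * (K * (real p * \<Delta>)))\<^sup>2) / (sqrt (real n) * increment_variance H p a \<Delta>)"
    by (simp only: q_def V_def)
qed

end

context sde_fbm
begin

text \<open>The difference of the scaled quadratic variations tends to 0 in mean, hence so does the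
  difference of the characteristic functions, and the limit for \<open>B\<close> carries over to
  \<open>X\<close>.\<close>

theorem quadratic_variation_clt_solution:
  assumes "clt_filter H p m a" and \<alpha>: "1 \<le> \<alpha>" "\<alpha> * (1 - H) > 1 / 4"
  shows "quadratic_variation_clt M H p a \<alpha> X (clt_variance H p a)"
proof -
  interpret clt_filter H p m a by fact
  define \<kappa> where "\<kappa> = max 1 ((2 - s + H) / 2)"
  define bd where "bd n \<Delta> = \<Delta> powr (3 * H / 2) * log 2 (2 * real n) * (2 * real n) powr \<kappa>
        + \<Delta> powr H * (2 * real n) powr (1 - s / 2)" for n :: nat and \<Delta> :: real
  obtain C where C: "C \<ge> 0" and Cb: "\<And>n \<Delta> u. p < n \<Longrightarrow> 0 < \<Delta> \<Longrightarrow> real n * \<Delta> \<le> 1 \<Longrightarrow> 0 \<le> u \<Longrightarrow> u \<le> real p * \<Delta> \<Longrightarrow>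
    expectation (\<lambda>\<omega>. \<bar>\<Sum>j=1..n - p. filter_increment p a \<Delta> B j \<omega> * f (real j * \<Delta> + u) (X (real j * \<Delta> + u) \<omega>)\<bar>) \<le> C * bd n \<Delta>"
    using weighted_sum_bound[OF assms(1)] unfolding \<kappa>_def[symmetric] bd_def by blast
  define a1 where "a1 = (\<Sum>i\<le>p. \<bar>a i\<bar>)"
  define qX where "qX n \<omega> = sqrt (real n) * quadratic_variation H p a n (real n powr (- \<alpha>)) X \<omega>" for n \<omega>
  define qB where "qB n \<omega> = sqrt (real n) * quadratic_variation H p a n (real n powr (- \<alpha>)) B \<omega>" for n \<omega>
  have meas: "qX n \<in> borel_measurable M" "qB n \<in> borel_measurable M" for n
  proof -
    have "(\<lambda>\<omega>. sqrt (real n) * quadratic_variation H p a n (real n powr (- \<alpha>)) Z \<omega>) \<in> borel_measurable M"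
      if "\<And>t. t \<in> {0..1} \<Longrightarrow> Z t \<in> borel_measurable M" for Z n
      by (intro borel_measurable_times borel_measurable_const measurable_quadratic_variation[OF that \<alpha>(1)])
    then show "qX n \<in> borel_measurable M" "qB n \<in> borel_measurable M"
      unfolding qX_def[abs_def] qB_def[abs_def] using measurable_X measurable_B by blast+
  qed
  \<comment> \<open>Exponents of \<open>n\<close> after inserting
    \<open>\<Delta> = n powr (- \<alpha>)\<close> and dividing by
    \<open>sqrt n * \<Delta> powr (2 * H)\<close>: \<open>e1\<close> for the chained part of the
    cross term, \<open>e2\<close> for its part with a fixed or deterministic argument,
    \<open>e3\<close> for the squared drift.\<close>
  define e1 e2 e3 where "e1 = \<kappa> - 1 / 2 - \<alpha> * (1 - H / 2)" and "e2 = (1 - s) / 2 - \<alpha> * (1 - H)" and "e3 = 1 / 2 - 2 * (\<alpha> * (1 - H))"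
  \<comment> \<open>For \<open>\<kappa> = 1\<close> the claim on \<open>e1\<close> follows from
    \<open>\<alpha> >= 1\<close> and \<open>H < 1\<close>. Otherwise
    \<open>(1 - s + H) / 2 < 1/4 + H / 2\<close>, and \<open>\<alpha> * (1 - H / 2)\<close> splits
    into \<open>\<alpha> * (1 - H) > 1/4\<close> and \<open>\<alpha> * H / 2 >= H / 2\<close>. For
    \<open>e2\<close> the point is \<open>(1 - s) / 2 < 1/4\<close>.\<close>
  have e: "e1 < 0" "e2 < 0" "e3 < 0"
  proof -
    have split: "\<alpha> * (1 - H / 2) = \<alpha> * (1 - H) + \<alpha> * H / 2" by (simp add: algebra_simps)
    have f1: "1 * (1 - H / 2) \<le> \<alpha> * (1 - H / 2)" and f2: "1 * H \<le> \<alpha> * H"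
      using \<alpha> H01 by (auto intro!: mult_right_mono)
    have "1 - 1 / 2 < 1 * (1 - H / 2)" using H01 by simp
    then have "1 - 1 / 2 < \<alpha> * (1 - H / 2)" using f1 by (rule less_le_trans)
    moreover have "(2 - s + H) / 2 - 1 / 2 < \<alpha> * (1 - H / 2)"
    proof -
      have "(2 - s' + h) / 2 - 1 / 2 < u + v / 2" if "1 / 4 < u" "1 * h \<le> v" "1 / 2 < s'" for s' h u v :: real
        using that by (simp add: field_simps)
      then show ?thesis unfolding split using \<alpha>(2) f2 s(1) .
    qed
    ultimately show "e1 < 0" unfolding e1_def \<kappa>_def max_def by simp
    show "e2 < 0" "e3 < 0" using \<alpha>(2) s by (auto simp: e2_def e3_def)
  qed
  define c1 c2 c3 where "c1 = 2 * a1 * real p * C * 2 powr \<kappa> / \<gamma>" and "c2 = 2 * a1 * real p * C * 2 powr (1 - s / 2) / \<gamma>"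
    and "c3 = (a1 * K * real p)\<^sup>2 / \<gamma>"
  define rate where "rate n = c1 * (real n powr e1 * log 2 (2 * real n)) + c2 * real n powr e2 + c3 * real n powr e3" for n :: nat
  have rate: "rate \<longlonglongrightarrow> 0"
  proof -
    have "(\<lambda>n. real n powr e1 * log 2 (2 * real n)) \<longlonglongrightarrow> 0" "(\<lambda>n. real n powr e2) \<longlonglongrightarrow> 0" "(\<lambda>n. real n powr e3) \<longlonglongrightarrow> 0"
      using e by real_asymp+
    then have "rate \<longlonglongrightarrow> c1 * 0 + c2 * 0 + c3 * 0"
      unfolding rate_def[abs_def] by (intro tendsto_intros)
    then show ?thesis by simp
  qed
  have diff: "integrable M (\<lambda>\<omega>. qX n \<omega> - qB n \<omega>) \<and> expectation (\<lambda>\<omega>. \<bar>qX n \<omega> - qB n \<omega>\<bar>) \<le> rate n" if n: "p < n" for n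
  proof -
    define \<Delta> where "\<Delta> = real n powr (- \<alpha>)"
    define x where "x = real n"
    have x: "x > 0" using n by (simp add: x_def)
    have \<Delta>: "0 < \<Delta>" "real n * \<Delta> \<le> 1" using n sampling_time_le_1[OF \<alpha>(1), of n n] by (simp_all add: \<Delta>_def)
    have dm: "(\<lambda>\<omega>. sqrt (real n) * quadratic_variation H p a n \<Delta> X \<omega> - sqrt (real n) * quadratic_variation H p a n \<Delta> B \<omega>) \<in> borel_measurable M"
      using meas[of n] unfolding qX_def[abs_def] qB_def[abs_def] \<Delta>_def by (rule borel_measurable_diff)
    note qd = quadratic_variation_difference[OF a \<gamma>_pos n \<Delta> Cb[OF n \<Delta>] dm, folded a1_def]
    have pw: "\<Delta> powr e = x powr (- \<alpha> * e)" for e by (simp add: \<Delta>_def x_def powr_powr)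
    have \<Delta>x: "\<Delta> = x powr (- \<alpha>)" by (simp add: \<Delta>_def x_def)
    have "(2 * (a1 * (real p * \<Delta> * (C * bd n \<Delta>))) + real n * (a1 * (K * (real p * \<Delta>)))\<^sup>2) / (sqrt (real n) * increment_variance H p a \<Delta>) = rate n"
    proof -
      define lg where "lg = log 2 (2 * real n)"
      have den: "1 / (sqrt (real n) * increment_variance H p a \<Delta>) = x powr (- 1 / 2) * x powr (2 * \<alpha> * H) / \<gamma>"
      proof -
        have "sqrt (real n) = x powr (1 / 2)" using x by (simp add: x_def powr_half_sqrt)
        then show ?thesis
          unfolding increment_variance_eq pw using x by (simp add: powr_minus field_simps flip: powr_add)
      qed
      have bd: "bd n \<Delta> = x powr (- \<alpha> * (3 * H / 2)) * lg * (2 powr \<kappa> * x powr \<kappa>) + x powr (- \<alpha> * H) * (2 powr (1 - s / 2) * x powr (1 - s / 2))"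
        unfolding bd_def pw lg_def using x by (simp add: x_def powr_mult)
      have sq: "real n * (a1 * (K * (real p * \<Delta>)))\<^sup>2 = (a1 * K * real p)\<^sup>2 * (x powr 1 * (x powr (- \<alpha>) * x powr (- \<alpha>)))"
        unfolding \<Delta>x using x by (simp add: power_mult_distrib power2_eq_square x_def mult_ac)
      have alg: "(2 * (a1 * (P * y * (C * (u * lg * (k * v) + w * (k' * z))))) + q * o') * (h * t / g)
        = (2 * a1 * P * C * k / g) * ((y * u * v * h * t) * lg) + (2 * a1 * P * C * k' / g) * (y * w * z * h * t) + (q / g) * (o' * h * t)"
        for P y u k v w k' z q o' h t g :: real
        by (simp add: algebra_simps add_divide_distrib)
      have "(2 * (a1 * (real p * \<Delta> * (C * bd n \<Delta>))) + real n * (a1 * (K * (real p * \<Delta>)))\<^sup>2) / (sqrt (real n) * increment_variance H p a \<Delta>)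
        = (2 * (a1 * (real p * \<Delta> * (C * bd n \<Delta>))) + real n * (a1 * (K * (real p * \<Delta>)))\<^sup>2) * (1 / (sqrt (real n) * increment_variance H p a \<Delta>))"
        by simp
      also have "\<dots> = c1 * ((x powr (- \<alpha>) * x powr (- \<alpha> * (3 * H / 2)) * x powr \<kappa> * x powr (- 1 / 2) * x powr (2 * \<alpha> * H)) * lg)
        + c2 * (x powr (- \<alpha>) * x powr (- \<alpha> * H) * x powr (1 - s / 2) * x powr (- 1 / 2) * x powr (2 * \<alpha> * H))
        + c3 * (x powr 1 * (x powr (- \<alpha>) * x powr (- \<alpha>)) * x powr (- 1 / 2) * x powr (2 * \<alpha> * H))"
        unfolding bd sq den c1_def c2_def c3_def unfolding \<Delta>x by (rule alg)
      also have "x powr (- \<alpha>) * x powr (- \<alpha> * (3 * H / 2)) * x powr \<kappa> * x powr (- 1 / 2) * x powr (2 * \<alpha> * H) = x powr e1"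
        unfolding powr_add[symmetric] e1_def by (intro arg_cong2[where f = "(powr)"] refl) (simp add: field_simps)
      also have "x powr (- \<alpha>) * x powr (- \<alpha> * H) * x powr (1 - s / 2) * x powr (- 1 / 2) * x powr (2 * \<alpha> * H) = x powr e2"
        unfolding powr_add[symmetric] e2_def by (intro arg_cong2[where f = "(powr)"] refl) (simp add: field_simps)
      also have "x powr 1 * (x powr (- \<alpha>) * x powr (- \<alpha>)) * x powr (- 1 / 2) * x powr (2 * \<alpha> * H) = x powr e3"
        unfolding powr_add[symmetric] e3_def by (intro arg_cong2[where f = "(powr)"] refl) (simp add: field_simps)
      finally show ?thesis by (simp add: rate_def x_def lg_def)
    qed
    then show ?thesis using qd unfolding qX_def qB_def \<Delta>_def by simp
  qed
  show ?thesis
  proof (subst quadratic_variation_clt_iff[OF prob_space_axioms measurable_X \<alpha>(1) less_imp_le[OF clt_variance_pos]], assumption, intro allI)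
    fix t
    have lim: "(\<lambda>n. \<bar>t\<bar> * rate n) \<longlonglongrightarrow> 0" using tendsto_mult[OF tendsto_const rate, of "\<bar>t\<bar>"] by simp
    have "(\<lambda>n. (CLINT x|M. iexp (t * qX n x)) - (CLINT x|M. iexp (t * qB n x))) \<longlonglongrightarrow> 0"
    proof (rule Lim_null_comparison[OF _ lim])
      show "\<forall>\<^sub>F n in sequentially. norm ((CLINT x|M. iexp (t * qX n x)) - (CLINT x|M. iexp (t * qB n x))) \<le> \<bar>t\<bar> * rate n"
        using eventually_gt_at_top[of p]
      proof eventually_elim
        case (elim n)
        note d = diff[OF elim]
        have "norm ((CLINT x|M. iexp (t * qX n x)) - (CLINT x|M. iexp (t * qB n x))) \<le> \<bar>t\<bar> * expectation (\<lambda>x. \<bar>qX n x - qB n x\<bar>)"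
          by (rule norm_iexp_expectation_diff_le[OF meas]) (rule d[THEN conjunct1])
        also have "\<dots> \<le> \<bar>t\<bar> * rate n" by (rule mult_left_mono[OF d[THEN conjunct2]]) simp
        finally show ?case .
      qed
    qed
    from tendsto_add[OF this fbm_characteristic_function_tendsto[OF assms(1) \<alpha>(1), of t, folded qB_def]]
    show "(\<lambda>n. CLINT x|M. iexp (t * (sqrt (real n) * quadratic_variation H p a n (real n powr (- \<alpha>)) X x)))
      \<longlonglongrightarrow> of_real (exp (- (clt_variance H p a * t\<^sup>2) / 2))"
      by (simp add: qX_def)
  qed
qed

end

theorem theorem4:
  fixes M :: "'w measure"
    and B X :: "real \<Rightarrow> 'w \<Rightarrow> real"
    and f :: "real \<Rightarrow> real \<Rightarrow> real"
    and a :: "nat \<Rightarrow> real"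
    and H x \<alpha> :: real
    and p m :: nat
  assumes "prob_space M"
    and "1 / 2 \<le> H" and "H < 1"
    and "fractional_brownian_motion M {0..1} H B"
    and "C01b {0..1} f"
    and "sde_solution M x f B X"
    and "zero_sum_filter p a"
    and "has_filter_order p a m"
    and "real m > H + 1 / 4"
    and "\<alpha> \<ge> 1"
    and "\<alpha> > max ((2 * H - 1) / (2 - 2 * H)) (1 / (4 - 4 * H))"
  shows "quadratic_variation_clt M H p a \<alpha> X (fbm_clt_variance H p a)"
proof -
  have H: "0 < H" "H < 1" using assms by auto
  interpret sde_fbm M H B x f X
    using assms H by (simp add: sde_fbm_def sde_fbm_axioms_def fbm_def fbm_axioms_def)
  have F: "clt_filter H p m a"
    using assms H by (simp add: clt_filter_def)
  have "1 / (4 - 4 * H) < \<alpha>" using assms by simp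
  then have "1 / 4 < \<alpha> * (1 - H)" using H by (simp add: field_simps)
  then show ?thesis
    unfolding fbm_clt_variance_eq[OF F]
    by (rule quadratic_variation_clt_solution[OF F assms(10)])
qed

end
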